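(* Let $M\ge 1$, $L_1,\dots,L_M\in\mathbb{N}=\{1,2,\dots\}$, and $q_1,\dots,q_M\in\mathbb{R}[x]$ with $\deg q_j<2L_j$ and $q_j(0)=0$ for each $j$. Let $$P(x,y)=\prod_{j=1}^{M}\bigl(y+q_j(x)+i x^{2L_j}\bigr).$$ Let $1\le \mathfrak{p}<\infty$ and $Q\in\mathbb{C}\{x,y\}$. Then $Q\in\mathcal{I}^{\mathfrak{p}}_P$ if and only if for every $j=1,\dots,M$, $$O(2L_j,q_j,Q)\ \ge\ \sum_{i=1}^{M}O_{ij}-\left\lceil\frac{2L_j+1}{\mathfrak{p}}\right\rceil+1 .$$
   Context: $\mathbb{C}\{x,y\}$ denotes the ring of convergent power series in $(x,y)$ centered at $(0,0)$. A function $f$ is in $L^{\mathfrak{p}}_{loc}$ if it is defined on some neighborhood $U$ of $(0,0)$ in $\mathbb{R}^2$ and belongs to $L^{\mathfrak{p}}(U)$ with respect to Lebesgue measure. For a function $P$, $\mathcal{I}^{\mathfrak{p}}_P=\{Q\in\mathbb{C}\{x,y\}: Q/P\in L^{\mathfrak{p}}_{loc}\}$. For $Q\in\mathbb{C}\{x,y\}$, $q\in\mathbb{C}[x]$, $n\in\mathbb{N}$, $O(n,q,Q)$ denotes the largest $k$ such that $x^k$ divides $Q(x,x^ny-q(x))$. "Ord" of a one-variable power series is its order of vanishing at $0$. Given data $L_1,\dots,L_M$, $q_1,\dots,q_M$, define $O_{ij}=\min\{\mathrm{Ord}(q_j-q_i),2L_j,2L_i\}$ (so $O_{jj}=2L_j$).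 *)

theory Defs
  imports "HOL-Analysis.Analysis" "HOL-Computational_Algebra.Polynomial"
begin

text \<open>Convergent power series in two variables, represented by their coefficient
  arrays c i j (coefficient of x^i y^j).  Convergence: absolute convergence on
  some polydisc of positive radius.\<close>
definition conv_ps :: "(nat \<Rightarrow> nat \<Rightarrow> complex) \<Rightarrow> bool" where
  "conv_ps c \<longleftrightarrow> (\<exists>r>0. (\<lambda>(i,j). norm (c i j) * r ^ (i + j)) summable_on (UNIV :: (nat \<times> nat) set))"

definition ps_eval :: "(nat \<Rightarrow> nat \<Rightarrow> complex) \<Rightarrow> complex \<times> complex \<Rightarrow> complex" where
  "ps_eval c z = (\<Sum>\<^sub>\<infinity>(i,j)\<in>UNIV. c i j * fst z ^ i * snd z ^ j)"

text \<open>O(n,q,Q): the largest k such that x^k divides Q(x, x^n y - q(x)) in C{x,y},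
  i.e. Q(x, x^n y - q(x)) = x^k S(x,y) near the origin for a convergent series S.
  Value \<infinity> if all k qualify (i.e. Q = 0).\<close>
definition Oval :: "nat \<Rightarrow> complex poly \<Rightarrow> (nat \<Rightarrow> nat \<Rightarrow> complex) \<Rightarrow> enat" where
  "Oval n q c = Sup (enat ` {k. \<exists>d. conv_ps d \<and>
      (\<forall>\<^sub>F z in nhds (0::complex \<times> complex).
         ps_eval c (fst z, fst z ^ n * snd z - poly q (fst z)) = fst z ^ k * ps_eval d z)})"

definition Ord_poly :: "real poly \<Rightarrow> enat" where
  "Ord_poly p = (if p = 0 then \<infinity> else enat (order 0 p))"

definition Oij :: "(nat \<Rightarrow> nat) \<Rightarrow> (nat \<Rightarrow> real poly) \<Rightarrow> nat \<Rightarrow> nat \<Rightarrow> nat" where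
  "Oij L q i j = the_enat (min (Ord_poly (q j - q i)) (enat (min (2 * L j) (2 * L i))))"

definition enat_ge_int :: "enat \<Rightarrow> int \<Rightarrow> bool" where
  "enat_ge_int e m \<longleftrightarrow> e = \<infinity> \<or> (\<exists>k. e = enat k \<and> m \<le> int k)"

definition Lp_loc :: "real \<Rightarrow> (real \<times> real \<Rightarrow> complex) \<Rightarrow> bool" where
  "Lp_loc p f \<longleftrightarrow> (\<exists>U. open U \<and> (0::real \<times> real) \<in> U \<and>
      (\<lambda>z. indicator U z *\<^sub>R f z) \<in> borel_measurable lborel \<and>
      set_integrable lborel U (\<lambda>z. norm (f z) powr p))"

end

theory Submission
  imports Defs
begin

text \<open>
  Modulo terms of high order, which affect neither side, \<open>Q\<close> is a polynomial \<open>T\<close>. On the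
  region \<open>|y + q\<^sub>j(x)| \<sim> |x|\<^sup>s\<close> with \<open>0 \<le> s \<le> 2 L\<^sub>j\<close>, where the \<open>j\<close>-th factor of \<open>P\<close>
  is smallest, \<open>|P|\<close> is comparable to \<open>|x|\<close> to the power \<open>\<Sum>\<^sub>i min(s, O\<^sub>i\<^sub>j)\<close>, and \<open>|T|\<close> is
  bounded by \<open>|x|\<close> to the power \<open>\<nu>\<^sub>j(s)\<close>, the weighted order of \<open>T\<close> along the \<open>j\<close>-th curve.
  Hence \<open>|Q/P|\<^sup>p\<close> is integrable there if the weight
  \<open>p (\<nu>\<^sub>j(s) - \<Sum>\<^sub>i min(s, O\<^sub>i\<^sub>j)) + s + 1\<close> is positive for all these \<open>s\<close>, and the stated
  condition is positivity at \<open>s = 2 L\<^sub>j\<close>. Necessity is a lower bound on the region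
  \<open>s = 2 L\<^sub>j\<close>. For sufficiency, suppose the weight first becomes nonpositive at some smaller
  integer \<open>s\<close>. Then its slope there is negative, so \<open>T\<close> has fewer zeros than there are curves in
  the cluster of curves agreeing up to order \<open>s\<close>. Wherever the cluster splits, some branch again
  has fewer zeros than curves, and since \<open>p \<ge> 1\<close> the weight does not increase along it; this
  leads to a curve violating the condition at its end.
\<close>

section \<open>Leading forms along a curve\<close>

text \<open>Along one curve the weight has no convexity to exploit: the order \<open>nu\<close> is
  concave in s, while minus the sum of the minima is convex. Positivity at the two ends of a curve
  therefore does not by itself give positivity in between, and the argument has to move to other
  curves of the cluster. What makes this possible is that the increment of \<open>nu\<close> from n
  to n + 1 lies between the degree of the leading form at n + 1 and the order at 0 of the leading
  form at n. Passing to another curve of the cluster translates the leading form at n, so the orders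
  for the various branches are root multiplicities of one polynomial and add up to at most its
  degree. On a branch with fewer zeros than curves the weight changes by at most 1 - p. Truncation
  is harmless at the degree K, the sum of all 2 L_i, because near 0 |P| is at least a multiple of
  max(|x|, |y|)^K, so the tail divided by P is bounded. The ceiling in the condition expresses a
  strict inequality between an integer and (2 L_j + 1) / p.\<close>

definition ev :: "complex poly poly \<Rightarrow> complex \<Rightarrow> complex \<Rightarrow> complex" where
  "ev T x y = poly (poly T [:y:]) x"

text \<open>\<open>T(x, x^n t - q(x))\<close> as a polynomial in \<open>t\<close> with coefficients in \<open>\<complex>[x]\<close>; the case
  \<open>n = 0\<close> is the expansion of \<open>T\<close> along the curve \<open>y = -q(x)\<close>.\<close>
definition blow :: "complex poly poly \<Rightarrow> complex poly \<Rightarrow> nat \<Rightarrow> complex poly poly" where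
  "blow T q n = pcompose T [:-q, monom 1 n:]"

definition supp :: "complex poly poly \<Rightarrow> complex poly \<Rightarrow> (nat \<times> nat) set" where
  "supp T q = {(a, b). coeff (coeff (blow T q 0) b) a \<noteq> 0}"

text \<open>The support function of the Newton polygon of T in the coordinates x and y + q(x), at
  the weight (1, n); \<open>lform\<close> is the corresponding initial form at x = 1. For T = 0 the
  \<open>LEAST\<close> is unspecified, so T \<noteq> 0 is assumed wherever it has to be
  attained.\<close>

definition nu :: "complex poly poly \<Rightarrow> complex poly \<Rightarrow> nat \<Rightarrow> nat" where
  "nu T q n = (LEAST k. \<exists>b. coeff (coeff (blow T q n) b) k \<noteq> 0)"

definition lform :: "complex poly poly \<Rightarrow> complex poly \<Rightarrow> nat \<Rightarrow> complex poly" where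
  "lform T q n = map_poly (\<lambda>c. coeff c (nu T q n)) (blow T q n)"

lemma poly_poly_eq_sum: "poly (poly T Y) x = (\<Sum>b\<le>degree T. poly (coeff T b) x * poly Y x ^ b)"
  for T :: "complex poly poly"
  by (simp add: poly_altdef[of T] poly_sum)

lemma poly_poly_eq_ev: "poly (poly T Y) x = ev T x (poly Y x)"
  by (simp add: ev_def poly_poly_eq_sum)

lemma ev_blow: "ev (blow T q n) x t = ev T x (x ^ n * t - poly q x)"
  unfolding blow_def ev_def[of "pcompose _ _"]
  by (simp add: poly_pcompose poly_poly_eq_ev poly_monom algebra_simps)

text \<open>Blowing up is the expansion along the curve with t scaled by x^n, so a single support
  \<open>supp T q\<close> describes the situation for all n.\<close>

lemma coeff_blow: "coeff (blow T q n) b = monom 1 (n * b) * coeff (blow T q 0) b"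
proof -
  have "blow T q n = pcompose (blow T q 0) [:0, monom 1 n:]"
    unfolding blow_def by (simp add: pcompose_assoc[symmetric] pcompose_pCons)
  then show ?thesis
    by (simp only: coeff_pcompose_linear monom_power power_one)
qed

lemma coeff_coeff_blow:
  "coeff (coeff (blow T q n) b) k = (if n * b \<le> k then coeff (coeff (blow T q 0) b) (k - n * b) else 0)"
  by (subst coeff_blow) (simp add: coeff_monom_mult)

lemma blow_eq_0_iff: "blow T q n = 0 \<longleftrightarrow> T = 0"
  unfolding blow_def by (subst pcompose_eq_0_iff) (auto simp: monom_eq_0_iff)

lemma finite_supp: "finite (supp T q)"
proof (rule finite_subset)
  let ?A = "blow T q 0"
  show "supp T q \<subseteq> (\<Union>b\<le>degree ?A. {..degree (coeff ?A b)} \<times> {b})"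
    by (auto simp: supp_def intro!: le_degree)
qed auto

lemma ev_eq_sum_supp:
  "ev T x (t - poly q x) = (\<Sum>(a, b)\<in>supp T q. coeff (coeff (blow T q 0) b) a * x ^ a * t ^ b)"
proof -
  let ?A = "blow T q 0"
  have "ev T x (t - poly q x) = ev ?A x t" by (simp add: ev_blow)
  also have "\<dots> = (\<Sum>b\<le>degree ?A. poly (coeff ?A b) x * t ^ b)"
    by (simp add: ev_def poly_poly_eq_sum)
  also have "\<dots> = (\<Sum>b\<le>degree ?A. \<Sum>a\<le>degree (coeff ?A b). coeff (coeff ?A b) a * x ^ a * t ^ b)"
    by (simp add: poly_altdef sum_distrib_right)
  also have "\<dots> = (\<Sum>(b, a)\<in>(SIGMA b:{..degree ?A}. {..degree (coeff ?A b)}). coeff (coeff ?A b) a * x ^ a * t ^ b)"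
    by (rule sum.Sigma) auto
  also have "\<dots> = (\<Sum>(b, a)\<in>prod.swap ` supp T q. coeff (coeff ?A b) a * x ^ a * t ^ b)"
  proof (rule sum.mono_neutral_right)
    show "prod.swap ` supp T q \<subseteq> (SIGMA b:{..degree ?A}. {..degree (coeff ?A b)})"
      by (auto simp: supp_def intro!: le_degree)
    show "\<forall>i\<in>(SIGMA b:{..degree ?A}. {..degree (coeff ?A b)}) - prod.swap ` supp T q.
      (case i of (b, a) \<Rightarrow> coeff (coeff ?A b) a * x ^ a * t ^ b) = 0"
      by (force simp: supp_def image_iff)
  qed auto
  also have "\<dots> = (\<Sum>(a, b)\<in>supp T q. coeff (coeff ?A b) a * x ^ a * t ^ b)"
    by (subst sum.reindex) (auto intro!: sum.cong)
  finally show ?thesis .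
qed

lemma nu_attained:
  assumes "T \<noteq> 0"
  shows "\<exists>b. coeff (coeff (blow T q n) b) (nu T q n) \<noteq> 0"
  unfolding nu_def
proof (rule LeastI_ex)
  show "\<exists>k b. coeff (coeff (blow T q n) b) k \<noteq> 0"
    using assms blow_eq_0_iff[of T q n] by (metis coeff_0 poly_eqI)
qed

lemma coeff_blow_below_nu: "k < nu T q n \<Longrightarrow> coeff (coeff (blow T q n) b) k = 0"
  unfolding nu_def using not_less_Least by blast

lemma coeff_lform: "coeff (lform T q n) b = coeff (coeff (blow T q n) b) (nu T q n)"
  by (simp add: lform_def coeff_map_poly)

lemma coeff_lform': 
  "coeff (lform T q n) b = (if n * b \<le> nu T q n then coeff (coeff (blow T q 0) b) (nu T q n - n * b) else 0)"
  by (subst coeff_lform, subst coeff_coeff_blow) simp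

lemma lform_nonzero: "T \<noteq> 0 \<Longrightarrow> lform T q n \<noteq> 0"
  using nu_attained[of T q n] coeff_lform[of T q n] by (metis coeff_0)

lemma nu_le: "(a, b) \<in> supp T q \<Longrightarrow> nu T q n \<le> a + n * b"
  using coeff_blow_below_nu[of "a + n * b" T q n b] coeff_coeff_blow[of T q n b "a + n * b"]
  by (force simp: supp_def)

lemma coeff_lform_supp:
  "coeff (lform T q n) b \<noteq> 0 \<Longrightarrow> \<exists>a. (a, b) \<in> supp T q \<and> a + n * b = nu T q n"
  by (rule exI[of _ "nu T q n - n * b"]) (auto simp: coeff_lform' supp_def split: if_splits)

text \<open>The top monomial of the leading form at n + 1 also competes in the minimum at n, where
  its weighted degree is smaller by its exponent of t.\<close>

lemma degree_lform_le:
  assumes "T \<noteq> 0"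
  shows "nu T q n + degree (lform T q (Suc n)) \<le> nu T q (Suc n)"
proof -
  obtain a where "(a, degree (lform T q (Suc n))) \<in> supp T q"
     "a + Suc n * degree (lform T q (Suc n)) = nu T q (Suc n)"
    using coeff_lform_supp lform_nonzero[OF assms] by (metis leading_coeff_0_iff)
  then show ?thesis using nu_le[of a _ T q n] by fastforce
qed

text \<open>The lowest monomial of the leading form at n competes in the minimum at n + 1, where its
  weighted degree is larger by its exponent of t, the order at 0.\<close>

lemma nu_Suc_le:
  assumes "T \<noteq> 0"
  shows "nu T q (Suc n) \<le> nu T q n + order 0 (lform T q n)"
proof -
  define m where "m = order 0 (lform T q n)"
  have "coeff (lform T q n) m \<noteq> 0"
  proof
    assume *: "coeff (lform T q n) m = 0"
    have "monom 1 m dvd lform T q n"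
      using order_1[of 0 "lform T q n"] by (simp add: m_def monom_altdef)
    then have "monom 1 (Suc m) dvd lform T q n"
      using * by (simp add: monom_1_dvd_iff' less_Suc_eq)
    then have "[:-0, 1:] ^ Suc m dvd lform T q n" by (simp add: monom_altdef)
    then show False using order_2[OF lform_nonzero[OF assms], of 0 q n] by (simp add: m_def)
  qed
  then obtain a where "(a, m) \<in> supp T q" "a + n * m = nu T q n"
    using coeff_lform_supp by blast
  then show ?thesis using nu_le[of a m T q "Suc n"] by (simp add: m_def)
qed

section \<open>Leading forms under a change of the curve\<close>

definition flat :: "nat \<Rightarrow> complex poly poly \<Rightarrow> bool" where
  "flat k W \<longleftrightarrow> (\<forall>b. \<forall>a<k. coeff (coeff W b) a = 0)"

lemma coeff_mult_flat:
  fixes r y :: "complex poly"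
  assumes "\<And>a. a < k \<Longrightarrow> coeff y a = 0"
  shows "a < k \<Longrightarrow> coeff (r * y) a = 0" "coeff (r * y) k = coeff r 0 * coeff y k"
proof -
  show "coeff (r * y) a = 0" if "a < k" for a
    unfolding coeff_mult using that assms by (auto intro!: sum.neutral)
  have "coeff (r * y) k = (\<Sum>i\<le>k. if i = 0 then coeff r 0 * coeff y k else 0)"
    unfolding coeff_mult by (rule sum.cong) (auto simp: assms)
  then show "coeff (r * y) k = coeff r 0 * coeff y k" by simp
qed

text \<open>Modulo x^(k+1) a flat W is x^k times a polynomial in t with constant coefficients, so
  composing with t - r sees only r(0). The induction follows the Horner form of W.\<close>

lemma flat_translate:
  assumes "flat k W"
  shows "flat k (pcompose W [:-r, 1:]) \<and>
    map_poly (\<lambda>c. coeff c k) (pcompose W [:-r, 1:])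
      = pcompose (map_poly (\<lambda>c. coeff c k) W) [:-coeff r 0, 1:]"
  using assms
proof (induction W)
  case 0
  then show ?case by (simp add: flat_def)
next
  case (pCons w W)
  define X where "X = pcompose W [:-r, 1:]"
  have fl: "flat k W" and w: "\<And>a. a < k \<Longrightarrow> coeff w a = 0"
    using pCons.prems by (auto simp: flat_def coeff_pCons split: nat.splits)
  note IH = pCons.IH[OF fl, folded X_def]
  have X: "\<And>b a. a < k \<Longrightarrow> coeff (coeff X b) a = 0" using IH by (auto simp: flat_def)
  have eq: "pcompose (pCons w W) [:-r, 1:] = [:w:] + smult (-r) X + pCons 0 X"
    by (simp add: pcompose_pCons X_def)
  have c: "coeff (pcompose (pCons w W) [:-r, 1:]) b
     = (if b = 0 then w else coeff X (b - 1)) - r * coeff X b" for b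
    by (cases b) (simp_all add: eq)
  have "flat k (pcompose (pCons w W) [:-r, 1:])"
    unfolding flat_def c by (auto simp: w X coeff_mult_flat(1)[OF X])
  moreover have "map_poly (\<lambda>c. coeff c k) (pcompose (pCons w W) [:-r, 1:])
      = pcompose (map_poly (\<lambda>c. coeff c k) (pCons w W)) [:-coeff r 0, 1:]"
  proof (rule poly_eqI)
    fix b
    have "pcompose (map_poly (\<lambda>c. coeff c k) (pCons w W)) [:-coeff r 0, 1:]
      = [:coeff w k:] + [:-coeff r 0, 1:] * map_poly (\<lambda>c. coeff c k) X"
      using IH by (simp add: map_poly_pCons pcompose_pCons)
    moreover have "coeff (map_poly (\<lambda>c. coeff c k) (pcompose (pCons w W) [:-r, 1:])) b
      = coeff ((if b = 0 then w else coeff X (b - 1)) - r * coeff X b) k"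
      by (subst coeff_map_poly) (simp_all only: c coeff_0)
    ultimately show "coeff (map_poly (\<lambda>c. coeff c k) (pcompose (pCons w W) [:-r, 1:])) b =
      coeff (pcompose (map_poly (\<lambda>c. coeff c k) (pCons w W)) [:-coeff r 0, 1:]) b"
      by (cases b) (simp_all add: coeff_map_poly coeff_mult_flat(2)[OF X])
  qed
  ultimately show ?case by blast
qed

text \<open>x^n t - (q + x^n r) = x^n (t - r) - q: replacing the curve by one with the same
  coefficients below x^n is a translation of t.\<close>

lemma blow_shift: "blow T (q + monom 1 n * r) n = pcompose (blow T q n) [:-r, 1:]"
  unfolding blow_def by (simp add: pcompose_assoc[symmetric] pcompose_pCons algebra_simps)

lemma nu_shift_ge: 
  assumes "T \<noteq> 0"
  shows "nu T q n \<le> nu T (q + monom 1 n * r) n"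
proof -
  have "flat (nu T q n) (blow T q n)" by (simp add: flat_def coeff_blow_below_nu)
  from flat_translate[OF this] have "flat (nu T q n) (blow T (q + monom 1 n * r) n)"
    by (simp add: blow_shift)
  then show ?thesis using nu_attained[OF assms, of "q + monom 1 n * r" n]
    unfolding flat_def by (meson not_le)
qed

text \<open>The translation by r is undone by -r, so the one-sided bound gives equality.\<close>

lemma nu_shift:
  assumes "T \<noteq> 0"
  shows "nu T (q + monom 1 n * r) n = nu T q n"
  using nu_shift_ge[OF assms, of q n r] nu_shift_ge[OF assms, of "q + monom 1 n * r" n "-r"] by simp

lemma lform_shift:
  assumes "T \<noteq> 0"
  shows "lform T (q + monom 1 n * r) n = pcompose (lform T q n) [:-coeff r 0, 1:]"
proof -
  have "flat (nu T q n) (blow T q n)" by (simp add: flat_def coeff_blow_below_nu)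
  from flat_translate[OF this] show ?thesis by (simp add: lform_def nu_shift[OF assms] blow_shift)
qed

section \<open>Root multiplicities\<close>

lemma pcompose_power_left: "pcompose (p ^ n) r = pcompose p r ^ n"
  for p r :: "'a::comm_semiring_1 poly"
  by (induction n) (simp_all add: pcompose_mult pcompose_1)

lemma order_translate:
  fixes S :: "complex poly"
  assumes "S \<noteq> 0"
  shows "order 0 (pcompose S [:-c, 1:]) = order (-c) S"
proof -
  have le: "order (c + d) S \<le> order d (pcompose S [:c, 1:])" if "S \<noteq> 0" for S :: "complex poly" and c d
  proof -
    obtain u where "S = [:-(c + d), 1:] ^ order (c + d) S * u"
      using order_1[of "c + d" S] by (auto elim: dvdE)
    then have "pcompose S [:c, 1:] = pcompose ([:-(c + d), 1:] ^ order (c + d) S * u) [:c, 1:]" by simp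
    also have "\<dots> = [:-d, 1:] ^ order (c + d) S * pcompose u [:c, 1:]"
      by (simp add: pcompose_mult pcompose_pCons pcompose_power_left)
    finally have "[:-d, 1:] ^ order (c + d) S dvd pcompose S [:c, 1:]" by simp
    moreover have "pcompose S [:c, 1:] \<noteq> 0" using that by (simp add: pcompose_eq_0_iff)
    ultimately show ?thesis by (simp add: order_divides)
  qed
  \<comment> \<open>The reverse inequality is \<open>le\<close> for the translated polynomial and
    the inverse translation.\<close>
  have "pcompose (pcompose S [:-c, 1:]) [:c, 1:] = S"
    by (simp add: pcompose_assoc[symmetric] pcompose_pCons pcompose_idR)
  moreover have "pcompose S [:-c, 1:] \<noteq> 0" using assms by (simp add: pcompose_eq_0_iff)
  ultimately show ?thesis
    using le[OF assms, of "-c" 0] le[of "pcompose S [:-c, 1:]" c "-c"] by simp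
qed

lemma sum_order_le_degree:
  fixes S :: "complex poly"
  assumes "S \<noteq> 0" "finite C"
  shows "(\<Sum>c\<in>C. order c S) \<le> degree S"
proof -
  have "(\<Sum>c\<in>C. order c S) = (\<Sum>c\<in>C. count (proots S) c)" using assms by simp
  also have "\<dots> \<le> (\<Sum>c\<in>C \<union> set_mset (proots S). count (proots S) c)"
    using assms(2) by (intro sum_mono2) auto
  also have "\<dots> = size (proots S)"
    unfolding size_multiset_overloaded_eq using assms(2)
    by (intro sum.mono_neutral_right) (auto simp: count_eq_zero_iff)
  also have "\<dots> \<le> degree S" by (rule size_proots_le)
  finally show ?thesis .
qed

section \<open>The tree of curves\<close>

text \<open>All later facts about \<open>Oij\<close> are read off from this threshold form, which
  replaces orders in \<open>enat\<close> by agreement of coefficients and covers equal polynomials,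
  whose difference has infinite order.\<close>

lemma le_Oij_iff:
  "n \<le> Oij L q i j \<longleftrightarrow> n \<le> 2 * L i \<and> n \<le> 2 * L j \<and> (\<forall>a<n. coeff (q i) a = coeff (q j) a)"
proof (cases "q j - q i = 0")
  case True
  then have "Oij L q i j = min (2 * L j) (2 * L i)" by (simp add: Oij_def Ord_poly_def)
  then show ?thesis using True by auto
next
  case False
  then have "Oij L q i j = min (order 0 (q j - q i)) (min (2 * L j) (2 * L i))"
    by (simp add: Oij_def Ord_poly_def)
  moreover have "n \<le> order 0 (q j - q i) \<longleftrightarrow> (\<forall>a<n. coeff (q i) a = coeff (q j) a)"
  proof -
    have "n \<le> order 0 (q j - q i) \<longleftrightarrow> monom 1 n dvd q j - q i"
      using False order_divides[of 0 n "q j - q i"] by (simp add: monom_altdef)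
    then show ?thesis by (auto simp: monom_1_dvd_iff')
  qed
  ultimately show ?thesis by auto
qed

lemma Oij_commute: "Oij L q i j = Oij L q j i"
  by (rule antisym) (auto simp: le_Oij_iff le_Oij_iff[THEN iffD1, OF order_refl])

lemma Oij_ultrametric: "n \<le> Oij L q i j \<Longrightarrow> n \<le> Oij L q j k \<Longrightarrow> n \<le> Oij L q i k"
  by (auto simp: le_Oij_iff)

text \<open>Up to level n, two curves of one cluster cannot be told apart by their agreement with a
  third one, by the ultrametric inequality in both directions. This makes the weight a function of
  the cluster.\<close>

lemma min_Oij_eq:
  assumes "n \<le> Oij L q i j"
  shows "min n (Oij L q k i) = min n (Oij L q k j)"
proof -
  have "m \<le> min n (Oij L q k i) \<longleftrightarrow> m \<le> min n (Oij L q k j)" for m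
    using assms Oij_ultrametric[of m L q k i j] Oij_ultrametric[of m L q k j i] Oij_commute[of L q i j]
    by (metis min.bounded_iff order_trans)
  then show ?thesis by (metis order_refl antisym)
qed

abbreviation (input) cpoly :: "real poly \<Rightarrow> complex poly" where
  "cpoly \<equiv> map_poly complex_of_real"

lemma cpoly_diff:
  assumes "\<forall>a<n. coeff q a = coeff q' a"
  shows "\<exists>r. cpoly q' = cpoly q + monom 1 n * r \<and> coeff r 0 = of_real (coeff q' n - coeff q n)"
proof (intro exI conjI)
  let ?r = "poly_shift n (cpoly q' - cpoly q)"
  show "cpoly q' = cpoly q + monom 1 n * ?r"
    using assms by (intro poly_eqI) (auto simp: coeff_monom_mult coeff_poly_shift coeff_map_poly)
qed (simp add: coeff_poly_shift coeff_map_poly)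

lemma nu_cluster:
  assumes "T \<noteq> 0" "n \<le> Oij L q i j"
  shows "nu T (cpoly (q i)) n = nu T (cpoly (q j)) n"
proof -
  have "\<forall>a<n. coeff (q i) a = coeff (q j) a" using assms(2) by (auto simp: le_Oij_iff)
  then show ?thesis using cpoly_diff[of n "q i" "q j"] nu_shift[OF assms(1)] by metis
qed

text \<open>In the blow-up along curve j, curve i is t = (q_j - q_i)(x) / x^n, which passes at x = 0
  through the difference of the coefficients of x^n. Translating by it carries one leading form to
  the other.\<close>

lemma order_lform_cluster:
  assumes "T \<noteq> 0" "n \<le> Oij L q i j"
  shows "order 0 (lform T (cpoly (q i)) n) =
    order (of_real (coeff (q j) n - coeff (q i) n)) (lform T (cpoly (q j)) n)"
proof -
  have "\<forall>a<n. coeff (q j) a = coeff (q i) a" using assms(2) by (auto simp: le_Oij_iff)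
  then obtain r where r: "cpoly (q i) = cpoly (q j) + monom 1 n * r"
      "coeff r 0 = of_real (coeff (q i) n - coeff (q j) n)"
    using cpoly_diff by blast
  show ?thesis
    using lform_shift[OF assms(1), of "cpoly (q j)" n r] r order_translate[OF lform_nonzero[OF assms(1)], of "cpoly (q j)" n "coeff r 0"]
    by simp
qed

text \<open>A cluster of curves agreeing to order \<open>n\<close> splits according to the coefficient of
  \<open>x ^ n\<close>; the zeros of the leading form of \<open>T\<close> at the different coefficients add up to at most
  its degree, so some subcluster receives fewer zeros than it has members.\<close>
lemma exists_deficient_branch:
  assumes "T \<noteq> 0" "finite I"
    and deg: "degree (lform T (cpoly (q j)) n) < card {i\<in>I. n \<le> Oij L q i j}"
    and long: "\<And>i. i \<in> I \<Longrightarrow> n \<le> Oij L q i j \<Longrightarrow> n < 2 * L i"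
  shows "\<exists>i\<in>I. n \<le> Oij L q i j \<and>
    order 0 (lform T (cpoly (q i)) n) < card {k\<in>I. Suc n \<le> Oij L q k i}"
proof (rule ccontr)
  assume neg: "\<not> ?thesis"
  define C where "C = {i\<in>I. n \<le> Oij L q i j}"
  define S where "S = lform T (cpoly (q j)) n"
  define \<phi> where "\<phi> i = complex_of_real (coeff (q j) n - coeff (q i) n)" for i
  have fin: "finite C" using assms(2) by (simp add: C_def)
  \<comment> \<open>By \<open>long\<close> every member extends beyond n, so agreeing with i to
    order n + 1 only adds equality of the coefficients of x^n.\<close>
  have fibre: "{k\<in>I. Suc n \<le> Oij L q k i} = {k\<in>C. \<phi> k = \<phi> i}" if i: "i \<in> C" for i
  proof -
    have ij: "\<forall>a<n. coeff (q i) a = coeff (q j) a" "n < 2 * L i"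
      using i long[of i] by (auto simp: C_def le_Oij_iff)
    have "Suc n \<le> Oij L q k i \<longleftrightarrow> n \<le> Oij L q k j \<and> \<phi> k = \<phi> i" if "k \<in> I" for k
      using ij i long[OF that] unfolding le_Oij_iff \<phi>_def C_def 
      by (auto simp: less_Suc_eq le_Oij_iff)
    then show ?thesis by (auto simp: C_def)
  qed
  have le: "card {k\<in>C. \<phi> k = y} \<le> order y S" if y: "y \<in> \<phi> ` C" for y
  proof -
    obtain i where i: "i \<in> C" "y = \<phi> i" using y by blast
    then have "card {k\<in>C. \<phi> k = \<phi> i} \<le> order 0 (lform T (cpoly (q i)) n)"
      using neg fibre[OF i(1)] by (force simp: C_def)
    also have "\<dots> = order y S"
      using order_lform_cluster[OF assms(1), of n L q i j] i by (simp add: S_def \<phi>_def C_def)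
    finally show ?thesis using i by simp
  qed
  have "card C = (\<Sum>y\<in>\<phi> ` C. card {k\<in>C. \<phi> k = y})"
    using sum.image_gen[OF fin, of "\<lambda>_. 1 :: nat" \<phi>] by simp
  also have "\<dots> \<le> (\<Sum>y\<in>\<phi> ` C. order y S)" by (intro sum_mono le)
  also have "\<dots> \<le> degree S"
    using fin lform_nonzero[OF assms(1)] by (intro sum_order_le_degree) (auto simp: S_def)
  finally show False using deg by (simp add: C_def S_def)
qed

section \<open>Weights and their change along the tree\<close>

lemma sum_min_Suc:
  fixes f :: "'a \<Rightarrow> nat"
  assumes "finite I"
  shows "(\<Sum>i\<in>I. min (Suc n) (f i)) = (\<Sum>i\<in>I. min n (f i)) + card {i\<in>I. Suc n \<le> f i}"
proof -
  have "(\<Sum>i\<in>I. min (Suc n) (f i)) = (\<Sum>i\<in>I. min n (f i) + (if Suc n \<le> f i then 1 else 0))"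
    by (intro sum.cong) auto
  also have "\<dots> = (\<Sum>i\<in>I. min n (f i)) + card {i\<in>I. Suc n \<le> f i}"
    using assms by (simp add: sum.distrib sum.If_cases Int_def)
  finally show ?thesis .
qed

text \<open>\<open>|T/P|^p\<close> integrated over \<open>y + q j x \<sim> x^n\<close> for fixed \<open>x\<close> has the size of
  \<open>|x|\<close> to the power \<open>weight - 1\<close>.\<close>
definition weight :: "complex poly poly \<Rightarrow> (nat \<Rightarrow> nat) \<Rightarrow> (nat \<Rightarrow> real poly) \<Rightarrow> nat set \<Rightarrow> real \<Rightarrow> nat \<Rightarrow> nat \<Rightarrow> real" where
  "weight T L q I p j n =
     p * (real (nu T (cpoly (q j)) n) - real (\<Sum>i\<in>I. min n (Oij L q i j))) + real n + 1"

lemma weight_Suc: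
  assumes "finite I"
  shows "weight T L q I p j (Suc n) = weight T L q I p j n
    + p * (real (nu T (cpoly (q j)) (Suc n)) - real (nu T (cpoly (q j)) n)
           - real (card {i\<in>I. Suc n \<le> Oij L q i j})) + 1"
  by (simp add: weight_def sum_min_Suc[OF assms] algebra_simps)

lemma weight_cluster:
  assumes "T \<noteq> 0" "n \<le> Oij L q i j"
  shows "weight T L q I p i n = weight T L q I p j n"
  by (simp only: weight_def nu_cluster[OF assms] min_Oij_eq[OF assms(2)])

text \<open>Nonpositive weight together with fewer zeros than curves is an invariant that passes to
  some branch at n + 1. Since n is bounded by the lengths of the curves, the walk must stop, and it
  can stop only at the end of a curve, where the weight is positive.\<close>

lemma weight_deficient_contradiction:
  assumes "T \<noteq> 0" "finite I" "1 \<le> p"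
    and leaf: "\<And>j. j \<in> I \<Longrightarrow> 0 < weight T L q I p j (2 * L j)"
    and "j \<in> I" "n \<le> 2 * L j" "weight T L q I p j n \<le> 0"
    and "degree (lform T (cpoly (q j)) n) < card {i\<in>I. n \<le> Oij L q i j}"
  shows False
  using assms(5-8)
proof (induction "(\<Sum>i\<in>I. 2 * L i) - n" arbitrary: n j rule: less_induct)
  case (less n j)
  \<comment> \<open>A member ending at n would share the nonpositive weight of j there, by
    \<open>weight_cluster\<close>, against \<open>leaf\<close>.\<close>
  have "n < 2 * L i" if i: "i \<in> I" "n \<le> Oij L q i j" for i
  proof (rule ccontr)
    assume "\<not> n < 2 * L i"
    moreover have "n \<le> 2 * L i" using i by (simp add: le_Oij_iff)
    ultimately have "n = 2 * L i" by simp
    then show False 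
      using leaf[OF i(1)] weight_cluster[OF assms(1) i(2), of I p] less.prems(3) by simp
  qed
  from exists_deficient_branch[OF assms(1,2) less.prems(4) this] obtain i where
    i: "i \<in> I" "n \<le> Oij L q i j" "n < 2 * L i"
      "order 0 (lform T (cpoly (q i)) n) < card {k\<in>I. Suc n \<le> Oij L q k i}" (is "?m < ?N")
    using \<open>\<And>i. i \<in> I \<Longrightarrow> n \<le> Oij L q i j \<Longrightarrow> n < 2 * L i\<close> by blast
  let ?\<nu> = "nu T (cpoly (q i))"
  \<comment> \<open>At least one zero is missing, which costs p \<ge> 1 and cancels the summand 1 of
    \<open>weight_Suc\<close>.\<close>
  have "p * (real (?\<nu> (Suc n)) - real (?\<nu> n) - real ?N) \<le> p * (-1)"
    using nu_Suc_le[OF assms(1), of "cpoly (q i)" n] i(4) assms(3)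
    by (intro mult_left_mono) auto
  then have "weight T L q I p i (Suc n) \<le> 0"
    using weight_Suc[OF assms(2), of T L q p i n] weight_cluster[OF assms(1) i(2), of I p]
      less.prems(3) assms(3) by simp
  moreover have "degree (lform T (cpoly (q i)) (Suc n)) < ?N"
    using degree_lform_le[OF assms(1), of "cpoly (q i)" n] nu_Suc_le[OF assms(1), of "cpoly (q i)" n] i(4)
    by simp
  moreover have "(\<Sum>i\<in>I. 2 * L i) - Suc n < (\<Sum>i\<in>I. 2 * L i) - n"
  proof -
    have "2 * L i \<le> (\<Sum>i\<in>I. 2 * L i)" using i(1) assms(2) by (intro member_le_sum) auto
    then show ?thesis using i(3) by simp
  qed
  ultimately show False using less.hyps[of "Suc n" i] i by simp
qed

lemma weight_pos:
  assumes "T \<noteq> 0" "finite I" "1 \<le> p"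
    and leaf: "\<And>j. j \<in> I \<Longrightarrow> 0 < weight T L q I p j (2 * L j)"
    and "j \<in> I" "n \<le> 2 * L j"
  shows "0 < weight T L q I p j n"
  using assms(6)
proof (induction n)
  case 0
  then show ?case using assms(3) by (simp add: weight_def add_nonneg_pos)
next
  case (Suc n)
  show ?case
  proof (rule ccontr)
    assume neg: "\<not> 0 < weight T L q I p j (Suc n)"
    let ?\<nu> = "nu T (cpoly (q j))" and ?N = "card {i\<in>I. Suc n \<le> Oij L q i j}"
    \<comment> \<open>The weight falls from positive to nonpositive although
      \<open>weight_Suc\<close> adds 1, so the term with the factor p is negative. This produces the
      first missing zero.\<close>
    have "p * (real (?\<nu> (Suc n)) - real (?\<nu> n) - real ?N) < 0"
      using neg Suc weight_Suc[OF assms(2), of T L q p j n] by simp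
    then have "?\<nu> (Suc n) < ?\<nu> n + ?N" using assms(3) by (simp add: mult_less_0_iff)
    then have "degree (lform T (cpoly (q j)) (Suc n)) < ?N"
      using degree_lform_le[OF assms(1), of "cpoly (q j)" n] by simp
    then show False
      using weight_deficient_contradiction[OF assms(1-4) assms(5) Suc.prems] neg by simp
  qed
qed

section \<open>Power series in two variables\<close>

text \<open>\<open>conv_ps\<close> with the radius fixed, so that estimates can name the closed
  polydisc on which they hold.\<close>

definition ps_summable :: "(nat \<Rightarrow> nat \<Rightarrow> complex) \<Rightarrow> real \<Rightarrow> bool" where
  "ps_summable c r \<longleftrightarrow> (\<lambda>(i, j). norm (c i j) * r ^ (i + j)) summable_on UNIV"

lemma norm_monomial_le:
  fixes x y :: complex
  assumes "norm x \<le> r" "norm y \<le> r"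
  shows "norm (x ^ i * y ^ j) \<le> r ^ (i + j)"
proof -
  have "0 \<le> r" using assms(1) norm_ge_zero order_trans by blast
  then show ?thesis
    unfolding norm_mult norm_power power_add using assms by (intro mult_mono power_mono) auto
qed

lemma ps_terms_bound:
  fixes c :: "nat \<Rightarrow> nat \<Rightarrow> complex"
  assumes "norm x \<le> r" "norm y \<le> r"
  shows "norm (case ij of (i, j) \<Rightarrow> c i j * x ^ i * y ^ j)
    \<le> (case ij of (i, j) \<Rightarrow> norm (c i j) * r ^ (i + j))"
proof (cases ij)
  case (Pair i j)
  have "norm (c i j * (x ^ i * y ^ j)) \<le> norm (c i j) * r ^ (i + j)"
    using norm_monomial_le[OF assms, of i j] by (subst norm_mult) (rule mult_left_mono, auto)
  then show ?thesis using Pair by (simp add: mult.assoc)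
qed

lemma ps_terms_abs_summable:
  fixes c :: "nat \<Rightarrow> nat \<Rightarrow> complex"
  assumes "ps_summable c r" "norm x \<le> r" "norm y \<le> r"
  shows "(\<lambda>ij. norm (case ij of (i, j) \<Rightarrow> c i j * x ^ i * y ^ j)) summable_on A"
proof (rule Infinite_Sum.abs_summable_on_comparison_test')
  show "(\<lambda>(i, j). norm (c i j) * r ^ (i + j)) summable_on A"
    using assms(1) unfolding ps_summable_def by (rule summable_on_subset) simp
qed (rule ps_terms_bound[OF assms(2,3)])

lemma ps_terms_summable:
  fixes c :: "nat \<Rightarrow> nat \<Rightarrow> complex"
  assumes "ps_summable c r" "norm x \<le> r" "norm y \<le> r"
  shows "(\<lambda>(i, j). c i j * x ^ i * y ^ j) summable_on A"
  by (rule abs_summable_summable[OF ps_terms_abs_summable[OF assms]])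

lemma ps_summable_mono:
  assumes "ps_summable c r" "0 \<le> s" "s \<le> r"
  shows "ps_summable c s"
  unfolding ps_summable_def
proof (rule summable_on_comparison_test)
  show "(\<lambda>(i, j). norm (c i j) * r ^ (i + j)) summable_on UNIV"
    using assms(1) by (simp add: ps_summable_def)
qed (use assms(2,3) in \<open>auto intro!: mult_left_mono power_mono\<close>)

lemma ps_eval_add:
  assumes "ps_summable c r" "ps_summable d r" "norm x \<le> r" "norm y \<le> r"
  shows "ps_eval (\<lambda>i j. c i j + d i j) (x, y) = ps_eval c (x, y) + ps_eval d (x, y)"
proof -
  have "ps_eval c (x, y) + ps_eval d (x, y)
     = (\<Sum>\<^sub>\<infinity>ij\<in>UNIV. (case ij of (i, j) \<Rightarrow> c i j * x ^ i * y ^ j) + (case ij of (i, j) \<Rightarrow> d i j * x ^ i * y ^ j))"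
    unfolding ps_eval_def fst_conv snd_conv
    by (rule infsum_add[symmetric]) (rule ps_terms_summable[OF assms(1,3,4)] ps_terms_summable[OF assms(2,3,4)])+
  also have "\<dots> = ps_eval (\<lambda>i j. c i j + d i j) (x, y)"
    unfolding ps_eval_def by (rule infsum_cong) (auto simp: algebra_simps)
  finally show ?thesis by simp
qed

lemma ps_summable_add:
  assumes "ps_summable c r" "ps_summable d r" "0 \<le> r"
  shows "ps_summable (\<lambda>i j. c i j + d i j) r"
proof -
  have "(\<lambda>ij. (case ij of (i, j) \<Rightarrow> norm (c i j) * r ^ (i + j)) + (case ij of (i, j) \<Rightarrow> norm (d i j) * r ^ (i + j))) summable_on UNIV"
    using assms(1,2) unfolding ps_summable_def by (rule summable_on_add)
  then show ?thesis
    unfolding ps_summable_def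
  proof (rule summable_on_comparison_test)
    fix ij :: "nat \<times> nat"
    obtain i j where "ij = (i, j)" by (cases ij)
    then show "(case ij of (i, j) \<Rightarrow> norm (c i j + d i j) * r ^ (i + j))
      \<le> (case ij of (i, j) \<Rightarrow> norm (c i j) * r ^ (i + j)) + (case ij of (i, j) \<Rightarrow> norm (d i j) * r ^ (i + j))"
      using assms(3) mult_right_mono[OF norm_triangle_ineq[of "c i j" "d i j"], of "r ^ (i + j)"] by (simp add: algebra_simps)
  qed (use assms(3) in auto)
qed

lemma ps_eval_continuous_on:
  assumes "ps_summable c r"
  shows "continuous_on ({x. norm x \<le> r} \<times> {y. norm y \<le> r}) (ps_eval c)"
proof -
  let ?Y = "{x::complex. norm x \<le> r} \<times> {y::complex. norm y \<le> r}"
  let ?f = "\<lambda>(i, j) z. c i j * fst z ^ i * snd z ^ j :: complex"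
  have "uniform_limit ?Y (\<lambda>X z. \<Sum>ij\<in>X. ?f ij z) (\<lambda>z. \<Sum>\<^sub>\<infinity>ij\<in>UNIV. ?f ij z) (finite_subsets_at_top UNIV)"
  proof (rule Weierstrass_m_test_general)
    fix ij :: "nat \<times> nat" and z assume "z \<in> ?Y"
    then have "norm (fst z) \<le> r" "norm (snd z) \<le> r" by auto
    from ps_terms_bound[OF this, where c = c and ij = ij]
    show "norm (?f ij z) \<le> (case ij of (i, j) \<Rightarrow> norm (c i j) * r ^ (i + j))"
      by (simp add: case_prod_unfold)
  qed (use assms in \<open>simp add: ps_summable_def\<close>)
  then have "continuous_on ?Y (\<lambda>z. \<Sum>\<^sub>\<infinity>ij\<in>UNIV. ?f ij z)"
    by (rule uniform_limit_theorem[rotated])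
      (auto simp: case_prod_unfold intro!: always_eventually continuous_intros)
  moreover have "(\<lambda>z. \<Sum>\<^sub>\<infinity>ij\<in>UNIV. ?f ij z) = ps_eval c"
    by (auto simp: ps_eval_def fun_eq_iff case_prod_unfold)
  ultimately show ?thesis by (simp only:)
qed

section \<open>Truncation at a total degree\<close>

definition low_deg :: "nat \<Rightarrow> (nat \<times> nat) set" where
  "low_deg K = {(i, j). i + j < K}"

lemma finite_low_deg: "finite (low_deg K)"
  by (rule finite_subset[of _ "{..<K} \<times> {..<K}"]) (auto simp: low_deg_def)

definition trunc :: "(nat \<Rightarrow> nat \<Rightarrow> complex) \<Rightarrow> nat \<Rightarrow> complex poly poly" where
  "trunc c K = (\<Sum>(i, j)\<in>low_deg K. monom (monom (c i j) i) j)"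

lemma ev_trunc: "ev (trunc c K) x y = (\<Sum>(i, j)\<in>low_deg K. c i j * x ^ i * y ^ j)"
  by (simp add: ev_def trunc_def poly_sum poly_monom case_prod_unfold)

lemma ps_eval_minus_trunc:
  assumes "ps_summable c r" "norm x \<le> r" "norm y \<le> r"
  shows "ps_eval c (x, y) - ev (trunc c K) x y = (\<Sum>\<^sub>\<infinity>(i, j)\<in>- low_deg K. c i j * x ^ i * y ^ j)"
proof -
  let ?f = "\<lambda>(i, j). c i j * x ^ i * y ^ j"
  have s: "?f summable_on A" for A
    by (rule ps_terms_summable[OF assms])
  have "infsum ?f (low_deg K \<union> - low_deg K) = infsum ?f (low_deg K) + infsum ?f (- low_deg K)"
    by (rule infsum_Un_disjoint[OF s s]) simp
  then show ?thesis
    by (simp add: ps_eval_def ev_trunc finite_low_deg)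
qed

lemma ps_eval_trunc_error:
  assumes "ps_summable c r" "0 < r"
  shows "\<exists>C\<ge>0. \<forall>x y. norm x \<le> r \<longrightarrow> norm y \<le> r \<longrightarrow>
    norm (ps_eval c (x, y) - ev (trunc c K) x y) \<le> C * max (norm x) (norm y) ^ K"
proof (intro exI conjI allI impI)
  define B where "B = (\<Sum>\<^sub>\<infinity>(i, j)\<in>- low_deg K. norm (c i j) * r ^ (i + j))"
  have sB: "(\<lambda>(i, j). norm (c i j) * r ^ (i + j)) summable_on - low_deg K"
    using assms(1) unfolding ps_summable_def by (rule summable_on_subset) simp
  have B0: "0 \<le> B" unfolding B_def using assms(2) by (intro infsum_nonneg) auto
  then show "0 \<le> B / r ^ K" using assms(2) by simp
  fix x y :: complex assume xy: "norm x \<le> r" "norm y \<le> r"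
  define \<rho> where "\<rho> = max (norm x) (norm y)"
  have \<rho>: "0 \<le> \<rho>" "\<rho> \<le> r" using xy by (auto simp: \<rho>_def le_max_iff_disj)
  let ?f = "\<lambda>(i, j). c i j * x ^ i * y ^ j"
  have fs: "?f summable_on - low_deg K"
    by (intro ps_terms_summable[OF assms(1)] xy)
  \<comment> \<open>A tail term has degree at least K, so at radius \<rho> \<le> r it is at most
    (\<rho> / r)^K times its bound at radius r.\<close>
  have "norm (infsum ?f (- low_deg K)) \<le> (\<rho> / r) ^ K * B"
  proof (rule norm_infsum_le[OF has_sum_infsum[OF fs]])
    show "((\<lambda>ij. (\<rho> / r) ^ K * (case ij of (i, j) \<Rightarrow> norm (c i j) * r ^ (i + j))) has_sum (\<rho> / r) ^ K * B) (- low_deg K)"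
      unfolding B_def by (intro has_sum_cmult_right has_sum_infsum sB)
    fix ij assume "ij \<in> - low_deg K"
    then obtain i j where ij: "ij = (i, j)" "K \<le> i + j" by (cases ij) (auto simp: low_deg_def)
    have "norm (c i j * x ^ i * y ^ j) \<le> norm (c i j) * \<rho> ^ (i + j)"
      using ps_terms_bound[of x \<rho> y c "(i, j)"] by (simp add: \<rho>_def)
    also have "\<rho> ^ (i + j) = (\<rho> / r) ^ (i + j) * r ^ (i + j)"
      using assms(2) by (simp add: power_divide)
    also have "\<dots> \<le> (\<rho> / r) ^ K * r ^ (i + j)"
      using \<rho> assms(2) ij by (intro mult_right_mono power_decreasing) auto
    finally have "norm (c i j * x ^ i * y ^ j) \<le> norm (c i j) * ((\<rho> / r) ^ K * r ^ (i + j))"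
      by (simp add: mult_left_mono)
    then show "norm (?f ij) \<le> (\<rho> / r) ^ K * (case ij of (i, j) \<Rightarrow> norm (c i j) * r ^ (i + j))"
      using ij by (simp add: algebra_simps)
  qed
  then show "norm (ps_eval c (x, y) - ev (trunc c K) x y) \<le> B / r ^ K * max (norm x) (norm y) ^ K"
    using ps_eval_minus_trunc[OF assms(1) xy, of K] by (simp add: \<rho>_def power_divide mult.commute)
qed

lemma ps_eval_bounded:
  assumes "ps_summable c r" "0 < r"
  shows "\<exists>C\<ge>0. \<forall>x y. norm x \<le> r \<longrightarrow> norm y \<le> r \<longrightarrow> norm (ps_eval c (x, y)) \<le> C"
  using ps_eval_trunc_error[OF assms, of 0] by (simp add: ev_trunc low_deg_def)

text \<open>Meant for substitution into a series, where each term becomes a polynomial: absolute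
  summability over all triples (k, a, b) allows collecting coefficients before evaluating.\<close>

lemma ps_family_sum:
  fixes h :: "'k \<Rightarrow> nat \<Rightarrow> nat \<Rightarrow> complex"
  assumes r: "0 < r"
    and h: "\<And>k. k \<in> I \<Longrightarrow> ((\<lambda>(a, b). norm (h k a b) * r ^ (a + b)) has_sum S k) UNIV"
    and S: "S summable_on I"
  shows "\<exists>d. ps_summable d r \<and> (\<forall>x y. norm x \<le> r \<longrightarrow> norm y \<le> r \<longrightarrow>
    ps_eval d (x, y) = (\<Sum>\<^sub>\<infinity>k\<in>I. ps_eval (h k) (x, y)))"
proof -
  define d where "d a b = (\<Sum>\<^sub>\<infinity>k\<in>I. h k a b)" for a b
  let ?N = "\<lambda>(k, a, b). norm (h k a b) * r ^ (a + b)"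
  have N: "?N summable_on I \<times> UNIV"
    using h S by (intro summable_on_SigmaI[where g = S]) (use r in auto)
  have N': "(\<lambda>(ab, k). norm (h k (fst ab) (snd ab)) * r ^ (fst ab + snd ab)) summable_on UNIV \<times> I"
  proof -
    have "(?N \<circ> prod.swap) summable_on (UNIV \<times> I)"
      by (subst summable_on_reindex[symmetric]) (use N in \<open>auto simp: product_swap\<close>)
    then show ?thesis by (simp add: o_def case_prod_unfold)
  qed
  have hs: "(\<lambda>k. norm (h k a b)) summable_on I" for a b
  proof -
    have "(\<lambda>k. norm (h k a b) * r ^ (a + b)) summable_on I"
      using summable_on_SigmaD1[OF N', of "(a, b)"] by simp
    then show ?thesis using r by (simp add: summable_on_cmult_left')
  qed
  have "ps_summable d r"
    unfolding ps_summable_def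
  proof (rule summable_on_comparison_test)
    show "(\<lambda>ab. \<Sum>\<^sub>\<infinity>k\<in>I. norm (h k (fst ab) (snd ab)) * r ^ (fst ab + snd ab)) summable_on UNIV"
      using summable_on_Sigma_banach[OF N'] by simp
    fix ab :: "nat \<times> nat"
    obtain a b where ab: "ab = (a, b)" by (cases ab)
    have "norm (d a b) \<le> (\<Sum>\<^sub>\<infinity>k\<in>I. norm (h k a b))"
      unfolding d_def by (rule norm_infsum_bound[OF hs])
    then have "norm (d a b) * r ^ (a + b) \<le> (\<Sum>\<^sub>\<infinity>k\<in>I. norm (h k a b)) * r ^ (a + b)"
      using r by (intro mult_right_mono) auto
    then show "(case ab of (a, b) \<Rightarrow> norm (d a b) * r ^ (a + b))
       \<le> (\<Sum>\<^sub>\<infinity>k\<in>I. norm (h k (fst ab) (snd ab)) * r ^ (fst ab + snd ab))"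
      by (simp add: ab infsum_cmult_left')
  qed (use r in auto)
  moreover have "ps_eval d (x, y) = (\<Sum>\<^sub>\<infinity>k\<in>I. ps_eval (h k) (x, y))"
    if xy: "norm x \<le> r" "norm y \<le> r" for x y
  proof -
    let ?f = "\<lambda>k ab. h k (fst ab) (snd ab) * x ^ fst ab * y ^ snd ab"
    have "(\<lambda>z. norm (case z of (k, ab) \<Rightarrow> ?f k ab)) summable_on I \<times> UNIV"
      using N
    proof (rule Infinite_Sum.abs_summable_on_comparison_test')
      fix z :: "'k \<times> nat \<times> nat"
      show "norm (case z of (k, ab) \<Rightarrow> ?f k ab) \<le> ?N z"
        using ps_terms_bound[OF xy, where ij = "snd z" and c = "h (fst z)"] by (simp add: case_prod_unfold)
    qed
    then have "(\<lambda>(k, ab). ?f k ab) summable_on I \<times> UNIV"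
      by (rule abs_summable_summable)
    then have "(\<Sum>\<^sub>\<infinity>k\<in>I. \<Sum>\<^sub>\<infinity>ab\<in>UNIV. ?f k ab) = (\<Sum>\<^sub>\<infinity>ab\<in>UNIV. \<Sum>\<^sub>\<infinity>k\<in>I. ?f k ab)"
      by (rule infsum_swap_banach)
    also have "\<dots> = ps_eval d (x, y)"
      by (simp add: ps_eval_def d_def case_prod_unfold infsum_cmult_left')
    finally show ?thesis by (simp add: ps_eval_def case_prod_unfold)
  qed
  ultimately show ?thesis by blast
qed

section \<open>Polynomial functions and their coefficient norm\<close>

text \<open>The bound is on a norm of the coefficients that is submultiplicative.\<close>
definition polyfun :: "real \<Rightarrow> real \<Rightarrow> (complex \<Rightarrow> complex \<Rightarrow> complex) \<Rightarrow> bool" where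
  "polyfun r B F \<longleftrightarrow> (\<exists>h A. finite A \<and> (\<forall>x y. F x y = (\<Sum>(a, b)\<in>A. h a b * x ^ a * y ^ b)) \<and>
     (\<Sum>(a, b)\<in>A. norm (h a b) * r ^ (a + b)) \<le> B)"

lemma polyfun_mono: "polyfun r B F \<Longrightarrow> B \<le> B' \<Longrightarrow> polyfun r B' F"
  unfolding polyfun_def by (meson order_trans)

lemma polyfun_radius_mono:
  assumes "polyfun r B F" "0 \<le> s" "s \<le> r"
  shows "polyfun s B F"
proof -
  obtain h A where h: "finite A" "\<forall>x y. F x y = (\<Sum>(a, b)\<in>A. h a b * x ^ a * y ^ b)"
     "(\<Sum>(a, b)\<in>A. norm (h a b) * r ^ (a + b)) \<le> B" using assms(1) unfolding polyfun_def by blast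
  have "(\<Sum>(a, b)\<in>A. norm (h a b) * s ^ (a + b)) \<le> (\<Sum>(a, b)\<in>A. norm (h a b) * r ^ (a + b))"
    using assms(2,3) by (intro sum_mono) (auto intro!: mult_left_mono power_mono)
  then show ?thesis unfolding polyfun_def using h by (meson order_trans)
qed

lemma polyfun_monomial: "polyfun r (norm c * r ^ (a + b)) (\<lambda>x y. c * x ^ a * y ^ b)"
  unfolding polyfun_def by (rule exI[of _ "\<lambda>_ _. c"], rule exI[of _ "{(a, b)}"]) auto

lemma polyfun_const: "polyfun r (norm c) (\<lambda>x y. c)"
  using polyfun_monomial[of r c 0 0] by simp

lemma polyfun_fst_power: "polyfun r (r ^ k) (\<lambda>x y. x ^ k)"
  using polyfun_monomial[of r 1 k 0] by simp

lemma polyfun_snd: "polyfun r r (\<lambda>x y. y)"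
  using polyfun_monomial[of r 1 0 1] by simp

lemma polyfun_add:
  assumes "polyfun r B F" "polyfun r B' F'" "0 \<le> r"
  shows "polyfun r (B + B') (\<lambda>x y. F x y + F' x y)"
proof -
  obtain h A where h: "finite A" "\<And>x y. F x y = (\<Sum>(a, b)\<in>A. h a b * x ^ a * y ^ b)"
     "(\<Sum>(a, b)\<in>A. norm (h a b) * r ^ (a + b)) \<le> B" using assms(1) unfolding polyfun_def by blast
  obtain h' A' where h': "finite A'" "\<And>x y. F' x y = (\<Sum>(a, b)\<in>A'. h' a b * x ^ a * y ^ b)"
     "(\<Sum>(a, b)\<in>A'. norm (h' a b) * r ^ (a + b)) \<le> B'" using assms(2) unfolding polyfun_def by blast
  define g where "g a b = (if (a, b) \<in> A then h a b else 0) + (if (a, b) \<in> A' then h' a b else 0)" for a b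
  have fin: "finite (A \<union> A')" using h h' by simp
  have "F x y + F' x y = (\<Sum>(a, b)\<in>A \<union> A'. g a b * x ^ a * y ^ b)" for x y
  proof -
    have "F x y = (\<Sum>(a, b)\<in>A \<union> A'. (if (a, b) \<in> A then h a b else 0) * x ^ a * y ^ b)"
      unfolding h using h h' by (intro sum.mono_neutral_cong_left) auto
    moreover have "F' x y = (\<Sum>(a, b)\<in>A \<union> A'. (if (a, b) \<in> A' then h' a b else 0) * x ^ a * y ^ b)"
      unfolding h' using h h' by (intro sum.mono_neutral_cong_left) auto
    ultimately show ?thesis
      by (simp only: sum.distrib[symmetric] g_def case_prod_unfold distrib_right)
  qed
  moreover have "(\<Sum>(a, b)\<in>A \<union> A'. norm (g a b) * r ^ (a + b)) \<le> B + B'"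
  proof -
    have "(\<Sum>(a, b)\<in>A \<union> A'. norm (g a b) * r ^ (a + b))
      \<le> (\<Sum>(a, b)\<in>A \<union> A'. norm (if (a, b) \<in> A then h a b else 0) * r ^ (a + b)
           + norm (if (a, b) \<in> A' then h' a b else 0) * r ^ (a + b))"
      using assms(3) unfolding g_def 
      by (intro sum_mono) (auto simp: distrib_right[symmetric] norm_triangle_ineq intro!: mult_right_mono)
    also have "\<dots> = (\<Sum>(a, b)\<in>A \<union> A'. norm (if (a, b) \<in> A then h a b else 0) * r ^ (a + b))
       + (\<Sum>(a, b)\<in>A \<union> A'. norm (if (a, b) \<in> A' then h' a b else 0) * r ^ (a + b))"
      by (simp only: sum.distrib case_prod_unfold)
    also have "(\<Sum>(a, b)\<in>A \<union> A'. norm (if (a, b) \<in> A then h a b else 0) * r ^ (a + b))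
      = (\<Sum>(a, b)\<in>A. norm (h a b) * r ^ (a + b))"
      using h h' by (intro sum.mono_neutral_cong_right) auto
    also have "(\<Sum>(a, b)\<in>A \<union> A'. norm (if (a, b) \<in> A' then h' a b else 0) * r ^ (a + b))
      = (\<Sum>(a, b)\<in>A'. norm (h' a b) * r ^ (a + b))"
      using h h' by (intro sum.mono_neutral_cong_right) auto
    finally show ?thesis using h h' by linarith
  qed
  ultimately show ?thesis unfolding polyfun_def using fin by blast
qed

lemma polyfun_mult:
  assumes "polyfun r B F" "polyfun r B' F'" "0 \<le> r"
  shows "polyfun r (B * B') (\<lambda>x y. F x y * F' x y)"
proof -
  obtain h A where h: "finite A" "\<And>x y. F x y = (\<Sum>(a, b)\<in>A. h a b * x ^ a * y ^ b)"
     "(\<Sum>(a, b)\<in>A. norm (h a b) * r ^ (a + b)) \<le> B" using assms(1) unfolding polyfun_def by blast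
  obtain h' A' where h': "finite A'" "\<And>x y. F' x y = (\<Sum>(a, b)\<in>A'. h' a b * x ^ a * y ^ b)"
     "(\<Sum>(a, b)\<in>A'. norm (h' a b) * r ^ (a + b)) \<le> B'" using assms(2) unfolding polyfun_def by blast
  define P where "P = A \<times> A'"
  \<comment> \<open>The products of terms are grouped by total exponent; summing over the fibres of
    \<sigma> is the convolution of the coefficients.\<close>
  define \<sigma> where "\<sigma> p = (fst (fst p) + fst (snd p), snd (fst p) + snd (snd p))"
    for p :: "(nat \<times> nat) \<times> nat \<times> nat"
  define w where "w p = h (fst (fst p)) (snd (fst p)) * h' (fst (snd p)) (snd (snd p))" for p
  define g where "g a b = (\<Sum>p\<in>{p\<in>P. \<sigma> p = (a, b)}. w p)" for a b
  have fin: "finite P" using h h' by (simp add: P_def)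
  have "F x y * F' x y = (\<Sum>(a, b)\<in>\<sigma> ` P. g a b * x ^ a * y ^ b)" for x y
  proof -
    have "F x y * F' x y = (\<Sum>p\<in>P. w p * x ^ fst (\<sigma> p) * y ^ snd (\<sigma> p))"
      unfolding h h' P_def sum_product sum.cartesian_product
      by (intro sum.cong) (auto simp: w_def \<sigma>_def power_add)
    also have "\<dots> = (\<Sum>s\<in>\<sigma> ` P. \<Sum>p\<in>{p\<in>P. \<sigma> p = s}. w p * x ^ fst (\<sigma> p) * y ^ snd (\<sigma> p))"
      by (rule sum.image_gen[OF fin])
    also have "\<dots> = (\<Sum>(a, b)\<in>\<sigma> ` P. g a b * x ^ a * y ^ b)"
    proof (rule sum.cong)
      fix s assume "s \<in> \<sigma> ` P"
      obtain a b where s: "s = (a, b)" by (cases s)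
      show "(\<Sum>p\<in>{p\<in>P. \<sigma> p = s}. w p * x ^ fst (\<sigma> p) * y ^ snd (\<sigma> p))
        = (case s of (a, b) \<Rightarrow> g a b * x ^ a * y ^ b)"
        by (simp add: g_def s sum_distrib_right)
    qed simp
    finally show ?thesis .
  qed
  moreover have "(\<Sum>(a, b)\<in>\<sigma> ` P. norm (g a b) * r ^ (a + b)) \<le> B * B'"
  proof -
    have "(\<Sum>(a, b)\<in>\<sigma> ` P. norm (g a b) * r ^ (a + b))
      \<le> (\<Sum>s\<in>\<sigma> ` P. \<Sum>p\<in>{p\<in>P. \<sigma> p = s}. norm (w p) * r ^ (fst (\<sigma> p) + snd (\<sigma> p)))"
    proof (rule sum_mono)
      fix s assume "s \<in> \<sigma> ` P"
      obtain a b where s: "s = (a, b)" by (cases s)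
      have "norm (g a b) * r ^ (a + b) \<le> (\<Sum>p\<in>{p\<in>P. \<sigma> p = (a, b)}. norm (w p)) * r ^ (a + b)"
        unfolding g_def using assms(3) by (intro mult_right_mono norm_sum) auto
      then show "(case s of (a, b) \<Rightarrow> norm (g a b) * r ^ (a + b))
        \<le> (\<Sum>p\<in>{p\<in>P. \<sigma> p = s}. norm (w p) * r ^ (fst (\<sigma> p) + snd (\<sigma> p)))"
        by (simp add: s sum_distrib_right)
    qed
    also have "\<dots> = (\<Sum>p\<in>P. norm (w p) * r ^ (fst (\<sigma> p) + snd (\<sigma> p)))"
      by (rule sum.image_gen[OF fin, symmetric])
    also have "\<dots> = (\<Sum>(a, b)\<in>A. norm (h a b) * r ^ (a + b)) * (\<Sum>(a, b)\<in>A'. norm (h' a b) * r ^ (a + b))"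
      unfolding P_def sum_product sum.cartesian_product
      by (intro sum.cong) (auto simp: w_def \<sigma>_def power_add norm_mult)
    also have "\<dots> \<le> B * B'"
    proof -
      have "0 \<le> (\<Sum>(a, b)\<in>A. norm (h a b) * r ^ (a + b))" 
           "0 \<le> (\<Sum>(a, b)\<in>A'. norm (h' a b) * r ^ (a + b))"
        using assms(3) by (auto intro!: sum_nonneg)
      then show ?thesis using h(3) h'(3) by (intro mult_mono) auto
    qed
    finally show ?thesis .
  qed
  ultimately show ?thesis unfolding polyfun_def using fin by blast
qed

lemma polyfun_power: "polyfun r B F \<Longrightarrow> 0 \<le> r \<Longrightarrow> polyfun r (B ^ k) (\<lambda>x y. F x y ^ k)"
  using polyfun_const[of r 1] by (induction k) (auto intro: polyfun_mult)

lemma polyfun_poly: "\<exists>B. polyfun 1 B (\<lambda>x y. poly q x)"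
proof (induction q)
  case 0
  then show ?case using polyfun_const[of 1 0] by auto
next
  case (pCons a q)
  then obtain B where "polyfun 1 B (\<lambda>x y. poly q x)" by blast
  from polyfun_add[OF polyfun_const[of 1 a] polyfun_mult[OF polyfun_fst_power[of 1 1] this]]
  show ?case by auto
qed

lemma polyfun_sum:
  "finite A \<Longrightarrow> (\<And>k. k \<in> A \<Longrightarrow> \<exists>B. polyfun 1 B (F k)) \<Longrightarrow> \<exists>B. polyfun 1 B (\<lambda>x y. \<Sum>k\<in>A. F k x y)"
proof (induction A rule: finite_induct)
  case empty
  then show ?case using polyfun_const[of 1 0] by auto
next
  case (insert k A)
  then show ?case using polyfun_add[of 1 _ "F k" _ "\<lambda>x y. \<Sum>k\<in>A. F k x y"] by fastforce
qed

lemma polyfun_ps: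
  assumes "polyfun r B F" "0 \<le> r"
  shows "\<exists>h s. ((\<lambda>(a, b). norm (h a b) * r ^ (a + b)) has_sum s) UNIV \<and> s \<le> B \<and>
     (\<forall>x y. F x y = ps_eval h (x, y))"
proof -
  obtain h A where h: "finite A" "\<And>x y. F x y = (\<Sum>(a, b)\<in>A. h a b * x ^ a * y ^ b)"
     "(\<Sum>(a, b)\<in>A. norm (h a b) * r ^ (a + b)) \<le> B" using assms(1) unfolding polyfun_def by blast
  define g where "g a b = (if (a, b) \<in> A then h a b else 0)" for a b
  have "((\<lambda>(a, b). norm (g a b) * r ^ (a + b)) has_sum (\<Sum>(a, b)\<in>A. norm (h a b) * r ^ (a + b))) UNIV"
    by (rule has_sum_finite_neutralI[OF h(1)]) (auto simp: g_def intro!: sum.cong)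
  moreover have "F x y = ps_eval g (x, y)" for x y
  proof -
    have "((\<lambda>(a, b). g a b * x ^ a * y ^ b) has_sum F x y) UNIV"
      by (rule has_sum_finite_neutralI[OF h(1)]) (auto simp: g_def h(2) intro!: sum.cong)
    then show ?thesis by (simp add: ps_eval_def infsumI)
  qed
  ultimately show ?thesis using h(3) by blast
qed

section \<open>Orders of vanishing and truncation\<close>

lemma eventually_nhds_polydisc:
  "(\<forall>\<^sub>F z in nhds (0 :: complex \<times> complex). P z) \<longleftrightarrow>
     (\<exists>r>0. \<forall>x y. norm x \<le> r \<longrightarrow> norm y \<le> r \<longrightarrow> P (x, y))"
proof
  assume "\<forall>\<^sub>F z in nhds (0 :: complex \<times> complex). P z"
  then obtain e where e: "e > 0" "\<And>z. norm z < e \<Longrightarrow> P z"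
    by (auto simp: eventually_nhds_metric)
  show "\<exists>r>0. \<forall>x y. norm x \<le> r \<longrightarrow> norm y \<le> r \<longrightarrow> P (x, y)"
  proof (intro exI[of _ "e / 3"] conjI allI impI e(2))
    fix x y :: complex assume "norm x \<le> e / 3" "norm y \<le> e / 3"
    then show "norm (x, y) < e" using norm_Pair_le[of x y] e(1) by linarith
  qed (use e in simp)
next
  assume "\<exists>r>0. \<forall>x y. norm x \<le> r \<longrightarrow> norm y \<le> r \<longrightarrow> P (x, y)"
  then obtain r where r: "r > 0" "\<And>x y. norm x \<le> r \<Longrightarrow> norm y \<le> r \<Longrightarrow> P (x, y)" by blast
  have "P z" if "dist z 0 < r" for z
  proof -
    have "norm z < r" using that by simp
    then have "norm (fst z) \<le> r" "norm (snd z) \<le> r"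
      using norm_fst_le[of "fst z" "snd z"] norm_snd_le[of "snd z" "fst z"] by auto
    then show ?thesis using r(2)[of "fst z" "snd z"] by simp
  qed
  then show "\<forall>\<^sub>F z in nhds (0 :: complex \<times> complex). P z"
    using r(1) unfolding eventually_nhds_metric by blast
qed

lemma polyfun_norm_le:
  assumes "polyfun r B F" "norm x \<le> r" "norm y \<le> r"
  shows "norm (F x y) \<le> B"
proof -
  obtain h A where h: "finite A" "\<And>x y. F x y = (\<Sum>(a, b)\<in>A. h a b * x ^ a * y ^ b)"
     "(\<Sum>(a, b)\<in>A. norm (h a b) * r ^ (a + b)) \<le> B" using assms(1) unfolding polyfun_def by blast
  have "norm (F x y) \<le> (\<Sum>(a, b)\<in>A. norm (h a b) * r ^ (a + b))"
    unfolding h(2) using ps_terms_bound[OF assms(2,3)] by (intro sum_norm_le) blast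
  then show ?thesis using h(3) by simp
qed

text \<open>Since \<open>q(0) = 0\<close>, substituting \<open>x^n y - q(x) = x u(x,y)\<close> makes a monomial of degree
  \<open>k\<close> divisible by \<open>x^k\<close>.\<close>
lemma tail_subst_divisible:
  assumes c: "ps_summable c r0" "0 < r0" and q: "poly q 0 = 0" and n: "1 \<le> n" and m: "m \<le> K"
  shows "\<exists>d r. 0 < r \<and> ps_summable d r \<and> (\<forall>x y. norm x \<le> r \<longrightarrow> norm y \<le> r \<longrightarrow>
    ps_eval c (x, x ^ n * y - poly q x) - ev (trunc c K) x (x ^ n * y - poly q x)
      = x ^ m * ps_eval d (x, y))"
proof -
  obtain q' where q': "q = pCons 0 q'" using q by (metis poly_0_coeff_0 pCons_cases coeff_pCons_0)
  define u where "u x y = x ^ (n - 1) * y + poly (-q') x" for x y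
  have xu: "x * u x y = x ^ n * y - poly q x" for x y
    using n by (cases n) (simp_all add: u_def q' algebra_simps)
  obtain B0 where "polyfun 1 B0 (\<lambda>x y. poly (-q') x)" using polyfun_poly by blast
  from polyfun_add[OF polyfun_mult[OF polyfun_fst_power[of 1 "n - 1"] polyfun_snd] this]
  have u0: "polyfun 1 (1 + B0) u" by (simp add: u_def[abs_def])
  define B where "B = max 1 (1 + B0)"
  have B: "1 \<le> B" "polyfun 1 B u" using polyfun_mono[OF u0] by (auto simp: B_def)
  \<comment> \<open>This radius gives |x u| \<le> r B \<le> r0, so the substituted point stays where
    \<open>c\<close> converges.\<close>
  define r where "r = min 1 (r0 / B)"
  have r: "0 < r" "r \<le> 1" "r * B \<le> r0" "r \<le> r0"
  proof -
    show 1: "0 < r" and "r \<le> 1" using c B by (auto simp: r_def)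
    have "r \<le> r0 / B" by (simp add: r_def)
    then show 2: "r * B \<le> r0" using B by (simp add: field_simps)
    have "r * 1 \<le> r * B" using 1 B by (intro mult_left_mono) auto
    then show "r \<le> r0" using 2 by simp
  qed
  have u: "polyfun r B u" using polyfun_radius_mono[OF B(2)] r by simp
  define I where "I = - low_deg K"
  have I: "m \<le> i + j" if "(i, j) \<in> I" for i j using that m by (auto simp: I_def low_deg_def)
  \<comment> \<open>\<open>F\<close> is a tail term after substitution with x^m cancelled, possible
    since i + j \<ge> m; \<open>G\<close> bounds its coefficient norm.\<close>
  define F where "F = (\<lambda>(i, j) x y. c i j * x ^ (i + j - m) * u x y ^ j)"
  define G where "G = (\<lambda>(i, j). norm (c i j) * r ^ (i + j - m) * B ^ j)"
  have "polyfun r (G ij) (F ij)" for ij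
  proof -
    obtain i j where ij: "ij = (i, j)" by (cases ij)
    show ?thesis
      unfolding ij F_def G_def prod.case using r(1)
      by (intro polyfun_mult[OF polyfun_mult[OF polyfun_const polyfun_fst_power] polyfun_power[OF u]]) auto
  qed
  then have "\<forall>ij. \<exists>h s. ((\<lambda>(a, b). norm (h a b) * r ^ (a + b)) has_sum s) UNIV \<and> s \<le> G ij \<and>
     (\<forall>x y. F ij x y = ps_eval h (x, y))"
    using r by (intro allI polyfun_ps) auto
  then have "\<exists>h S. \<forall>ij. ((\<lambda>(a, b). norm (h ij a b) * r ^ (a + b)) has_sum S ij) UNIV \<and> S ij \<le> G ij \<and>
     (\<forall>x y. F ij x y = ps_eval (h ij) (x, y))"
    by (simp only: choice_iff)
  then obtain h S where h: "\<And>ij. ((\<lambda>(a, b). norm (h ij a b) * r ^ (a + b)) has_sum S ij) UNIV"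
      "\<And>ij. S ij \<le> G ij" "\<And>ij x y. F ij x y = ps_eval (h ij) (x, y)" by blast
  have "G summable_on I"
  proof (rule summable_on_comparison_test)
    show "(\<lambda>ij. inverse (r ^ m) * (case ij of (i, j) \<Rightarrow> norm (c i j) * r0 ^ (i + j))) summable_on I"
      using c(1) unfolding ps_summable_def
      by (intro summable_on_cmult_right) (rule summable_on_subset, auto)
    fix ij assume ij: "ij \<in> I"
    obtain i j where [simp]: "ij = (i, j)" by (cases ij)
    have "r ^ (i + j - m) * B ^ j = inverse (r ^ m) * (r ^ i * (r * B) ^ j)"
      using I[of i j] ij r(1) by (simp add: power_diff power_add power_mult_distrib field_simps)
    also have "\<dots> \<le> inverse (r ^ m) * (r0 ^ i * r0 ^ j)"
      using r B c by (intro mult_left_mono mult_mono power_mono) auto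
    finally show "G ij \<le> inverse (r ^ m) * (case ij of (i, j) \<Rightarrow> norm (c i j) * r0 ^ (i + j))"
      using mult_left_mono[of _ _ "norm (c i j)"] by (fastforce simp: G_def power_add algebra_simps)
    show "0 \<le> G ij" using r B by (simp add: G_def)
  qed
  then have "S summable_on I"
  proof (rule summable_on_comparison_test)
    show "0 \<le> S ij" for ij using h(1)[of ij] by (rule has_sum_nonneg) (use r in auto)
  qed (use h(2) in auto)
  from ps_family_sum[of r I h S, OF r(1) h(1) this] obtain d where d: "ps_summable d r"
     "\<And>x y. norm x \<le> r \<Longrightarrow> norm y \<le> r \<Longrightarrow> ps_eval d (x, y) = (\<Sum>\<^sub>\<infinity>k\<in>I. ps_eval (h k) (x, y))"
    by blast
  have "ps_eval c (x, x ^ n * y - poly q x) - ev (trunc c K) x (x ^ n * y - poly q x) = x ^ m * ps_eval d (x, y)"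
    if xy: "norm x \<le> r" "norm y \<le> r" for x y
  proof -
    have "norm (x * u x y) \<le> r * B"
      unfolding norm_mult using xy polyfun_norm_le[OF u xy] r by (intro mult_mono) auto
    then have "ps_eval c (x, x * u x y) - ev (trunc c K) x (x * u x y)
       = (\<Sum>\<^sub>\<infinity>(i, j)\<in>I. c i j * x ^ i * (x * u x y) ^ j)"
      unfolding I_def using xy r by (intro ps_eval_minus_trunc[OF c(1)]) auto
    also have "\<dots> = (\<Sum>\<^sub>\<infinity>ij\<in>I. x ^ m * F ij x y)"
    proof (rule infsum_cong)
      fix ij assume "ij \<in> I"
      obtain i j where ij: "ij = (i, j)" by (cases ij)
      have "x ^ i * x ^ j = x ^ m * x ^ (i + j - m)"
        using I[of i j] \<open>ij \<in> I\<close> ij by (simp add: power_add[symmetric])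
      then show "(case ij of (i, j) \<Rightarrow> c i j * x ^ i * (x * u x y) ^ j) = x ^ m * F ij x y"
        by (simp add: ij F_def power_mult_distrib mult.assoc[symmetric]) 
    qed
    also have "\<dots> = x ^ m * (\<Sum>\<^sub>\<infinity>ij\<in>I. F ij x y)" by (rule infsum_cmult_right')
    finally show ?thesis using d(2)[OF xy] by (simp add: xu h(3))
  qed
  then show ?thesis using d(1) r(1) by blast
qed

lemma ev_subst_eq_sum:
  "ev T x (x ^ n * t - poly q x) = (\<Sum>(a, b)\<in>supp T q. coeff (coeff (blow T q 0) b) a * x ^ (a + n * b) * t ^ b)"
  unfolding ev_eq_sum_supp
  by (intro sum.cong) (auto simp: power_add power_mult power_mult_distrib)

lemma ev_subst_divisible:
  assumes "\<forall>(a, b)\<in>supp T q. m \<le> a + n * b"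
  shows "\<exists>d. ps_summable d 1 \<and> (\<forall>x y. ev T x (x ^ n * y - poly q x) = x ^ m * ps_eval d (x, y))"
proof -
  define F where "F x y = (\<Sum>ab\<in>supp T q. coeff (coeff (blow T q 0) (snd ab)) (fst ab) * x ^ (fst ab + n * snd ab - m) * y ^ snd ab)" for x y
  have "\<exists>B. polyfun 1 B F"
    unfolding F_def by (rule polyfun_sum[OF finite_supp]) (blast intro: polyfun_monomial)
  then obtain B where "polyfun 1 B F" by blast
  from polyfun_ps[OF this] obtain d s where d: "((\<lambda>(a, b). norm (d a b) * 1 ^ (a + b)) has_sum s) UNIV"
     "\<And>x y. F x y = ps_eval d (x, y)" by auto
  have "ev T x (x ^ n * y - poly q x) = x ^ m * F x y" for x y
    unfolding ev_subst_eq_sum F_def sum_distrib_left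
  proof (rule sum.cong)
    fix ab assume "ab \<in> supp T q"
    then have "m \<le> fst ab + n * snd ab" using assms by auto
    then have "x ^ (fst ab + n * snd ab) = x ^ m * x ^ (fst ab + n * snd ab - m)"
      by (simp add: power_add[symmetric])
    then show "(case ab of (a, b) \<Rightarrow> coeff (coeff (blow T q 0) b) a * x ^ (a + n * b) * y ^ b) =
      x ^ m * (coeff (coeff (blow T q 0) (snd ab)) (fst ab) * x ^ (fst ab + n * snd ab - m) * y ^ snd ab)"
      by (simp add: case_prod_unfold)
  qed simp
  moreover have "ps_summable d 1" using has_sum_imp_summable[OF d(1)] by (simp add: ps_summable_def)
  ultimately show ?thesis using d(2) by auto
qed

lemma poly_lform_eq_sum:
  "poly (lform T q n) t = (\<Sum>(a, b)\<in>{(a, b)\<in>supp T q. a + n * b = nu T q n}. coeff (coeff (blow T q 0) b) a * t ^ b)"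
proof -
  let ?S = "lform T q n" and ?g = "\<lambda>b. (nu T q n - n * b, b)"
  have "{(a, b)\<in>supp T q. a + n * b = nu T q n} = ?g ` {b. coeff ?S b \<noteq> 0}"
  proof (intro set_eqI iffI)
    fix ab assume "ab \<in> ?g ` {b. coeff ?S b \<noteq> 0}"
    then obtain b where b: "ab = ?g b" "coeff ?S b \<noteq> 0" by blast
    from coeff_lform_supp[OF b(2)] obtain a where "(a, b) \<in> supp T q" "a + n * b = nu T q n" by blast
    then show "ab \<in> {(a, b)\<in>supp T q. a + n * b = nu T q n}" using b(1) by (auto simp flip: \<open>a + n * b = nu T q n\<close>)
  next
    fix ab assume "ab \<in> {(a, b)\<in>supp T q. a + n * b = nu T q n}"
    then obtain a b where ab: "ab = (a, b)" "(a, b) \<in> supp T q" "a + n * b = nu T q n" by auto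
    then have "coeff ?S b \<noteq> 0" "ab = ?g b"
      by (auto simp: coeff_lform' supp_def simp flip: \<open>a + n * b = nu T q n\<close>)
    then show "ab \<in> ?g ` {b. coeff ?S b \<noteq> 0}" by blast
  qed
  then have "(\<Sum>(a, b)\<in>{(a, b)\<in>supp T q. a + n * b = nu T q n}. coeff (coeff (blow T q 0) b) a * t ^ b)
     = (\<Sum>b | coeff ?S b \<noteq> 0. coeff (coeff (blow T q 0) b) (nu T q n - n * b) * t ^ b)"
    by (simp only:) (subst sum.reindex, auto simp: inj_on_def)
  also have "\<dots> = (\<Sum>b | coeff ?S b \<noteq> 0. coeff ?S b * t ^ b)"
    by (intro sum.cong) (auto simp: coeff_lform' split: if_splits)
  also have "\<dots> = poly ?S t"
    unfolding poly_altdef by (intro sum.mono_neutral_left) (auto intro: le_degree)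
  finally show ?thesis by simp
qed

text \<open>Each monomial outside the initial form has integral weighted degree above
  \<open>nu T q n\<close>, hence carries at least one more power of x.\<close>

lemma ev_leading_term:
  "\<exists>C\<ge>0. \<forall>x t. norm x \<le> 1 \<longrightarrow> norm t \<le> 1 \<longrightarrow>
    norm (ev T x (x ^ n * t - poly q x) - x ^ nu T q n * poly (lform T q n) t) \<le> C * norm x ^ Suc (nu T q n)"
proof (intro exI conjI allI impI)
  let ?c = "\<lambda>a b. coeff (coeff (blow T q 0) b) a" and ?\<nu> = "nu T q n"
  let ?A = "{(a, b)\<in>supp T q. a + n * b = ?\<nu>}"
  let ?C = "\<Sum>(a, b)\<in>supp T q - ?A. norm (?c a b)"
  show "0 \<le> ?C" by (auto intro!: sum_nonneg)
  fix x t :: complex assume xt: "norm x \<le> 1" "norm t \<le> 1"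
  have "ev T x (x ^ n * t - poly q x) = (\<Sum>(a, b)\<in>supp T q - ?A. ?c a b * x ^ (a + n * b) * t ^ b)
      + (\<Sum>(a, b)\<in>?A. ?c a b * x ^ (a + n * b) * t ^ b)"
    unfolding ev_subst_eq_sum by (rule sum.subset_diff) (auto simp: finite_supp)
  also have "(\<Sum>(a, b)\<in>?A. ?c a b * x ^ (a + n * b) * t ^ b) = x ^ ?\<nu> * poly (lform T q n) t"
    unfolding poly_lform_eq_sum sum_distrib_left by (intro sum.cong) auto
  finally have "norm (ev T x (x ^ n * t - poly q x) - x ^ ?\<nu> * poly (lform T q n) t)
     = norm (\<Sum>(a, b)\<in>supp T q - ?A. ?c a b * x ^ (a + n * b) * t ^ b)" by simp
  also have "\<dots> \<le> (\<Sum>(a, b)\<in>supp T q - ?A. norm (?c a b) * norm x ^ Suc ?\<nu>)"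
  proof (rule sum_norm_le)
    fix ab assume ab: "ab \<in> supp T q - ?A"
    obtain a b where [simp]: "ab = (a, b)" by (cases ab)
    have "Suc ?\<nu> \<le> a + n * b" using ab nu_le[of a b T q n] by auto
    then have "norm x ^ (a + n * b) \<le> norm x ^ Suc ?\<nu>" using xt by (intro power_decreasing) auto
    moreover have "norm t ^ b \<le> 1" using xt by (simp add: power_le_one)
    ultimately have "norm (?c a b) * (norm x ^ (a + n * b) * norm t ^ b) \<le> norm (?c a b) * (norm x ^ Suc ?\<nu> * 1)"
      by (intro mult_left_mono mult_mono) auto
    then show "norm (case ab of (a, b) \<Rightarrow> ?c a b * x ^ (a + n * b) * t ^ b)
       \<le> (case ab of (a, b) \<Rightarrow> norm (?c a b) * norm x ^ Suc ?\<nu>)"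
      by (simp add: norm_mult norm_power mult.assoc)
  qed
  also have "\<dots> = ?C * norm x ^ Suc ?\<nu>"
    by (simp add: sum_distrib_right case_prod_unfold)
  finally show "norm (ev T x (x ^ n * t - poly q x) - x ^ ?\<nu> * poly (lform T q n) t) \<le> ?C * norm x ^ Suc ?\<nu>" .
qed

section \<open>Comparing the series with its truncation along a curve\<close>

lemma poly_bound_linear:
  fixes q :: "complex poly"
  assumes "poly q 0 = 0"
  shows "\<exists>D\<ge>1. \<forall>x. norm x \<le> 1 \<longrightarrow> norm (poly q x) \<le> D * norm x"
proof -
  obtain q' where q': "q = pCons 0 q'" using assms by (metis poly_0_coeff_0 pCons_cases coeff_pCons_0)
  obtain B where B: "polyfun 1 B (\<lambda>x y. poly q' x)" using polyfun_poly by blast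
  have "norm (poly q x) \<le> max 1 B * norm x" if "norm x \<le> 1" for x
  proof -
    have "norm (poly q' x) \<le> max 1 B" using polyfun_norm_le[OF B that, of 0] by simp
    then show ?thesis unfolding q' by (simp add: norm_mult mult.commute mult_left_mono)
  qed
  then show ?thesis by (intro exI[of _ "max 1 B"]) auto
qed

lemma curve_bound:
  fixes q :: "complex poly"
  assumes "poly q 0 = 0" "1 \<le> n"
  shows "\<exists>D\<ge>1. \<forall>x t. norm x \<le> 1 \<longrightarrow> norm t \<le> 1 \<longrightarrow> norm (x ^ n * t - poly q x) \<le> D * norm x"
proof -
  obtain D where D: "D \<ge> 1" "\<And>x. norm x \<le> 1 \<Longrightarrow> norm (poly q x) \<le> D * norm x"
    using poly_bound_linear[OF assms(1)] by blast
  have "norm (x ^ n * t - poly q x) \<le> (1 + D) * norm x" if "norm x \<le> 1" "norm t \<le> 1" for x t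
  proof -
    have "norm x ^ n * norm t \<le> norm x ^ 1 * 1"
      using that assms(2) by (intro mult_mono power_decreasing) auto
    then have "norm (x ^ n * t) \<le> norm x" by (simp add: norm_mult norm_power)
    then show ?thesis using D(2)[OF that(1)] norm_triangle_ineq4[of "x ^ n * t" "poly q x"]
      by (simp add: distrib_right)
  qed
  then show ?thesis using D(1) by (intro exI[of _ "1 + D"]) auto
qed

text \<open>The truncation error is of order \<open>x^K\<close> along the curves, so it does not affect the
  leading term if the latter has order below \<open>K\<close>.\<close>
lemma ps_eval_leading_term:
  assumes c: "ps_summable c r0" "0 < r0" and q: "poly q 0 = 0" "1 \<le> n"
    and \<nu>: "nu (trunc c K) q n < K"
  shows "\<exists>C\<ge>0. \<exists>\<delta>>0. \<forall>x t. norm x \<le> \<delta> \<longrightarrow> norm t \<le> 1 \<longrightarrow>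
    norm (ps_eval c (x, x ^ n * t - poly q x)
       - x ^ nu (trunc c K) q n * poly (lform (trunc c K) q n) t) \<le> C * norm x ^ Suc (nu (trunc c K) q n)"
proof -
  let ?T = "trunc c K" and ?\<nu> = "nu (trunc c K) q n"
  obtain C where C: "C \<ge> 0" "\<And>x t. norm x \<le> 1 \<Longrightarrow> norm t \<le> 1 \<Longrightarrow>
    norm (ev ?T x (x ^ n * t - poly q x) - x ^ ?\<nu> * poly (lform ?T q n) t) \<le> C * norm x ^ Suc ?\<nu>"
    using ev_leading_term by blast
  obtain D where D: "D \<ge> 1" "\<And>x t. norm x \<le> 1 \<Longrightarrow> norm t \<le> 1 \<Longrightarrow> norm (x ^ n * t - poly q x) \<le> D * norm x"
    using curve_bound[OF q] by blast
  obtain E where E: "E \<ge> 0" "\<And>x y. norm x \<le> r0 \<Longrightarrow> norm y \<le> r0 \<Longrightarrow>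
    norm (ps_eval c (x, y) - ev ?T x y) \<le> E * max (norm x) (norm y) ^ K"
    using ps_eval_trunc_error[OF c] by blast
  define \<delta> where "\<delta> = min 1 (r0 / D)"
  have \<delta>: "0 < \<delta>" using c D by (simp add: \<delta>_def)
  have "norm (ps_eval c (x, x ^ n * t - poly q x) - x ^ ?\<nu> * poly (lform ?T q n) t)
     \<le> (C + E * D ^ K) * norm x ^ Suc ?\<nu>" if x: "norm x \<le> \<delta>" and t: "norm t \<le> 1" for x t
  proof -
    let ?y = "x ^ n * t - poly q x"
    have x1: "norm x \<le> 1" and xr: "D * norm x \<le> r0"
      using x D(1) by (auto simp: \<delta>_def field_simps)
    have y: "norm ?y \<le> D * norm x" by (rule D(2)[OF x1 t])
    have xD: "norm x \<le> D * norm x" using D(1) by (simp add: mult_le_cancel_right1)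
    have "norm (ps_eval c (x, ?y) - ev ?T x ?y) \<le> E * max (norm x) (norm ?y) ^ K"
      using xr y xD by (intro E(2)) auto
    also have "\<dots> \<le> E * (D * norm x) ^ K"
      using E(1) y xD by (intro mult_left_mono power_mono) (auto simp: le_max_iff_disj)
    also have "\<dots> \<le> E * (D ^ K * norm x ^ Suc ?\<nu>)"
      unfolding power_mult_distrib using E(1) D(1) \<nu> x1
      by (intro mult_left_mono power_decreasing) auto
    finally have "norm (ps_eval c (x, ?y) - ev ?T x ?y) \<le> E * D ^ K * norm x ^ Suc ?\<nu>" by (simp add: mult.assoc)
    moreover note C(2)[OF x1 t]
    moreover have "norm (ps_eval c (x, ?y) - x ^ ?\<nu> * poly (lform ?T q n) t)
       \<le> norm (ps_eval c (x, ?y) - ev ?T x ?y) + norm (ev ?T x ?y - x ^ ?\<nu> * poly (lform ?T q n) t)"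
      using norm_triangle_ineq[of "ps_eval c (x, ?y) - ev ?T x ?y" "ev ?T x ?y - x ^ ?\<nu> * poly (lform ?T q n) t"] by simp
    ultimately show ?thesis by (simp only: distrib_right)
  qed
  moreover have "0 \<le> C + E * D ^ K" using C E D by simp
  ultimately show ?thesis using \<delta> by blast
qed

text \<open>Otherwise x^\<nu> S(t), with S the leading form, would be O(x^(\<nu>+1)) for all small
  t; letting x tend to 0, S vanishes on a disc and is 0. The minimum with K appears because the
  leading term of the truncation is that of the series only for orders below K.\<close>

lemma nu_ge_of_divisible:
  assumes c: "ps_summable c r0" "0 < r0" and q: "poly q 0 = 0" "1 \<le> n" and T: "trunc c K \<noteq> 0"
    and d: "ps_summable d r1" "0 < r1" "0 < r"
    and eq: "\<And>x y. norm x \<le> r \<Longrightarrow> norm y \<le> r \<Longrightarrow> ps_eval c (x, x ^ n * y - poly q x) = x ^ k * ps_eval d (x, y)"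
  shows "min k K \<le> nu (trunc c K) q n"
proof (rule ccontr)
  let ?\<nu> = "nu (trunc c K) q n" and ?S = "lform (trunc c K) q n"
  assume neg: "\<not> min k K \<le> ?\<nu>"
  then have \<nu>: "?\<nu> < K" "?\<nu> < k" by auto
  obtain C \<delta> where C: "C \<ge> 0" "\<delta> > 0" "\<And>x t. norm x \<le> \<delta> \<Longrightarrow> norm t \<le> 1 \<Longrightarrow>
    norm (ps_eval c (x, x ^ n * t - poly q x) - x ^ ?\<nu> * poly ?S t) \<le> C * norm x ^ Suc ?\<nu>"
    using ps_eval_leading_term[OF c q \<nu>(1)] by metis
  obtain E where E: "E \<ge> 0" "\<And>x y. norm x \<le> r1 \<Longrightarrow> norm y \<le> r1 \<Longrightarrow> norm (ps_eval d (x, y)) \<le> E"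
    using ps_eval_bounded[OF d(1,2)] by blast
  define e where "e = min (min 1 \<delta>) (min r r1)"
  have e: "e > 0" "e \<le> 1" "e \<le> \<delta>" "e \<le> r" "e \<le> r1" using C d by (auto simp: e_def)
  have "poly ?S t = 0" if t: "norm t \<le> e" for t
  proof (rule ccontr)
    assume nz: "poly ?S t \<noteq> 0"
    have bound: "norm (poly ?S t) \<le> (C + E) * s" if s: "0 < s" "s \<le> e" for s
    proof -
      have ns: "norm (complex_of_real s) = s" using s by simp
      let ?x = "complex_of_real s"
      have "norm (ps_eval c (?x, ?x ^ n * t - poly q ?x)) \<le> s ^ k * E"
        using eq[of ?x t] E(2)[of ?x t] s t e ns by (simp add: norm_mult norm_power mult_left_mono)
      also have "\<dots> \<le> s ^ Suc ?\<nu> * E"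
        using \<nu> s e E by (intro mult_right_mono power_decreasing) auto
      finally have "norm (ps_eval c (?x, ?x ^ n * t - poly q ?x)) \<le> E * s ^ Suc ?\<nu>" by (simp add: mult.commute)
      moreover have "norm (ps_eval c (?x, ?x ^ n * t - poly q ?x) - ?x ^ ?\<nu> * poly ?S t) \<le> C * s ^ Suc ?\<nu>"
        using C(3)[of ?x t] s t e ns by simp
      ultimately have "norm (?x ^ ?\<nu> * poly ?S t) \<le> (C + E) * s ^ Suc ?\<nu>"
        using norm_triangle_ineq3[of "ps_eval c (?x, ?x ^ n * t - poly q ?x)" "?x ^ ?\<nu> * poly ?S t"]
        by (simp only: distrib_right)
      then have "s ^ ?\<nu> * norm (poly ?S t) \<le> s ^ ?\<nu> * ((C + E) * s)"
        using ns by (simp add: norm_mult norm_power algebra_simps)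
      then show ?thesis using s by (simp add: mult_le_cancel_left_pos)
    qed
    \<comment> \<open>Makes (C + E) s at most half of |S(t)|, against \<open>bound\<close>; the
      summand 1 keeps the denominator positive.\<close>
    define s where "s = min e (norm (poly ?S t) / (2 * (C + E + 1)))"
    have pos: "C + E + 1 > 0" using C E by simp
    have "s \<le> norm (poly ?S t) / (2 * (C + E + 1))" by (simp add: s_def)
    then have s: "0 < s" "s \<le> e" "s * (2 * (C + E + 1)) \<le> norm (poly ?S t)"
      using e nz pos by (simp_all add: pos_le_divide_eq) (simp_all add: s_def)
    have "(C + E) * s \<le> (C + E + 1) * s" using s by simp
    also have "\<dots> \<le> norm (poly ?S t) / 2" using s by (simp add: algebra_simps)
    also have "\<dots> < norm (poly ?S t)" using nz by simp
    finally show False using bound[OF s(1,2)] by simp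
  qed
  then have "cball 0 e \<subseteq> {t. poly ?S t = 0}" by auto
  moreover have "infinite (cball (0 :: complex) e)"
    using e uncountable_cball[of e "0 :: complex"] countable_finite by blast
  ultimately have "?S = 0" using poly_roots_finite finite_subset by blast
  then show False using lform_nonzero[OF T] by blast
qed

text \<open>The case m \<le> 0 covers an empty X, whose supremum in \<open>enat\<close> is 0. For m
  > 0, a supremum of at least m exceeds m - 1, so some element does.\<close>

lemma enat_ge_int_Sup:
  "enat_ge_int (Sup (enat ` X)) m \<longleftrightarrow> m \<le> 0 \<or> (\<exists>k\<in>X. m \<le> int k)"
proof -
  have *: "enat_ge_int e m \<longleftrightarrow> m \<le> 0 \<or> enat (nat m) \<le> e" for e
    by (cases e) (auto simp: enat_ge_int_def)
  have "enat (nat m) \<le> Sup (enat ` X) \<longleftrightarrow> (\<exists>k\<in>X. m \<le> int k)" if m: "m > 0"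
  proof
    assume "enat (nat m) \<le> Sup (enat ` X)"
    moreover have "enat (nat m - 1) < enat (nat m)" using m by simp
    ultimately have "enat (nat m - 1) < Sup (enat ` X)" by (rule order.strict_trans2[rotated])
    then obtain k where "k \<in> X" "enat (nat m - 1) < enat k" by (auto simp: less_Sup_iff)
    then show "\<exists>k\<in>X. m \<le> int k" using m by (intro bexI[of _ k]) auto
  next
    assume "\<exists>k\<in>X. m \<le> int k"
    then obtain k where k: "k \<in> X" "nat m \<le> k" by auto
    then have "enat (nat m) \<le> enat k" by simp
    also have "\<dots> \<le> Sup (enat ` X)" using k by (intro Sup_upper) auto
    finally show "enat (nat m) \<le> Sup (enat ` X)" .
  qed
  then show ?thesis unfolding * by (cases "m > 0") auto
qed

text \<open>After substitution the terms of degree at least K \<ge> m are divisible by x^m, so the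
  truncation decides. The condition is put on all of \<open>supp\<close> and not on
  \<open>nu\<close>, so that it holds, as it should, for a zero truncation.\<close>

lemma Oval_ge_iff:
  assumes "conv_ps c" "poly q 0 = 0" "1 \<le> n" "m \<le> int K"
  shows "enat_ge_int (Oval n q c) m \<longleftrightarrow> (\<forall>(a, b)\<in>supp (trunc c K) q. m \<le> int (a + n * b))"
proof -
  obtain r0 where c: "0 < r0" "ps_summable c r0" using assms(1) by (auto simp: conv_ps_def ps_summable_def)
  let ?T = "trunc c K"
  have "m \<le> int (a + n * b)" if d: "conv_ps d" and ev: "\<forall>\<^sub>F z in nhds 0. ps_eval c (fst z, fst z ^ n * snd z - poly q (fst z)) = fst z ^ k * ps_eval d z"
     and k: "m \<le> int k" and ab: "(a, b) \<in> supp ?T q" for d k a b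
  proof -
    have T: "?T \<noteq> 0" using ab blow_eq_0_iff[of ?T q 0] by (auto simp: supp_def)
    obtain r1 where r1: "0 < r1" "ps_summable d r1" using d by (auto simp: conv_ps_def ps_summable_def)
    obtain r where r: "r > 0" "\<And>x y. norm x \<le> r \<Longrightarrow> norm y \<le> r \<Longrightarrow> ps_eval c (x, x ^ n * y - poly q x) = x ^ k * ps_eval d (x, y)"
      using ev unfolding eventually_nhds_polydisc by auto
    have "min k K \<le> nu ?T q n"
      by (rule nu_ge_of_divisible[OF c(2,1) assms(2,3) T r1(2,1) r])
    also have "\<dots> \<le> a + n * b" by (rule nu_le[OF ab])
    finally show ?thesis using k assms(4) by linarith
  qed
  moreover have "\<exists>k d. conv_ps d \<and> (\<forall>\<^sub>F z in nhds 0. ps_eval c (fst z, fst z ^ n * snd z - poly q (fst z)) = fst z ^ k * ps_eval d z) \<and> m \<le> int k"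
    if m: "m > 0" and s: "\<forall>(a, b)\<in>supp ?T q. m \<le> int (a + n * b)"
  proof -
    have "nat m \<le> K" using assms(4) by simp
    from tail_subst_divisible[OF c(2,1) assms(2,3) this] obtain d r where d: "0 < r" "ps_summable d r"
      "\<And>x y. norm x \<le> r \<Longrightarrow> norm y \<le> r \<Longrightarrow> ps_eval c (x, x ^ n * y - poly q x) - ev ?T x (x ^ n * y - poly q x) = x ^ nat m * ps_eval d (x, y)"
      by blast
    have "\<forall>(a, b)\<in>supp ?T q. nat m \<le> a + n * b" using s by (auto simp: nat_le_iff)
    from ev_subst_divisible[OF this] obtain d' where d': "ps_summable d' 1"
      "\<And>x y. ev ?T x (x ^ n * y - poly q x) = x ^ nat m * ps_eval d' (x, y)" by blast
    define e where "e = min r 1"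
    have e: "0 < e" "e \<le> r" "e \<le> 1" using d by (auto simp: e_def)
    have de: "ps_summable d e" "ps_summable d' e" using d d' e ps_summable_mono by (meson less_imp_le)+
    let ?d = "\<lambda>i j. d i j + d' i j"
    have "conv_ps ?d" using ps_summable_add[OF de] e unfolding conv_ps_def ps_summable_def by auto
    moreover have "ps_eval c (x, x ^ n * y - poly q x) = x ^ nat m * ps_eval ?d (x, y)"
      if xy: "norm x \<le> e" "norm y \<le> e" for x y
      using ps_eval_add[OF de xy] d(3)[of x y] d'(2)[of x y] xy e by (simp add: algebra_simps)
    then have "\<forall>\<^sub>F z in nhds 0. ps_eval c (fst z, fst z ^ n * snd z - poly q (fst z)) = fst z ^ nat m * ps_eval ?d z"
      unfolding eventually_nhds_polydisc using e by auto
    ultimately show ?thesis using m by (intro exI[of _ "nat m"] exI[of _ ?d]) auto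
  qed
  ultimately have "m > 0 \<Longrightarrow> (\<exists>k d. conv_ps d \<and> (\<forall>\<^sub>F z in nhds 0. ps_eval c (fst z, fst z ^ n * snd z - poly q (fst z)) = fst z ^ k * ps_eval d z) \<and> m \<le> int k)
      \<longleftrightarrow> (\<forall>(a, b)\<in>supp ?T q. m \<le> int (a + n * b))" by blast
  then show ?thesis
    unfolding Oval_def enat_ge_int_Sup by (cases "m > 0") (auto intro: order_trans[of m 0])
qed

section \<open>Necessity\<close>

lemma poly_cpoly: "poly (cpoly q) (of_real x) = of_real (poly q x)"
  by (induction q) (auto simp: map_poly_pCons)

lemma poly_abs_le_power:
  fixes r :: "real poly"
  assumes "\<And>a. a < n \<Longrightarrow> coeff r a = 0"
  shows "\<exists>C\<ge>0. \<forall>x. \<bar>x\<bar> \<le> 1 \<longrightarrow> \<bar>poly r x\<bar> \<le> C * \<bar>x\<bar> ^ n"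
proof (intro exI conjI allI impI)
  show "0 \<le> (\<Sum>i\<le>degree r. \<bar>coeff r i\<bar>)" by (simp add: sum_nonneg)
  fix x :: real assume x: "\<bar>x\<bar> \<le> 1"
  have "\<bar>poly r x\<bar> \<le> (\<Sum>i\<le>degree r. \<bar>coeff r i * x ^ i\<bar>)" unfolding poly_altdef by (rule sum_abs)
  also have "\<dots> \<le> (\<Sum>i\<le>degree r. \<bar>coeff r i\<bar> * \<bar>x\<bar> ^ n)"
  proof (rule sum_mono)
    fix i
    show "\<bar>coeff r i * x ^ i\<bar> \<le> \<bar>coeff r i\<bar> * \<bar>x\<bar> ^ n"
    proof (cases "i < n")
      case False
      then have "\<bar>x\<bar> ^ i \<le> \<bar>x\<bar> ^ n" using x by (intro power_decreasing) auto
      then show ?thesis by (simp add: abs_mult power_abs mult_left_mono)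
    qed (simp add: assms)
  qed
  finally show "\<bar>poly r x\<bar> \<le> (\<Sum>i\<le>degree r. \<bar>coeff r i\<bar>) * \<bar>x\<bar> ^ n" by (simp add: sum_distrib_right)
qed

section \<open>Divergence over a strip along a curve\<close>

lemma nn_integral_inverse_eq_top:
  fixes c \<delta> :: real
  assumes "0 < c" "0 < \<delta>"
  shows "(\<integral>\<^sup>+x. ennreal (c / x) * indicator {0<..<\<delta>} x \<partial>lborel) = \<infinity>"
proof (rule ccontr)
  let ?J = "\<integral>\<^sup>+x. ennreal (c / x) * indicator {0<..<\<delta>} x \<partial>lborel"
  assume "?J \<noteq> \<infinity>"
  then obtain N where N: "?J \<le> of_nat N" 
    by (metis ennreal_Ex_less_of_nat infinity_ennreal_def less_imp_le less_top)
  define b where "b = \<delta> / 2"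
  \<comment> \<open>Chosen so that c (ln b - ln a) = N + 1, more than the supposed bound N.\<close>
  define a where "a = b * exp (- (real N + 1) / c)"
  have ab: "0 < a" "a \<le> b" "0 < b" "b < \<delta>" using assms by (auto simp: a_def b_def mult_le_cancel_left1 divide_nonpos_pos)
  have "has_bochner_integral lborel (\<lambda>x. c / x * indicator {a..b} x) (c * ln b - c * ln a)"
    using ab by (intro has_bochner_integral_FTC_Icc_real) (auto intro!: derivative_eq_intros continuous_intros)
  then have "(\<integral>\<^sup>+x. ennreal (c / x * indicator {a..b} x) \<partial>lborel) = ennreal (c * ln b - c * ln a)"
    using ab assms by (subst nn_integral_eq_integral)
      (auto simp: has_bochner_integral_iff indicator_def)
  also have "c * ln b - c * ln a = real N + 1"
    using ab assms by (simp add: a_def ln_mult distrib_left)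
  finally have "ennreal (real N + 1) = (\<integral>\<^sup>+x. ennreal (c / x * indicator {a..b} x) \<partial>lborel)" by simp
  also have "\<dots> \<le> ?J"
    using ab by (intro nn_integral_mono) (auto simp: indicator_def)
  also have "\<dots> \<le> ennreal (real N)" using N by (simp add: ennreal_of_nat_eq_real_of_nat)
  finally show False by simp
qed

lemma nn_integral_lborel_pair:
  fixes F :: "real \<times> real \<Rightarrow> ennreal"
  assumes "F \<in> borel_measurable borel"
  shows "(\<integral>\<^sup>+z. F z \<partial>lborel) = (\<integral>\<^sup>+x. \<integral>\<^sup>+y. F (x, y) \<partial>lborel \<partial>lborel)"
proof -
  have "F \<in> borel_measurable (lborel \<Otimes>\<^sub>M lborel)" using assms by (simp add: lborel_prod)
  from lborel.nn_integral_fst[OF this] show ?thesis by (simp add: lborel_prod)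
qed

text \<open>For fixed x the strip has width (\<beta> - \<alpha>) x^n, so integrating the lower bound
  over y leaves a positive multiple of 1 / x, which is not integrable at 0.\<close>

lemma curved_region_not_integrable:
  fixes f :: "real \<times> real \<Rightarrow> real" and g :: "real \<Rightarrow> real"
  assumes f: "set_integrable lborel U f" 
    and g: "g \<in> borel_measurable borel"
    and c: "0 < c" "0 < \<delta>" "\<alpha> < \<beta>"
    and U: "\<And>x t. 0 < x \<Longrightarrow> x < \<delta> \<Longrightarrow> \<alpha> \<le> t \<Longrightarrow> t \<le> \<beta> \<Longrightarrow> (x, x ^ n * t - g x) \<in> U"
    and lower: "\<And>x t. 0 < x \<Longrightarrow> x < \<delta> \<Longrightarrow> \<alpha> \<le> t \<Longrightarrow> t \<le> \<beta> \<Longrightarrow> c / x ^ Suc n \<le> f (x, x ^ n * t - g x)"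
  shows False
proof -
  note [measurable] = g
  define F :: "real \<times> real \<Rightarrow> ennreal" where
    "F = (\<lambda>z. ennreal (c / fst z ^ Suc n) * (if 0 < fst z \<and> fst z < \<delta> \<and> fst z ^ n * \<alpha> - g (fst z) \<le> snd z \<and> snd z \<le> fst z ^ n * \<beta> - g (fst z) then 1 else 0))"
  have F [measurable]: "F \<in> borel_measurable borel"
    unfolding F_def borel_prod[symmetric] by measurable
  have "(\<integral>\<^sup>+z. F z \<partial>lborel) \<le> (\<integral>\<^sup>+z. ennreal (norm (indicator U z *\<^sub>R f z)) \<partial>lborel)"
  proof (rule nn_integral_mono)
    fix z :: "real \<times> real"
    obtain x y where z: "z = (x, y)" by (cases z)
    show "F z \<le> ennreal (norm (indicator U z *\<^sub>R f z))"
    proof (cases "0 < x \<and> x < \<delta> \<and> x ^ n * \<alpha> - g x \<le> y \<and> y \<le> x ^ n * \<beta> - g x")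
      case True
      define t where "t = (y + g x) / x ^ n"
      have y: "y = x ^ n * t - g x" using True by (simp add: t_def)
      have t: "\<alpha> \<le> t" "t \<le> \<beta>" using True by (auto simp: t_def field_simps)
      have "F z = ennreal (c / x ^ Suc n)" using True by (simp add: F_def z)
      also have "\<dots> \<le> ennreal (norm (indicator U z *\<^sub>R f z))"
        using U[of x t] lower[of x t] True t unfolding z y by (intro ennreal_leI) (auto simp: indicator_def)
      finally show ?thesis .
    next
      case False
      then show ?thesis by (auto simp: F_def z)
    qed
  qed
  also have "\<dots> < \<infinity>"
    using f unfolding set_integrable_def integrable_iff_bounded by simp
  finally have fin: "(\<integral>\<^sup>+z. F z \<partial>lborel) < \<infinity>" .
  have "(\<integral>\<^sup>+z. F z \<partial>lborel) = (\<integral>\<^sup>+x. \<integral>\<^sup>+y. F (x, y) \<partial>lborel \<partial>lborel)"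
    by (rule nn_integral_lborel_pair[OF F])
  also have "\<dots> = (\<integral>\<^sup>+x. ennreal (c * (\<beta> - \<alpha>) / x) * indicator {0<..<\<delta>} x \<partial>lborel)"
  proof (rule nn_integral_cong)
    fix x :: real
    show "(\<integral>\<^sup>+y. F (x, y) \<partial>lborel) = ennreal (c * (\<beta> - \<alpha>) / x) * indicator {0<..<\<delta>} x"
    proof (cases "0 < x \<and> x < \<delta>")
      case True
      have le: "x ^ n * \<alpha> \<le> x ^ n * \<beta>" using True c by (intro mult_left_mono) auto
      have "(\<integral>\<^sup>+y. F (x, y) \<partial>lborel) = (\<integral>\<^sup>+y. ennreal (c / x ^ Suc n) * indicator {x ^ n * \<alpha> - g x..x ^ n * \<beta> - g x} y \<partial>lborel)"
        using True by (intro nn_integral_cong) (auto simp: F_def indicator_def)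
      also have "\<dots> = ennreal (c / x ^ Suc n) * ennreal (x ^ n * \<beta> - x ^ n * \<alpha>)"
        using le by (subst nn_integral_cmult_indicator) auto
      also have "\<dots> = ennreal (c / x ^ Suc n * (x ^ n * \<beta> - x ^ n * \<alpha>))"
        using c True by (subst ennreal_mult'') (auto simp: le)
      also have "c / x ^ Suc n * (x ^ n * \<beta> - x ^ n * \<alpha>) = c * (\<beta> - \<alpha>) / x"
        using True by (simp add: field_simps)
      finally show ?thesis using True by simp
    next
      case False
      then show ?thesis by (auto simp: F_def)
    qed
  qed
  also have "\<dots> = \<infinity>"
    using c by (intro nn_integral_inverse_eq_top) auto
  finally show False using fin by simp
qed

section \<open>The factors of P and the lower bound for |Q/P|\<close>

definition factor :: "(nat \<Rightarrow> nat) \<Rightarrow> (nat \<Rightarrow> real poly) \<Rightarrow> nat \<Rightarrow> real \<times> real \<Rightarrow> complex" where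
  "factor L q i z = complex_of_real (snd z) + complex_of_real (poly (q i) (fst z))
     + \<i> * complex_of_real (fst z) ^ (2 * L i)"

lemma Re_factor: "Re (factor L q i z) = snd z + poly (q i) (fst z)"
  by (simp add: factor_def flip: of_real_power)

lemma Im_factor: "Im (factor L q i z) = fst z ^ (2 * L i)"
  by (simp add: factor_def flip: of_real_power)

lemma norm_factor_ge:
  "\<bar>snd z + poly (q i) (fst z)\<bar> \<le> norm (factor L q i z)"
  "\<bar>fst z\<bar> ^ (2 * L i) \<le> norm (factor L q i z)"
  using abs_Re_le_cmod[of "factor L q i z"] abs_Im_le_cmod[of "factor L q i z"]
  by (auto simp: Re_factor Im_factor power_abs)

text \<open>The real part is x^(2 L_j) t + (q_i - q_j)(x) and the imaginary part x^(2 L_i); all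
  three terms vanish to order at least \<open>Oij L q i j\<close>.\<close>

lemma norm_factor_curve_le:
  "\<exists>C\<ge>1. \<forall>x t. 0 < x \<longrightarrow> x \<le> 1 \<longrightarrow> \<bar>t\<bar> \<le> 1 \<longrightarrow>
     norm (factor L q i (x, x ^ (2 * L j) * t - poly (q j) x)) \<le> C * x ^ Oij L q i j"
proof -
  have O: "Oij L q i j \<le> 2 * L i" "Oij L q i j \<le> 2 * L j" "\<And>a. a < Oij L q i j \<Longrightarrow> coeff (q i - q j) a = 0"
    using le_Oij_iff[of "Oij L q i j" L q i j] by auto
  obtain C where C: "C \<ge> 0" "\<And>x. \<bar>x\<bar> \<le> 1 \<Longrightarrow> \<bar>poly (q i - q j) x\<bar> \<le> C * \<bar>x\<bar> ^ Oij L q i j"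
    using poly_abs_le_power[OF O(3)] by blast
  have "norm (factor L q i (x, x ^ (2 * L j) * t - poly (q j) x)) \<le> (C + 2) * x ^ Oij L q i j"
    if x: "0 < x" "x \<le> 1" "\<bar>t\<bar> \<le> 1" for x t
  proof -
    let ?z = "factor L q i (x, x ^ (2 * L j) * t - poly (q j) x)"
    have "\<bar>x ^ (2 * L j) * t\<bar> \<le> x ^ Oij L q i j * 1"
      unfolding abs_mult using x O by (intro mult_mono) (auto simp: power_decreasing power_abs)
    moreover have "\<bar>poly (q i) x - poly (q j) x\<bar> \<le> C * x ^ Oij L q i j" using C(2)[of x] x by simp
    moreover have "x ^ (2 * L i) \<le> x ^ Oij L q i j" using x O by (intro power_decreasing) auto
    moreover have "norm ?z \<le> \<bar>x ^ (2 * L j) * t - poly (q j) x + poly (q i) x\<bar> + \<bar>x ^ (2 * L i)\<bar>"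
      using cmod_le[of ?z] by (simp add: Re_factor Im_factor)
    moreover have "\<bar>x ^ (2 * L i)\<bar> = x ^ (2 * L i)" using x by simp
    ultimately show ?thesis by (simp only: distrib_right)
  qed
  then show ?thesis using C by (intro exI[of _ "C + 2"]) auto
qed

lemma poly_nonvanishing_interval:
  fixes S :: "complex poly"
  assumes "S \<noteq> 0"
  shows "\<exists>\<alpha> \<beta> c. -1 \<le> \<alpha> \<and> \<alpha> < \<beta> \<and> \<beta> \<le> 1 \<and> 0 < c \<and>
    (\<forall>t. \<alpha> \<le> t \<longrightarrow> t \<le> \<beta> \<longrightarrow> c \<le> norm (poly S (complex_of_real t)))"
proof -
  have "finite (complex_of_real -` {t. poly S t = 0})"
    using poly_roots_finite[OF assms] by (rule finite_vimageI) (simp add: inj_on_def)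
  then have "\<not> {0<..<1} \<subseteq> complex_of_real -` {t. poly S t = 0}"
    using infinite_Ioo[of 0 "1 :: real"] finite_subset zero_less_one by blast
  then obtain t0 where "t0 \<in> {0<..<1}" "poly S (complex_of_real t0) \<noteq> 0" by blast
  then have t0: "0 < t0" "t0 < 1" "poly S (complex_of_real t0) \<noteq> 0" by auto
  define c where "c = norm (poly S (complex_of_real t0)) / 2"
  have c: "0 < c" using t0 by (simp add: c_def)
  have "isCont (\<lambda>t. poly S (complex_of_real t)) t0" by (intro continuous_intros)
  then obtain e where e: "e > 0" "\<And>t. \<bar>t - t0\<bar> < e \<Longrightarrow> norm (poly S (complex_of_real t) - poly S (complex_of_real t0)) < c"
    using c unfolding continuous_at_eps_delta dist_norm by (metis real_norm_def)
  define d where "d = min (e / 2) (min t0 (1 - t0))"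
  have d: "0 < d" "d < e" "d \<le> t0" "d \<le> 1 - t0" using e t0 by (auto simp: d_def min_def)
  have "c \<le> norm (poly S (complex_of_real t))" if "t0 - d \<le> t" "t \<le> t0 + d" for t
  proof -
    have "norm (poly S (complex_of_real t) - poly S (complex_of_real t0)) < c" using that d by (intro e(2)) auto
    then show ?thesis
      using norm_triangle_ineq2[of "poly S (complex_of_real t0)" "poly S (complex_of_real t)"]
      by (simp add: c_def norm_minus_commute)
  qed
  then show ?thesis using c d t0 by (intro exI[of _ "t0 - d"] exI[of _ "t0 + d"] exI[of _ c]) auto
qed

lemma Lp_loc_imp_weight_pos:
  assumes M: "finite I" "j \<in> I" and L: "1 \<le> L j" and q0: "poly (q j) 0 = 0" and p: "1 \<le> p"
    and c: "ps_summable c r0" "0 < r0" and K: "(\<Sum>i\<in>I. Oij L q i j) \<le> K" and T: "trunc c K \<noteq> 0"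
    and Lp: "Lp_loc p (\<lambda>z. ps_eval c (complex_of_real (fst z), complex_of_real (snd z)) / (\<Prod>i\<in>I. factor L q i z))"
  shows "0 < weight (trunc c K) L q I p j (2 * L j)"
proof (rule ccontr)
  define T where "T = trunc c K"
  define n where "n = 2 * L j"
  define \<nu> where "\<nu> = nu T (cpoly (q j)) n"
  define S where "S = lform T (cpoly (q j)) n"
  define N where "N = (\<Sum>i\<in>I. Oij L q i j)"
  let ?Q = "\<lambda>z. ps_eval c (complex_of_real (fst z), complex_of_real (snd z))"
  let ?P = "\<lambda>z. \<Prod>i\<in>I. factor L q i z"
  assume "\<not> 0 < weight (trunc c K) L q I p j (2 * L j)"
  moreover have "(\<Sum>i\<in>I. min n (Oij L q i j)) = N"
  proof -
    have "Oij L q i j \<le> n" for i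
      using le_Oij_iff[of "Oij L q i j" L q i j] by (simp add: n_def)
    then show ?thesis by (simp add: N_def min_absorb2)
  qed
  ultimately have w: "p * (real \<nu> - real N) + real n + 1 \<le> 0"
    by (simp only: weight_def \<nu>_def T_def n_def not_less)
  \<comment> \<open>This places \<nu> below K, where the leading term of the truncation is also that
    of the series.\<close>
  have "\<nu> < N"
  proof (rule ccontr)
    assume "\<not> \<nu> < N"
    then have "0 \<le> p * (real \<nu> - real N)" using p by simp
    then show False using w by simp
  qed
  then have \<nu>K: "\<nu> < K" using K by (simp add: N_def)
  have cq0: "poly (cpoly (q j)) 0 = 0" using poly_cpoly[of "q j" 0] q0 by simp
  have n1: "1 \<le> n" using L by (simp add: n_def)
  obtain C \<delta>1 where C: "C \<ge> 0" "\<delta>1 > 0" "\<And>x t. norm x \<le> \<delta>1 \<Longrightarrow> norm t \<le> 1 \<Longrightarrow>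
    norm (ps_eval c (x, x ^ n * t - poly (cpoly (q j)) x) - x ^ \<nu> * poly S t) \<le> C * norm x ^ Suc \<nu>"
    using ps_eval_leading_term[OF c cq0 n1, of K] \<nu>K unfolding \<nu>_def S_def T_def by metis
  obtain D where D: "D \<ge> 1" "\<And>x t. norm x \<le> 1 \<Longrightarrow> norm t \<le> 1 \<Longrightarrow> norm (x ^ n * t - poly (cpoly (q j)) x) \<le> D * norm x"
    using curve_bound[OF cq0 n1] by blast
  have "S \<noteq> 0" using lform_nonzero[OF assms(9)] by (simp add: S_def T_def)
  then obtain \<alpha> \<beta> s where s: "-1 \<le> \<alpha>" "\<alpha> < \<beta>" "\<beta> \<le> 1" "0 < s"
     "\<And>t. \<alpha> \<le> t \<Longrightarrow> t \<le> \<beta> \<Longrightarrow> s \<le> norm (poly S (complex_of_real t))"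
    using poly_nonvanishing_interval by metis
  have "\<forall>i. \<exists>C\<ge>1. \<forall>x t. 0 < x \<longrightarrow> x \<le> 1 \<longrightarrow> \<bar>t\<bar> \<le> 1 \<longrightarrow>
     norm (factor L q i (x, x ^ n * t - poly (q j) x)) \<le> C * x ^ Oij L q i j"
    unfolding n_def using norm_factor_curve_le by blast
  then have "\<exists>B. \<forall>i. B i \<ge> 1 \<and> (\<forall>x t. 0 < x \<longrightarrow> x \<le> 1 \<longrightarrow> \<bar>t\<bar> \<le> 1 \<longrightarrow>
     norm (factor L q i (x, x ^ n * t - poly (q j) x)) \<le> B i * x ^ Oij L q i j)"
    by (simp only: choice_iff)
  then obtain B where B: "\<And>i. B i \<ge> 1" "\<And>i x t. 0 < x \<Longrightarrow> x \<le> 1 \<Longrightarrow> \<bar>t\<bar> \<le> 1 \<Longrightarrow>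
     norm (factor L q i (x, x ^ n * t - poly (q j) x)) \<le> B i * x ^ Oij L q i j" by blast
  define A where "A = (\<Prod>i\<in>I. B i)"
  have A: "A \<ge> 1" unfolding A_def using B(1) by (intro prod_ge_1) auto
  obtain U where U: "open U" "0 \<in> U" "set_integrable lborel U (\<lambda>z. norm (?Q z / ?P z) powr p)"
    using Lp unfolding Lp_loc_def by blast
  obtain e where e: "e > 0" "ball 0 e \<subseteq> U" using U openE by blast
  \<comment> \<open>The four bounds give x \<le> 1, the range of the leading-term expansion, a strip
    inside U, and an error of at most half the main term.\<close>
  define \<delta> where "\<delta> = min (min 1 \<delta>1) (min (e / (1 + D)) (s / (2 * (C + 1))))"
  have \<delta>: "0 < \<delta>" using C D e s by (auto simp: \<delta>_def)
  have \<delta>x: "x \<le> 1" "x \<le> \<delta>1" "(1 + D) * x < e" "C * x \<le> s / 2" if x: "0 < x" "x < \<delta>" for x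
  proof -
    show "x \<le> 1" "x \<le> \<delta>1" using x by (auto simp: \<delta>_def)
    have "x < e / (1 + D)" using x by (simp add: \<delta>_def)
    then show "(1 + D) * x < e" using D by (simp add: pos_less_divide_eq mult.commute)
    have "x < s / (2 * (C + 1))" using x by (simp add: \<delta>_def)
    then have "x * (2 * (C + 1)) < s" using C by (simp add: pos_less_divide_eq)
    then show "C * x \<le> s / 2" using x by (simp add: algebra_simps)
  qed
  define g where "g x = poly (q j) x" for x
  have y: "complex_of_real (x ^ n * t - g x) = complex_of_real x ^ n * complex_of_real t - poly (cpoly (q j)) (complex_of_real x)" for x t
    by (simp add: g_def poly_cpoly)
  show False
  proof (rule curved_region_not_integrable[OF U(3), of g "(s / (2 * A)) powr p" \<delta> \<alpha> \<beta> n])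
    show "g \<in> borel_measurable borel"
      unfolding g_def by (intro borel_measurable_continuous_onI continuous_intros)
    fix x t :: real assume x: "0 < x" "x < \<delta>" and t: "\<alpha> \<le> t" "t \<le> \<beta>"
    note dx = \<delta>x[OF x]
    let ?y = "x ^ n * t - g x"
    have t1: "\<bar>t\<bar> \<le> 1" using t s by auto
    have "\<bar>?y\<bar> \<le> D * x"
      using D(2)[of "complex_of_real x" "complex_of_real t"] x dx t1 unfolding y[symmetric] norm_of_real by simp
    then have "norm (x, ?y) \<le> (1 + D) * x"
      using norm_Pair_le[of x ?y] x by (simp add: distrib_right)
    then have "(x, ?y) \<in> ball 0 e" using dx by simp
    then show "(x, ?y) \<in> U" using e by blast
    have "norm (?Q (x, ?y) - complex_of_real x ^ \<nu> * poly S (complex_of_real t)) \<le> C * x ^ Suc \<nu>"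
      using C(3)[of "complex_of_real x" "complex_of_real t"] x dx t1 by (simp only: fst_conv snd_conv y) simp
    moreover have "s * x ^ \<nu> \<le> norm (complex_of_real x ^ \<nu> * poly S (complex_of_real t))"
      using s(5)[OF t] x by (simp add: norm_mult norm_power mult.commute mult_left_mono)
    moreover have "C * x ^ Suc \<nu> \<le> s / 2 * x ^ \<nu>"
      using mult_right_mono[OF dx(4), of "x ^ \<nu>"] x by (simp add: mult.assoc)
    ultimately have Q: "s / 2 * x ^ \<nu> \<le> norm (?Q (x, ?y))"
      using norm_triangle_ineq3[of "?Q (x, ?y)" "complex_of_real x ^ \<nu> * poly S (complex_of_real t)"] by linarith
    have "norm (?P (x, ?y)) = (\<Prod>i\<in>I. norm (factor L q i (x, ?y)))" by (simp add: prod_norm)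
    also have "\<dots> \<le> (\<Prod>i\<in>I. B i * x ^ Oij L q i j)"
      using B(2)[OF x(1) dx(1) t1] by (intro prod_mono) (auto simp: g_def)
    also have "\<dots> = A * x ^ N"
      by (simp add: A_def N_def prod.distrib power_sum)
    finally have P: "norm (?P (x, ?y)) \<le> A * x ^ N" .
    have "0 < norm (factor L q i (x, ?y))" for i
    proof -
      have "0 < \<bar>fst (x, ?y)\<bar> ^ (2 * L i)" using x by simp
      also have "\<dots> \<le> norm (factor L q i (x, ?y))" by (rule norm_factor_ge(2))
      finally show ?thesis .
    qed
    then have "0 < norm (?P (x, ?y))" unfolding prod_norm[symmetric] by (intro prod_pos) blast
    then have "s / 2 * x ^ \<nu> / (A * x ^ N) \<le> norm (?Q (x, ?y)) / norm (?P (x, ?y))"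
      using Q P x s by (intro frac_le) auto
    also have "s / 2 * x ^ \<nu> / (A * x ^ N) = s / (2 * A) * x powr (real \<nu> - real N)"
      using x by (simp add: powr_diff powr_realpow)
    finally have QP: "(s / (2 * A) * x powr (real \<nu> - real N)) powr p \<le> norm (?Q (x, ?y) / ?P (x, ?y)) powr p"
      using s A p by (intro powr_mono2) (auto simp: norm_divide)
    have "x powr (- real (Suc n)) = 1 / x ^ Suc n"
      using x by (simp only: powr_minus_divide powr_realpow)
    then have "(s / (2 * A)) powr p / x ^ Suc n = (s / (2 * A)) powr p * x powr (- real (Suc n))" by simp
    \<comment> \<open>The failing weight says p (\<nu> - N) \<le> -(n + 1), and x \<le> 1 reverses
      the order of the exponents.\<close>
    also have "\<dots> \<le> (s / (2 * A)) powr p * x powr (p * (real \<nu> - real N))"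
      using x dx w by (intro mult_left_mono powr_mono') auto
    also have "\<dots> = (s / (2 * A) * x powr (real \<nu> - real N)) powr p"
      using s A by (subst powr_mult) (simp_all add: powr_powr mult.commute)
    also note QP
    finally show "(s / (2 * A)) powr p / x ^ Suc n \<le> norm (?Q (x, ?y) / ?P (x, ?y)) powr p" .
  qed (use s A \<delta> in auto)
qed

section \<open>Pointwise bounds near the curves\<close>

text \<open>The minimum of the individual constants works. To fit this pattern, several estimates
  below use one number e at once as radius, as constant and even as exponent.\<close>

lemma finite_uniform_pos:
  fixes P :: "'a \<Rightarrow> real \<Rightarrow> bool"
  assumes "finite I" "\<And>j. j \<in> I \<Longrightarrow> \<exists>e>0. P j e"
    and mono: "\<And>j e e'. P j e \<Longrightarrow> 0 < e' \<Longrightarrow> e' \<le> e \<Longrightarrow> P j e'"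
  shows "\<exists>e>0. \<forall>j\<in>I. P j e"
  using assms(1,2)
proof (induction I rule: finite_induct)
  case empty
  show ?case by (rule exI[of _ 1]) simp
next
  case (insert j I)
  obtain e where e: "e > 0" "\<forall>j\<in>I. P j e" using insert by auto
  obtain e' where e': "e' > 0" "P j e'" using insert.prems[of j] by auto
  have "\<forall>k\<in>insert j I. P k (min e e')"
    using e e' mono[of _ e "min e e'"] mono[of _ e' "min e e'"] by auto
  then show ?case using e e' by (intro exI[of _ "min e e'"]) auto
qed

text \<open>As m is an integer, the minimum has no kink inside [n, n + 1].\<close>

lemma min_nat_interpolate:
  fixes m n :: nat and \<theta> :: real
  assumes "0 \<le> \<theta>" "\<theta> \<le> 1"
  shows "min (real n + \<theta>) (real m) = (1 - \<theta>) * real (min n m) + \<theta> * real (min (Suc n) m)"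
proof (cases "m \<le> n")
  case True
  then show ?thesis using assms by (simp add: algebra_simps)
next
  case False
  then have "real n + 1 \<le> real m" by simp
  then show ?thesis using assms False by (simp add: algebra_simps min_def)
qed

text \<open>Between consecutive integers the exponent is affine in \<open>s\<close>, so positivity at the
  integers suffices.\<close>
lemma exponent_lower_bound:
  assumes w: "\<And>n. n \<le> 2 * L j \<Longrightarrow> 0 < weight T L q I p j n" and p: "1 \<le> p" and L: "1 \<le> L j"
  shows "\<exists>\<epsilon>>0. \<forall>(a, b)\<in>supp T (cpoly (q j)). \<forall>s. 0 \<le> s \<longrightarrow> s \<le> real (2 * L j) \<longrightarrow>
    \<epsilon> \<le> p * (real a + s * real b - (\<Sum>i\<in>I. min s (real (Oij L q i j)))) + s + 1"
proof -
  define \<epsilon> where "\<epsilon> = Min (weight T L q I p j ` {..2 * L j})"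
  have \<epsilon>: "\<epsilon> > 0" "\<And>n. n \<le> 2 * L j \<Longrightarrow> \<epsilon> \<le> weight T L q I p j n"
    using w by (auto simp: \<epsilon>_def)
  have "\<epsilon> \<le> p * (real a + s * real b - (\<Sum>i\<in>I. min s (real (Oij L q i j)))) + s + 1"
    if ab: "(a, b) \<in> supp T (cpoly (q j))" and s: "0 \<le> s" "s \<le> real (2 * L j)" for a b s
  proof -
    define E where "E n = p * (real a + real n * real b - real (\<Sum>i\<in>I. min n (Oij L q i j))) + real n + 1" for n
    have E: "\<epsilon> \<le> E n" if n: "n \<le> 2 * L j" for n
    proof -
      have "real (nu T (cpoly (q j)) n) \<le> real (a + n * b)" using nu_le[OF ab, of n] by linarith
      then have "weight T L q I p j n \<le> E n"
        using p unfolding weight_def E_def by (intro add_right_mono mult_left_mono) auto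
      then show ?thesis using \<epsilon>(2)[OF n] by simp
    qed
    \<comment> \<open>The cap keeps n + 1 \<le> 2 L_j also at the right end s = 2 L_j, where
      \<theta> = 1.\<close>
    define n where "n = min (nat \<lfloor>s\<rfloor>) (2 * L j - 1)"
    define \<theta> where "\<theta> = s - real n"
    have n: "Suc n \<le> 2 * L j" using L by (simp add: n_def)
    have \<theta>: "0 \<le> \<theta>" "\<theta> \<le> 1"
    proof -
      have "real (nat \<lfloor>s\<rfloor>) \<le> s" using s by simp
      then show "0 \<le> \<theta>" by (simp add: \<theta>_def n_def min_def)
      have s1: "s \<le> real (nat \<lfloor>s\<rfloor>) + 1" using s by linarith
      show "\<theta> \<le> 1"
      proof (cases "nat \<lfloor>s\<rfloor> \<le> 2 * L j - 1")
        case True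
        then have "n = nat \<lfloor>s\<rfloor>" by (simp add: n_def)
        then show ?thesis using s1 by (simp only: \<theta>_def)
      next
        case False
        then have "real n = real (2 * L j) - 1" using L by (simp add: n_def min_def of_nat_diff)
        then show ?thesis using s by (simp only: \<theta>_def)
      qed
    qed
    have s_eq: "s = real n + \<theta>" by (simp add: \<theta>_def)
    have affine: "p * (u + (m + \<theta>) * v - ((1 - \<theta>) * A + \<theta> * B)) + (m + \<theta>) + 1
       = (1 - \<theta>) * (p * (u + m * v - A) + m + 1) + \<theta> * (p * (u + (1 + m) * v - B) + (1 + m) + 1)"
      for u v m A B :: real by (simp add: algebra_simps)
    have "(\<Sum>i\<in>I. min s (real (Oij L q i j)))
       = (1 - \<theta>) * real (\<Sum>i\<in>I. min n (Oij L q i j)) + \<theta> * real (\<Sum>i\<in>I. min (Suc n) (Oij L q i j))"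
      unfolding s_eq min_nat_interpolate[OF \<theta>] by (simp add: sum.distrib sum_distrib_left)
    then have "p * (real a + s * real b - (\<Sum>i\<in>I. min s (real (Oij L q i j)))) + s + 1
       = (1 - \<theta>) * E n + \<theta> * E (Suc n)"
      unfolding E_def s_eq of_nat_Suc by (simp only: affine)
    moreover have "(1 - \<theta>) * \<epsilon> + \<theta> * \<epsilon> \<le> (1 - \<theta>) * E n + \<theta> * E (Suc n)"
      using E[of n] E[of "Suc n"] n \<theta> by (intro add_mono mult_left_mono) auto
    ultimately show ?thesis by (simp add: algebra_simps)
  qed
  then show ?thesis using \<epsilon>(1) by blast
qed

lemma poly_abs_ge_power:
  fixes r :: "real poly"
  assumes "\<And>a. a < n \<Longrightarrow> coeff r a = 0" "coeff r n \<noteq> 0"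
  shows "\<exists>e>0. \<forall>x. \<bar>x\<bar> \<le> e \<longrightarrow> e * \<bar>x\<bar> ^ n \<le> \<bar>poly r x\<bar>"
proof -
  define u where "u = poly_shift n r"
  have r: "r = monom 1 n * u"
    using assms(1) by (intro poly_eqI) (auto simp: u_def coeff_monom_mult coeff_poly_shift)
  have u0: "poly u 0 \<noteq> 0" using assms(2) by (simp add: u_def poly_0_coeff_0 coeff_poly_shift)
  define k where "k = \<bar>poly u 0\<bar> / 2"
  have k: "k > 0" using u0 by (simp add: k_def)
  have "isCont (poly u) 0" by (intro continuous_intros)
  then obtain d where d: "d > 0" "\<And>x. \<bar>x\<bar> < d \<Longrightarrow> \<bar>poly u x - poly u 0\<bar> < k"
    using k unfolding continuous_at_eps_delta dist_norm by (metis diff_zero real_norm_def)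
  have "min (d / 2) k * \<bar>x\<bar> ^ n \<le> \<bar>poly r x\<bar>" if x: "\<bar>x\<bar> \<le> min (d / 2) k" for x
  proof -
    have "\<bar>poly u x - poly u 0\<bar> < k" using x d(1) by (intro d(2)) auto
    moreover have "\<bar>poly u 0\<bar> = 2 * k" by (simp add: k_def)
    ultimately have "k \<le> \<bar>poly u x\<bar>" by linarith
    then have "min (d / 2) k * \<bar>x\<bar> ^ n \<le> \<bar>poly u x\<bar> * \<bar>x\<bar> ^ n" by (intro mult_right_mono) auto
    then show ?thesis by (simp add: r poly_monom abs_mult power_abs mult.commute)
  qed
  then show ?thesis using d k by (intro exI[of _ "min (d / 2) k"]) auto
qed

text \<open>If \<open>Oij\<close> equals one of the lengths 2 L_i, 2 L_j, an imaginary part is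
  already that large. Otherwise q_i - q_j has exactly this order, and as factor j is the smaller
  one, factor i has at least half the distance between the two curves.\<close>

lemma norm_factor_ge_Oij:
  "\<exists>e>0. \<forall>z. \<bar>fst z\<bar> \<le> e \<longrightarrow> norm (factor L q j z) \<le> norm (factor L q i z) \<longrightarrow>
     e * \<bar>fst z\<bar> ^ Oij L q i j \<le> norm (factor L q i z)"
proof -
  have O: "Oij L q i j \<le> 2 * L i" "Oij L q i j \<le> 2 * L j" "\<And>a. a < Oij L q i j \<Longrightarrow> coeff (q i - q j) a = 0"
    using le_Oij_iff[of "Oij L q i j" L q i j] by auto
  consider "Oij L q i j = 2 * L i \<or> Oij L q i j = 2 * L j" | "Oij L q i j < 2 * L i" "Oij L q i j < 2 * L j"
    using O by linarith
  then show ?thesis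
  proof cases
    case 1
    have "\<bar>fst z\<bar> ^ Oij L q i j \<le> norm (factor L q i z)" if "norm (factor L q j z) \<le> norm (factor L q i z)" for z
      using 1 that norm_factor_ge(2)[of z L i q] norm_factor_ge(2)[of z L j q] by auto
    then show ?thesis by (intro exI[of _ 1]) auto
  next
    case 2
    have "\<not> Suc (Oij L q i j) \<le> Oij L q i j" by simp
    then have "coeff (q i - q j) (Oij L q i j) \<noteq> 0"
      using 2 O(3) unfolding le_Oij_iff by (auto simp: less_Suc_eq)
    from poly_abs_ge_power[OF O(3) this] obtain e where
      e: "e > 0" "\<And>x. \<bar>x\<bar> \<le> e \<Longrightarrow> e * \<bar>x\<bar> ^ Oij L q i j \<le> \<bar>poly (q i - q j) x\<bar>" by blast
    have "e / 2 * \<bar>fst z\<bar> ^ Oij L q i j \<le> norm (factor L q i z)"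
      if z: "\<bar>fst z\<bar> \<le> e / 2" "norm (factor L q j z) \<le> norm (factor L q i z)" for z
    proof -
      have "e * \<bar>fst z\<bar> ^ Oij L q i j \<le> \<bar>poly (q i) (fst z) - poly (q j) (fst z)\<bar>"
        using e(2)[of "fst z"] z e(1) by simp
      also have "\<dots> \<le> \<bar>snd z + poly (q i) (fst z)\<bar> + \<bar>snd z + poly (q j) (fst z)\<bar>" by linarith
      also have "\<dots> \<le> 2 * norm (factor L q i z)"
        using norm_factor_ge(1)[of z q i L] norm_factor_ge(1)[of z q j L] z by linarith
      finally show ?thesis by simp
    qed
    then show ?thesis using e(1) by (intro exI[of _ "e / 2"]) auto
  qed
qed

text \<open>Writing \<open>max |t| (|x|^(2 L j)) = |x| powr s\<close> with \<open>t = y + q j x\<close>, all factors and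
  monomials are compared with powers of \<open>|x|\<close>.\<close>
lemma polynomial_quotient_bound:
  assumes I: "finite I" "j \<in> I" and L: "1 \<le> L j" and p: "1 \<le> p"
    and w: "\<And>n. n \<le> 2 * L j \<Longrightarrow> T \<noteq> 0 \<Longrightarrow> 0 < weight T L q I p j n"
  shows "\<exists>e>0. \<forall>x y. 0 < \<bar>x\<bar> \<longrightarrow> \<bar>x\<bar> \<le> e \<longrightarrow> 0 < \<bar>y + poly (q j) x\<bar> \<longrightarrow> \<bar>y + poly (q j) x\<bar> \<le> 1 \<longrightarrow>
     (\<forall>i\<in>I. norm (factor L q j (x, y)) \<le> norm (factor L q i (x, y))) \<longrightarrow>
     (norm (ev T (of_real x) (of_real y)) / (\<Prod>i\<in>I. norm (factor L q i (x, y)))) powr p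
       \<le> 1 / e * \<bar>x\<bar> powr (e - 1) * \<bar>y + poly (q j) x\<bar> powr (e - 1)"
proof (cases "T = 0")
  case True
  then show ?thesis by (intro exI[of _ 1]) (auto simp: ev_def)
next
  case False
  let ?S = "supp T (cpoly (q j))"
  obtain \<epsilon>1 where \<epsilon>1: "\<epsilon>1 > 0" "\<And>a b s. (a, b) \<in> ?S \<Longrightarrow> 0 \<le> s \<Longrightarrow> s \<le> real (2 * L j) \<Longrightarrow>
    \<epsilon>1 \<le> p * (real a + s * real b - (\<Sum>i\<in>I. min s (real (Oij L q i j)))) + s + 1"
    using exponent_lower_bound[where T = T and L = L and q = q and I = I and p = p and j = j, OF w[OF _ False] p L] by blast
  define \<epsilon> where "\<epsilon> = min 1 \<epsilon>1"
  have \<epsilon>: "0 < \<epsilon>" "\<epsilon> \<le> 1" "\<And>a b s. (a, b) \<in> ?S \<Longrightarrow> 0 \<le> s \<Longrightarrow> s \<le> real (2 * L j) \<Longrightarrow>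
    \<epsilon> \<le> p * (real a + s * real b - (\<Sum>i\<in>I. min s (real (Oij L q i j)))) + s + 1"
    using \<epsilon>1 by (auto simp: \<epsilon>_def intro: order_trans[OF min.cobounded2])
  have "\<exists>k>0. \<forall>i\<in>I. \<forall>z. \<bar>fst z\<bar> \<le> k \<longrightarrow> norm (factor L q j z) \<le> norm (factor L q i z) \<longrightarrow>
     k * \<bar>fst z\<bar> ^ Oij L q i j \<le> norm (factor L q i z)"
    using I(1)
  proof (rule finite_uniform_pos)
    fix i and e e' :: real
    assume H: "\<forall>z. \<bar>fst z\<bar> \<le> e \<longrightarrow> norm (factor L q j z) \<le> norm (factor L q i z) \<longrightarrow>
      e * \<bar>fst z\<bar> ^ Oij L q i j \<le> norm (factor L q i z)" and e: "0 < e'" "e' \<le> e"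
    show "\<forall>z. \<bar>fst z\<bar> \<le> e' \<longrightarrow> norm (factor L q j z) \<le> norm (factor L q i z) \<longrightarrow>
      e' * \<bar>fst z\<bar> ^ Oij L q i j \<le> norm (factor L q i z)"
    proof (intro allI impI)
      fix z :: "real \<times> real" assume z: "\<bar>fst z\<bar> \<le> e'" "norm (factor L q j z) \<le> norm (factor L q i z)"
      have "e' * \<bar>fst z\<bar> ^ Oij L q i j \<le> e * \<bar>fst z\<bar> ^ Oij L q i j" using e by (intro mult_right_mono) auto
      also have "\<dots> \<le> norm (factor L q i z)" using H[rule_format, of z] z e by linarith
      finally show "e' * \<bar>fst z\<bar> ^ Oij L q i j \<le> norm (factor L q i z)" .
    qed
  qed (rule norm_factor_ge_Oij)
  then obtain k0 where k0: "k0 > 0" "\<And>i z. i \<in> I \<Longrightarrow> \<bar>fst z\<bar> \<le> k0 \<Longrightarrow> norm (factor L q j z) \<le> norm (factor L q i z) \<Longrightarrow>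
     k0 * \<bar>fst z\<bar> ^ Oij L q i j \<le> norm (factor L q i z)" by blast
  define k where "k = min 1 k0"
  have k: "0 < k" "k \<le> 1" "k \<le> k0" using k0 by (auto simp: k_def)
  let ?c = "\<lambda>a b. coeff (coeff (blow T (cpoly (q j)) 0) b) a"
  define C where "C = (\<Sum>(a, b)\<in>?S. norm (?c a b)) / k ^ card I"
  have C: "C \<ge> 0" unfolding C_def using k by (intro divide_nonneg_pos sum_nonneg) auto
  \<comment> \<open>Since h \<ge> X^(2 L_j), this choice bounds \<open>h powr (- \<eta>)\<close> by
    \<open>X powr (- \<epsilon> / 2)\<close>, which uses up only half of the gain
    \<epsilon>.\<close>
  define \<eta> where "\<eta> = \<epsilon> / (4 * real (L j))"
  have \<eta>: "0 < \<eta>" "\<eta> \<le> \<epsilon> / 4" "\<eta> \<le> 1"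
  proof -
    show "0 < \<eta>" using \<epsilon> L by (simp add: \<eta>_def)
    show "\<eta> \<le> \<epsilon> / 4" unfolding \<eta>_def using \<epsilon> L by (intro frac_le) auto
    then show "\<eta> \<le> 1" using \<epsilon> by simp
  qed
  define e where "e = min (min (k0 / 1) (1 / 2)) (min \<eta> (1 / (C powr p + 1)))"
  have e: "0 < e" "e \<le> k0" "e \<le> 1 / 2" "e \<le> \<eta>" "e \<le> 1 / (C powr p + 1)"
    using k0 \<eta> by (auto simp: e_def add_nonneg_pos)
  have "(norm (ev T (of_real x) (of_real y)) / (\<Prod>i\<in>I. norm (factor L q i (x, y)))) powr p
       \<le> 1 / e * \<bar>x\<bar> powr (e - 1) * \<bar>y + poly (q j) x\<bar> powr (e - 1)"
    if x: "0 < \<bar>x\<bar>" "\<bar>x\<bar> \<le> e" and t: "0 < \<bar>y + poly (q j) x\<bar>" "\<bar>y + poly (q j) x\<bar> \<le> 1"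
      and jmin: "\<And>i. i \<in> I \<Longrightarrow> norm (factor L q j (x, y)) \<le> norm (factor L q i (x, y))" for x y
  proof -
    define X where "X = \<bar>x\<bar>"
    define t where "t = y + poly (q j) x"
    define h where "h = max \<bar>t\<bar> (X ^ (2 * L j))"
    define s where "s = ln h / ln X"
    define N where "N = (\<Sum>i\<in>I. min s (real (Oij L q i j)))"
    have X: "0 < X" "X < 1" using x e by (auto simp: X_def)
    have h: "0 < h" "h \<le> 1" "\<bar>t\<bar> \<le> h" "X ^ (2 * L j) \<le> h"
      using X t by (auto simp: h_def t_def less_max_iff_disj power_le_one)
    have hX: "h = X powr s" using X h by (simp add: s_def powr_def)
    have s: "0 \<le> s" "s \<le> real (2 * L j)"
    proof -
      show "0 \<le> s" unfolding s_def using X h by (intro divide_nonpos_neg) auto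
      have "X powr real (2 * L j) \<le> X powr s" using h(4) X unfolding hX by (simp only: powr_realpow)
      then show "s \<le> real (2 * L j)" using X powr_less_mono'[of X "real (2 * L j)" s] by linarith
    qed
    have hf: "h \<le> norm (factor L q j (x, y))"
      using norm_factor_ge(1)[of "(x, y)" q j L] norm_factor_ge(2)[of "(x, y)" L j q]
      by (simp add: h_def t_def X_def)
    \<comment> \<open>Up to the order of agreement, minimality of factor j yields the bound h = X^s;
      beyond it, the separation of the curves yields the other one.\<close>
    have f: "k * X powr min s (real (Oij L q i j)) \<le> norm (factor L q i (x, y))" if i: "i \<in> I" for i
    proof (cases "s \<le> real (Oij L q i j)")
      case True
      have "k * h \<le> 1 * h" using k h by (intro mult_right_mono) auto
      then show ?thesis using True hf jmin[OF i] by (simp add: hX min_def)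
    next
      case False
      have "k * X ^ Oij L q i j \<le> k0 * X ^ Oij L q i j" using k X by (intro mult_right_mono) auto
      also have "\<dots> \<le> norm (factor L q i (x, y))"
        using k0(2)[OF i, of "(x, y)"] jmin[OF i] x e by (simp add: X_def)
      finally show ?thesis using False X by (simp add: min_def powr_realpow)
    qed
    have den: "k ^ card I * X powr N \<le> (\<Prod>i\<in>I. norm (factor L q i (x, y)))"
    proof -
      have "k ^ card I * X powr N = (\<Prod>i\<in>I. k * X powr min s (real (Oij L q i j)))"
        using I(1) X by (simp add: N_def prod.distrib powr_sum)
      also have "\<dots> \<le> (\<Prod>i\<in>I. norm (factor L q i (x, y)))"
        using f k by (intro prod_mono) auto
      finally show ?thesis .
    qed
    have "ev T (of_real x) (of_real y) = (\<Sum>(a, b)\<in>?S. ?c a b * of_real x ^ a * of_real t ^ b)"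
      using ev_eq_sum_supp[of T "of_real x" "of_real t" "cpoly (q j)"] by (simp add: poly_cpoly t_def)
    \<comment> \<open>The exponent comes from solving \<epsilon> \<le> p (a + s b - N) + s + 1 for a
      + s b.\<close>
    then have "norm (ev T (of_real x) (of_real y)) \<le> (\<Sum>(a, b)\<in>?S. norm (?c a b) * X powr (N + (\<epsilon> - 1 - s) / p))"
    proof (simp only:, intro sum_norm_le)
      fix ab assume ab: "ab \<in> ?S"
      obtain a b where [simp]: "ab = (a, b)" by (cases ab)
      have "\<bar>t\<bar> ^ b \<le> h ^ b" using h by (intro power_mono) auto
      also have "h ^ b = X powr (s * real b)" using X by (simp add: hX powr_powr flip: powr_realpow)
      finally have "X ^ a * \<bar>t\<bar> ^ b \<le> X powr real a * X powr (s * real b)"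
        using X by (intro mult_mono) (auto simp: powr_realpow)
      also have "\<dots> = X powr (real a + s * real b)" by (simp add: powr_add)
      also have "\<dots> \<le> X powr (N + (\<epsilon> - 1 - s) / p)"
      proof (rule powr_mono')
        have "\<epsilon> \<le> p * (real a + s * real b - N) + s + 1"
          using \<epsilon>(3)[of a b s] ab s by (simp add: N_def)
        then have "(\<epsilon> - 1 - s) / p \<le> real a + s * real b - N"
          using p by (subst pos_divide_le_eq) (simp_all add: algebra_simps)
        then show "N + (\<epsilon> - 1 - s) / p \<le> real a + s * real b" by simp
      qed (use X in auto)
      finally have "norm (?c a b) * (X ^ a * \<bar>t\<bar> ^ b) \<le> norm (?c a b) * X powr (N + (\<epsilon> - 1 - s) / p)"
        by (intro mult_left_mono) auto
      then show "norm (case ab of (a, b) \<Rightarrow> ?c a b * of_real x ^ a * of_real t ^ b)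
         \<le> (case ab of (a, b) \<Rightarrow> norm (?c a b) * X powr (N + (\<epsilon> - 1 - s) / p))"
        by (simp add: norm_mult norm_power X_def mult.assoc)
    qed
    also have "\<dots> = (C * X powr ((\<epsilon> - 1 - s) / p)) * (k ^ card I * X powr N)"
      using k by (simp add: C_def powr_add sum_distrib_right[symmetric] case_prod_unfold)
    also have "\<dots> \<le> (C * X powr ((\<epsilon> - 1 - s) / p)) * (\<Prod>i\<in>I. norm (factor L q i (x, y)))"
      using den C by (intro mult_left_mono) auto
    finally have num: "norm (ev T (of_real x) (of_real y)) \<le> (C * X powr ((\<epsilon> - 1 - s) / p)) * (\<Prod>i\<in>I. norm (factor L q i (x, y)))" .
    have "0 < k ^ card I * X powr N" using k X by simp
    then have "0 < (\<Prod>i\<in>I. norm (factor L q i (x, y)))" using den by linarith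
    then have "(norm (ev T (of_real x) (of_real y)) / (\<Prod>i\<in>I. norm (factor L q i (x, y)))) powr p
       \<le> (C * X powr ((\<epsilon> - 1 - s) / p)) powr p"
      using num p by (intro powr_mono2) (auto simp: pos_divide_le_eq)
    also have "\<dots> = C powr p * X powr (\<epsilon> - 1 - s)"
      using C p by (simp add: powr_mult powr_powr)
    \<comment> \<open>X^(-s) = 1 / h is split in two: h^(\<eta> - 1) becomes an integrable
      singularity in t, and h^(-\<eta>) is absorbed by X^\<epsilon>.\<close>
    also have "X powr (\<epsilon> - 1 - s) = X powr (\<epsilon> - 1) * (h powr (\<eta> - 1) * h powr (- \<eta>))"
    proof -
      have "h powr (\<eta> - 1) * h powr (- \<eta>) = X powr (- s)"
        by (simp add: hX powr_powr flip: powr_add) (simp add: algebra_simps)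
      then show ?thesis by (simp add: powr_diff powr_minus_divide)
    qed
    also have "C powr p * (X powr (\<epsilon> - 1) * (h powr (\<eta> - 1) * h powr (- \<eta>)))
       \<le> 1 / e * (X powr (\<epsilon> - 1) * (\<bar>t\<bar> powr (e - 1) * X powr (- \<epsilon> / 2)))"
    proof (intro mult_mono)
      show "C powr p \<le> 1 / e"
      proof -
        have "0 < C powr p + 1" by (simp add: add_nonneg_pos)
        then have "e * (C powr p + 1) \<le> 1" using e(5) by (simp add: pos_le_divide_eq)
        then show ?thesis using e(1) by (simp add: pos_le_divide_eq algebra_simps)
      qed
      have "h powr (\<eta> - 1) \<le> \<bar>t\<bar> powr (\<eta> - 1)"
        using h t \<eta> by (intro powr_mono2') (auto simp: t_def)
      also have "\<dots> \<le> \<bar>t\<bar> powr (e - 1)"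
        using t e by (intro powr_mono') (auto simp: t_def)
      finally show "h powr (\<eta> - 1) \<le> \<bar>t\<bar> powr (e - 1)" .
      have "h powr (- \<eta>) = X powr (- s * \<eta>)" by (simp add: hX powr_powr)
      also have "\<dots> \<le> X powr (- \<epsilon> / 2)"
      proof (rule powr_mono')
        have "s * \<eta> \<le> real (2 * L j) * \<eta>" using s \<eta> by (intro mult_right_mono) auto
        also have "\<dots> = \<epsilon> / 2" using L by (simp add: \<eta>_def)
        finally show "- \<epsilon> / 2 \<le> - s * \<eta>" by simp
      qed (use X in auto)
      finally show "h powr (- \<eta>) \<le> X powr (- \<epsilon> / 2)" .
    qed (use e in auto)
    also have "\<dots> = 1 / e * (X powr (\<epsilon> / 2 - 1) * \<bar>t\<bar> powr (e - 1))"
    proof -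
      have "X powr (\<epsilon> - 1) * X powr (- \<epsilon> / 2) = X powr (\<epsilon> / 2 - 1)"
        by (simp add: field_simps flip: powr_add)
      then show ?thesis by (simp add: algebra_simps)
    qed
    also have "\<dots> \<le> 1 / e * (X powr (e - 1) * \<bar>t\<bar> powr (e - 1))"
      using X e \<eta> by (intro mult_left_mono mult_right_mono powr_mono') auto
    finally show ?thesis by (simp add: X_def t_def mult.assoc)
  qed
  then show ?thesis using e(1) by blast
qed

section \<open>Integrable majorants\<close>

text \<open>With t = y + q_i(x), |y| is at most |t| plus a multiple of |x|, and |t|^(2 L_i) \<le>
  |t| for |t| \<le> 1 and L_i \<ge> 1; the real and the imaginary part together thus control both
  variables.\<close>

lemma norm_factor_ge_max:
  assumes "poly (q i) 0 = 0"
  shows "\<exists>k>0. \<forall>x y. \<bar>x\<bar> \<le> 1 \<longrightarrow> \<bar>y + poly (q i) x\<bar> \<le> 1 \<longrightarrow>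
     k * max \<bar>x\<bar> \<bar>y\<bar> ^ (2 * L i) \<le> norm (factor L q i (x, y))"
proof -
  let ?n = "2 * L i"
  obtain C0 where C0: "C0 \<ge> 0" "\<And>x. \<bar>x\<bar> \<le> 1 \<Longrightarrow> \<bar>poly (q i) x\<bar> \<le> C0 * \<bar>x\<bar> ^ 1"
    using poly_abs_le_power[of 1 "q i"] assms by (auto simp: poly_0_coeff_0)
  define C where "C = 2 * (C0 + 1)"
  have C: "C \<ge> 1" using C0 by (simp add: C_def)
  have "max \<bar>x\<bar> \<bar>y\<bar> ^ ?n \<le> C ^ ?n * norm (factor L q i (x, y))"
    if x: "\<bar>x\<bar> \<le> 1" and t: "\<bar>y + poly (q i) x\<bar> \<le> 1" for x y
  proof -
    define F where "F = norm (factor L q i (x, y))"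
    define t where "t = \<bar>y + poly (q i) x\<bar>"
    have F: "t \<le> F" "\<bar>x\<bar> ^ ?n \<le> F" 
      using norm_factor_ge(1)[of "(x, y)" q i L] norm_factor_ge(2)[of "(x, y)" L i q]
      by (auto simp: F_def t_def)
    have "\<bar>y\<bar> \<le> t + C0 * \<bar>x\<bar>" using C0(2)[OF x] by (simp add: t_def)
    also have "\<dots> \<le> C * max t \<bar>x\<bar>"
    proof -
      have "t + C0 * \<bar>x\<bar> \<le> max t \<bar>x\<bar> + C0 * max t \<bar>x\<bar>"
        using C0 by (intro add_mono mult_left_mono) auto
      also have "\<dots> \<le> C * max t \<bar>x\<bar>"
        using C0 by (auto simp: C_def t_def algebra_simps le_max_iff_disj)
      finally show ?thesis .
    qed
    finally have "max \<bar>x\<bar> \<bar>y\<bar> \<le> C * max t \<bar>x\<bar>"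
      using mult_mono[OF C, of "\<bar>x\<bar>" "max t \<bar>x\<bar>"] C by auto
    then have "max \<bar>x\<bar> \<bar>y\<bar> ^ ?n \<le> C ^ ?n * max t \<bar>x\<bar> ^ ?n"
      unfolding power_mult_distrib[symmetric] by (intro power_mono) (auto simp: le_max_iff_disj)
    also have "max t \<bar>x\<bar> ^ ?n \<le> F"
    \<comment> \<open>For exponent 0 the comparison of t^n with t fails, but the claim is 1 \<le> F,
      given by the imaginary part.\<close>
    proof (cases "t \<le> \<bar>x\<bar> \<or> ?n = 0")
      case True
      then show ?thesis using F by (auto simp: max_def)
    next
      case False
      then have "t ^ ?n \<le> t ^ 1" using t by (intro power_decreasing) (auto simp: t_def)
      then show ?thesis using F False by (auto simp: max_def)
    qed
    finally show ?thesis using C by (simp add: F_def mult_left_mono)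
  qed
  then show ?thesis using C by (intro exI[of _ "1 / C ^ ?n"]) (auto simp: field_simps)
qed

text \<open>A Lojasiewicz type inequality for P. Its exponent fixes the truncation degree: a
  remainder of order K divided by P stays bounded.\<close>

lemma prod_factor_ge_max:
  assumes "finite I" "\<And>i. i \<in> I \<Longrightarrow> poly (q i) 0 = 0"
  shows "\<exists>k>0. \<forall>x y. \<bar>x\<bar> \<le> 1 \<longrightarrow> (\<forall>i\<in>I. \<bar>y + poly (q i) x\<bar> \<le> 1) \<longrightarrow>
     k * max \<bar>x\<bar> \<bar>y\<bar> ^ (\<Sum>i\<in>I. 2 * L i) \<le> (\<Prod>i\<in>I. norm (factor L q i (x, y)))"
proof -
  have "\<exists>k>0. \<forall>i\<in>I. \<forall>x y. \<bar>x\<bar> \<le> 1 \<longrightarrow> \<bar>y + poly (q i) x\<bar> \<le> 1 \<longrightarrow>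
     k * max \<bar>x\<bar> \<bar>y\<bar> ^ (2 * L i) \<le> norm (factor L q i (x, y))"
    using assms(1)
  proof (rule finite_uniform_pos)
    fix i and e e' :: real
    assume H: "\<forall>x y. \<bar>x\<bar> \<le> 1 \<longrightarrow> \<bar>y + poly (q i) x\<bar> \<le> 1 \<longrightarrow>
      e * max \<bar>x\<bar> \<bar>y\<bar> ^ (2 * L i) \<le> norm (factor L q i (x, y))" and e: "0 < e'" "e' \<le> e"
    show "\<forall>x y. \<bar>x\<bar> \<le> 1 \<longrightarrow> \<bar>y + poly (q i) x\<bar> \<le> 1 \<longrightarrow>
      e' * max \<bar>x\<bar> \<bar>y\<bar> ^ (2 * L i) \<le> norm (factor L q i (x, y))"
    proof (intro allI impI)
      fix x y assume xy: "\<bar>x\<bar> \<le> 1" "\<bar>y + poly (q i) x\<bar> \<le> 1"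
      have "e' * max \<bar>x\<bar> \<bar>y\<bar> ^ (2 * L i) \<le> e * max \<bar>x\<bar> \<bar>y\<bar> ^ (2 * L i)"
        using e by (intro mult_right_mono) auto
      then show "e' * max \<bar>x\<bar> \<bar>y\<bar> ^ (2 * L i) \<le> norm (factor L q i (x, y))"
        using H[rule_format, OF xy] by linarith
    qed
  qed (intro norm_factor_ge_max assms(2))
  then obtain k where k: "k > 0" "\<And>i x y. i \<in> I \<Longrightarrow> \<bar>x\<bar> \<le> 1 \<Longrightarrow> \<bar>y + poly (q i) x\<bar> \<le> 1 \<Longrightarrow>
     k * max \<bar>x\<bar> \<bar>y\<bar> ^ (2 * L i) \<le> norm (factor L q i (x, y))" by blast
  have "k ^ card I * max \<bar>x\<bar> \<bar>y\<bar> ^ (\<Sum>i\<in>I. 2 * L i) \<le> (\<Prod>i\<in>I. norm (factor L q i (x, y)))"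
    if xy: "\<bar>x\<bar> \<le> 1" "\<forall>i\<in>I. \<bar>y + poly (q i) x\<bar> \<le> 1" for x y
  proof -
    have "k ^ card I * max \<bar>x\<bar> \<bar>y\<bar> ^ (\<Sum>i\<in>I. 2 * L i) = (\<Prod>i\<in>I. k * max \<bar>x\<bar> \<bar>y\<bar> ^ (2 * L i))"
      by (simp only: prod.distrib prod_constant power_sum)
    also have "\<dots> \<le> (\<Prod>i\<in>I. norm (factor L q i (x, y)))"
      using k xy by (intro prod_mono) (auto simp: le_max_iff_disj)
    finally show ?thesis .
  qed
  then show ?thesis using k(1) by (intro exI[of _ "k ^ card I"]) auto
qed

section \<open>Majorants with power singularities\<close>

lemma nn_integral_abs_powr_finite:
  assumes "0 < \<eta>"
  shows "(\<integral>\<^sup>+t. ennreal (\<bar>t\<bar> powr (\<eta> - 1)) * indicator {-1..1} t \<partial>lborel) < \<infinity>"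
proof -
  define f :: "real \<Rightarrow> real" where "f t = t powr (\<eta> - 1) * indicator {0..1} t" for t
  have f [measurable]: "f \<in> borel_measurable borel" unfolding f_def by measurable
  have "((\<lambda>t. t powr (\<eta> - 1)) has_integral (1 powr (\<eta> - 1 + 1) / (\<eta> - 1 + 1))) {0..1}"
    using assms by (intro has_integral_powr_from_0) auto
  then have "((\<lambda>t. if t \<in> {0..1} then t powr (\<eta> - 1) else 0) has_integral 1 / \<eta>) UNIV"
    by (subst has_integral_restrict_UNIV) simp
  moreover have "(\<lambda>t. if t \<in> {0..1} then t powr (\<eta> - 1) else 0) = f"
    by (auto simp: f_def indicator_def)
  ultimately have "(f has_integral 1 / \<eta>) UNIV" by simp
  then have int: "(\<integral>\<^sup>+t. ennreal (f t) \<partial>lborel) = ennreal (1 / \<eta>)"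
    by (rule nn_integral_has_integral_lborel[OF f, rotated]) (simp add: f_def)
  have "(\<integral>\<^sup>+t. ennreal (f t) \<partial>lborel) = ennreal \<bar>-1\<bar> * (\<integral>\<^sup>+t. ennreal (f (0 + (-1) * t)) \<partial>lborel)"
    by (rule nn_integral_real_affine) auto
  then have int': "(\<integral>\<^sup>+t. ennreal (f (- t)) \<partial>lborel) = ennreal (1 / \<eta>)" using int by simp
  have "(\<integral>\<^sup>+t. ennreal (\<bar>t\<bar> powr (\<eta> - 1)) * indicator {-1..1} t \<partial>lborel)
     \<le> (\<integral>\<^sup>+t. ennreal (f t) + ennreal (f (- t)) \<partial>lborel)"
    by (intro nn_integral_mono) (auto simp: f_def indicator_def)
  also have "\<dots> = ennreal (1 / \<eta>) + ennreal (1 / \<eta>)"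
    by (subst nn_integral_add) (simp_all add: int int')
  also have "\<dots> < \<infinity>" by simp
  finally show ?thesis .
qed

lemma AE_lborel_finite: "finite A \<Longrightarrow> AE x in lborel. x \<notin> (A :: real set)"
  by (rule AE_not_in) (auto intro: finite_imp_null_set_lborel)

text \<open>The majorant is singular on null sets only, where it takes the junk value \<open>0\<close>.\<close>
lemma integrable_of_singular_majorant:
  fixes F :: "real \<times> real \<Rightarrow> real" and g :: "nat \<Rightarrow> real \<Rightarrow> real"
  assumes F: "F \<in> borel_measurable borel" "\<And>z. 0 \<le> F z"
    and g: "\<And>j. g j \<in> borel_measurable borel" and I: "finite I"
    and B: "0 \<le> B" and \<eta>: "0 < \<eta>"
    and supp: "\<And>x y. F (x, y) \<noteq> 0 \<Longrightarrow> \<bar>x\<bar> \<le> 1 \<and> (\<forall>j\<in>I. \<bar>y + g j x\<bar> \<le> 1)"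
    and bound: "\<And>x y. x \<noteq> 0 \<Longrightarrow> \<forall>j\<in>I. y + g j x \<noteq> 0 \<Longrightarrow> \<bar>x\<bar> \<le> 1 \<Longrightarrow> \<forall>j\<in>I. \<bar>y + g j x\<bar> \<le> 1 \<Longrightarrow>
       F (x, y) \<le> B * \<bar>x\<bar> powr (\<eta> - 1) * (\<Sum>j\<in>I. \<bar>y + g j x\<bar> powr (\<eta> - 1))"
  shows "integrable lborel F"
proof (rule integrableI_bounded)
  show "F \<in> borel_measurable lborel" using F(1) by simp
  note [measurable] = F(1) g
  define \<phi> :: "real \<Rightarrow> ennreal" where "\<phi> t = ennreal (\<bar>t\<bar> powr (\<eta> - 1)) * indicator {-1..1} t" for t
  have [measurable]: "\<phi> \<in> borel_measurable borel" unfolding \<phi>_def by measurable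
  define J where "J = (\<integral>\<^sup>+t. \<phi> t \<partial>lborel)"
  have J: "J < \<infinity>" unfolding J_def \<phi>_def by (rule nn_integral_abs_powr_finite[OF \<eta>])
  \<comment> \<open>By translation invariance the inner integral over y has the same value J for
    every curve and every x.\<close>
  have shift: "(\<integral>\<^sup>+y. \<phi> (y + a) \<partial>lborel) = J" for a
    unfolding J_def using nn_integral_real_affine[of \<phi> 1 a] by (simp add: add.commute)
  have "(\<integral>\<^sup>+z. ennreal (norm (F z)) \<partial>lborel) = (\<integral>\<^sup>+x. \<integral>\<^sup>+y. ennreal (norm (F (x, y))) \<partial>lborel \<partial>lborel)"
    by (rule nn_integral_lborel_pair) measurable
  also have "\<dots> \<le> (\<integral>\<^sup>+x. ennreal B * \<phi> x * (of_nat (card I) * J) \<partial>lborel)"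
  proof (rule nn_integral_mono_AE)
    have "AE x in lborel. x \<noteq> (0 :: real)" by (rule AE_lborel_singleton)
    then show "AE x in lborel. (\<integral>\<^sup>+y. ennreal (norm (F (x, y))) \<partial>lborel) \<le> ennreal B * \<phi> x * (of_nat (card I) * J)"
    proof eventually_elim
      case (elim x)
      have "(\<integral>\<^sup>+y. ennreal (norm (F (x, y))) \<partial>lborel) \<le> (\<integral>\<^sup>+y. ennreal B * \<phi> x * (\<Sum>j\<in>I. \<phi> (y + g j x)) \<partial>lborel)"
      proof (rule nn_integral_mono_AE)
        have "AE y in lborel. y \<notin> (\<lambda>j. - g j x) ` I" using I by (intro AE_lborel_finite) simp
        then show "AE y in lborel. ennreal (norm (F (x, y))) \<le> ennreal B * \<phi> x * (\<Sum>j\<in>I. \<phi> (y + g j x))"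
        proof eventually_elim
          case (elim y)
          have y: "\<forall>j\<in>I. y + g j x \<noteq> 0"
          proof
            fix j assume "j \<in> I"
            then have "y \<noteq> - g j x" using elim by blast
            then show "y + g j x \<noteq> 0" by linarith
          qed
          show ?case
          proof (cases "F (x, y) = 0")
            case False
            note s = supp[OF False]
            have \<phi>x: "\<phi> x = ennreal (\<bar>x\<bar> powr (\<eta> - 1))" using s by (auto simp: \<phi>_def indicator_def abs_le_iff)
            have \<phi>y: "\<phi> (y + g j x) = ennreal (\<bar>y + g j x\<bar> powr (\<eta> - 1))" if "j \<in> I" for j
            proof -
              have "\<bar>y + g j x\<bar> \<le> 1" using s that by blast
              then have "y + g j x \<in> {-1..1}" by (auto simp: abs_le_iff)
              then show ?thesis by (simp add: \<phi>_def)
            qed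
            have "ennreal (norm (F (x, y))) \<le> ennreal (B * \<bar>x\<bar> powr (\<eta> - 1) * (\<Sum>j\<in>I. \<bar>y + g j x\<bar> powr (\<eta> - 1)))"
              using bound[of x y] F(2)[of "(x, y)"] s y \<open>x \<noteq> 0\<close> by (intro ennreal_leI) auto
            also have "\<dots> = ennreal B * \<phi> x * (\<Sum>j\<in>I. \<phi> (y + g j x))"
              using B by (simp add: \<phi>x \<phi>y ennreal_mult sum_nonneg sum_ennreal cong: sum.cong)
            finally show ?thesis .
          qed simp
        qed
      qed
      also have "\<dots> = ennreal B * \<phi> x * (\<Sum>j\<in>I. \<integral>\<^sup>+y. \<phi> (y + g j x) \<partial>lborel)"
        by (simp add: nn_integral_cmult nn_integral_sum)
      also have "\<dots> = ennreal B * \<phi> x * (of_nat (card I) * J)" by (simp add: shift)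
      finally show ?case .
    qed
  qed
  also have "\<dots> = ennreal B * J * (of_nat (card I) * J)"
    by (simp add: nn_integral_cmult nn_integral_multc J_def)
  also have "\<dots> < \<infinity>"
    using J by (simp add: ennreal_mult_less_top of_nat_less_top)
  finally show "(\<integral>\<^sup>+z. ennreal (norm (F z)) \<partial>lborel) < \<infinity>" .
qed

lemma powr_add_le:
  fixes a b p :: real
  assumes "0 \<le> a" "0 \<le> b" "0 \<le> p"
  shows "(a + b) powr p \<le> 2 powr p * (a powr p + b powr p)"
proof -
  have "(a + b) powr p \<le> (2 * max a b) powr p" using assms by (intro powr_mono2) auto
  also have "\<dots> = 2 powr p * max a b powr p" using assms by (simp add: powr_mult)
  also have "max a b powr p \<le> a powr p + b powr p" by (simp add: max_def)
  finally show ?thesis by (simp add: mult_left_mono)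
qed

section \<open>Sufficiency and the theorem\<close>

text \<open>Q is split into its truncation and a tail. The tail over P is bounded, and the
  truncation over P has the singular majorant belonging to the curve whose factor is smallest at the
  point.\<close>

lemma weight_pos_imp_Lp_loc:
  assumes I: "finite I" "I \<noteq> {}" and L: "\<And>j. j \<in> I \<Longrightarrow> 1 \<le> L j"
    and q0: "\<And>j. j \<in> I \<Longrightarrow> poly (q j) 0 = 0" and p: "1 \<le> p"
    and c: "ps_summable c r0" "0 < r0" and K: "K = (\<Sum>i\<in>I. 2 * L i)"
    and w: "\<And>j n. j \<in> I \<Longrightarrow> n \<le> 2 * L j \<Longrightarrow> trunc c K \<noteq> 0 \<Longrightarrow> 0 < weight (trunc c K) L q I p j n"
  shows "Lp_loc p (\<lambda>z. ps_eval c (complex_of_real (fst z), complex_of_real (snd z)) / (\<Prod>i\<in>I. factor L q i z))"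
proof -
  let ?T = "trunc c K"
  let ?Q = "\<lambda>z. ps_eval c (complex_of_real (fst z), complex_of_real (snd z))"
  let ?P = "\<lambda>z. \<Prod>i\<in>I. factor L q i z"
  let ?R = "\<lambda>x y. norm (ev ?T (complex_of_real x) (complex_of_real y)) / (\<Prod>i\<in>I. norm (factor L q i (x, y)))"
  \<comment> \<open>The clause |x| \<le> 1 makes the predicate monotone in e: a power of a number in
    (0, 1] grows when its exponent decreases.\<close>
  have "\<exists>e>0. \<forall>j\<in>I. \<forall>x y. 0 < \<bar>x\<bar> \<longrightarrow> \<bar>x\<bar> \<le> 1 \<longrightarrow> \<bar>x\<bar> \<le> e \<longrightarrow> 0 < \<bar>y + poly (q j) x\<bar> \<longrightarrow> \<bar>y + poly (q j) x\<bar> \<le> 1 \<longrightarrow>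
     (\<forall>i\<in>I. norm (factor L q j (x, y)) \<le> norm (factor L q i (x, y))) \<longrightarrow>
     ?R x y powr p \<le> 1 / e * \<bar>x\<bar> powr (e - 1) * \<bar>y + poly (q j) x\<bar> powr (e - 1)"
    (is "\<exists>e>0. \<forall>j\<in>I. ?B j e") using I(1)
  proof (rule finite_uniform_pos)
    fix j assume j: "j \<in> I"
    show "\<exists>e>0. ?B j e"
      using polynomial_quotient_bound[OF I(1) j L[OF j] p w[OF j]] by blast
  next
    fix j and e e' :: real assume H: "?B j e" and e: "0 < e'" "e' \<le> e"
    show "?B j e'"
    proof (intro allI impI)
      fix x y :: real
      assume x: "0 < \<bar>x\<bar>" "\<bar>x\<bar> \<le> 1" "\<bar>x\<bar> \<le> e'" and t: "0 < \<bar>y + poly (q j) x\<bar>" "\<bar>y + poly (q j) x\<bar> \<le> 1"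
        and m: "\<forall>i\<in>I. norm (factor L q j (x, y)) \<le> norm (factor L q i (x, y))"
      have "?R x y powr p \<le> 1 / e * \<bar>x\<bar> powr (e - 1) * \<bar>y + poly (q j) x\<bar> powr (e - 1)"
        using H[rule_format, of x y] x t m e by simp
      also have "\<dots> \<le> 1 / e' * \<bar>x\<bar> powr (e' - 1) * \<bar>y + poly (q j) x\<bar> powr (e' - 1)"
        using e x t by (intro mult_mono powr_mono' divide_left_mono) auto
      finally show "?R x y powr p \<le> 1 / e' * \<bar>x\<bar> powr (e' - 1) * \<bar>y + poly (q j) x\<bar> powr (e' - 1)" .
    qed
  qed
  then obtain e1 where e1: "e1 > 0" "\<And>j x y. j \<in> I \<Longrightarrow> 0 < \<bar>x\<bar> \<Longrightarrow> \<bar>x\<bar> \<le> 1 \<Longrightarrow> \<bar>x\<bar> \<le> e1 \<Longrightarrow> 0 < \<bar>y + poly (q j) x\<bar> \<Longrightarrow> \<bar>y + poly (q j) x\<bar> \<le> 1 \<Longrightarrow>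
     (\<forall>i\<in>I. norm (factor L q j (x, y)) \<le> norm (factor L q i (x, y))) \<Longrightarrow>
     ?R x y powr p \<le> 1 / e1 * \<bar>x\<bar> powr (e1 - 1) * \<bar>y + poly (q j) x\<bar> powr (e1 - 1)" by blast
  obtain k where k: "k > 0" "\<And>x y. \<bar>x\<bar> \<le> 1 \<Longrightarrow> (\<forall>i\<in>I. \<bar>y + poly (q i) x\<bar> \<le> 1) \<Longrightarrow>
     k * max \<bar>x\<bar> \<bar>y\<bar> ^ K \<le> (\<Prod>i\<in>I. norm (factor L q i (x, y)))"
    using prod_factor_ge_max[where q = q and L = L, OF I(1) q0, folded K] by blast
  have "\<exists>e>0. \<forall>j\<in>I. \<forall>x. \<bar>x\<bar> \<le> e \<longrightarrow> \<bar>poly (q j) x\<bar> \<le> 1 / 2"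
    using I(1)
  proof (rule finite_uniform_pos)
    fix j assume j: "j \<in> I"
    obtain C where C: "C \<ge> 0" "\<And>x. \<bar>x\<bar> \<le> 1 \<Longrightarrow> \<bar>poly (q j) x\<bar> \<le> C * \<bar>x\<bar> ^ 1"
      using poly_abs_le_power[of 1 "q j"] q0[OF j] by (auto simp: poly_0_coeff_0)
    have "\<bar>poly (q j) x\<bar> \<le> 1 / 2" if x: "\<bar>x\<bar> \<le> 1 / (2 * (C + 1))" for x
    proof -
      have "\<bar>x\<bar> * (2 * (C + 1)) \<le> 1" using x C(1) by (simp add: pos_le_divide_eq)
      moreover have "\<bar>x\<bar> * 2 \<le> \<bar>x\<bar> * (2 * (C + 1))" using C(1) by (intro mult_left_mono) auto
      ultimately have "\<bar>x\<bar> \<le> 1" "C * \<bar>x\<bar> \<le> 1 / 2" by (auto simp: algebra_simps)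
      then show ?thesis using C(2)[of x] by simp
    qed
    then show "\<exists>e>0. \<forall>x. \<bar>x\<bar> \<le> e \<longrightarrow> \<bar>poly (q j) x\<bar> \<le> 1 / 2"
      using C(1) by (intro exI[of _ "1 / (2 * (C + 1))"]) auto
  qed (auto dest: order_trans)
  then obtain e2 where e2: "e2 > 0" "\<And>j x. j \<in> I \<Longrightarrow> \<bar>x\<bar> \<le> e2 \<Longrightarrow> \<bar>poly (q j) x\<bar> \<le> 1 / 2" by blast
  obtain E where E: "E \<ge> 0" "\<And>x y. norm x \<le> r0 \<Longrightarrow> norm y \<le> r0 \<Longrightarrow>
    norm (ps_eval c (x, y) - ev ?T x y) \<le> E * max (norm x) (norm y) ^ K"
    using ps_eval_trunc_error[OF c] by blast
  define \<delta> where "\<delta> = min (min e1 e2) (min r0 (1 / 2))"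
  have \<delta>: "0 < \<delta>" "\<delta> \<le> e1" "\<delta> \<le> e2" "\<delta> \<le> r0" "\<delta> \<le> 1 / 2" using e1 e2 c by (auto simp: \<delta>_def)
  define U where "U = {-\<delta><..<\<delta>} \<times> {-\<delta><..<\<delta>}"
  have U: "open U" "(0 :: real \<times> real) \<in> U" using \<delta> by (auto simp: U_def open_Times zero_prod_def)
  have UD: "\<bar>x\<bar> \<le> \<delta>" "\<bar>y\<bar> \<le> \<delta>" "\<bar>x\<bar> \<le> 1" "\<forall>j\<in>I. \<bar>y + poly (q j) x\<bar> \<le> 1" if "(x, y) \<in> U" for x y
  proof -
    show xy: "\<bar>x\<bar> \<le> \<delta>" "\<bar>y\<bar> \<le> \<delta>" using that by (auto simp: U_def)
    then show "\<bar>x\<bar> \<le> 1" using \<delta> by simp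
    show "\<forall>j\<in>I. \<bar>y + poly (q j) x\<bar> \<le> 1"
    proof
      fix j assume "j \<in> I"
      then have "\<bar>poly (q j) x\<bar> \<le> 1 / 2" using xy \<delta> by (intro e2(2)) auto
      then show "\<bar>y + poly (q j) x\<bar> \<le> 1" using xy \<delta> by linarith
    qed
  qed
  have Pm [measurable]: "?P \<in> borel_measurable borel"
    unfolding factor_def by (intro borel_measurable_continuous_onI continuous_intros)
  have "continuous_on U ?Q"
  proof (rule continuous_on_compose2[OF ps_eval_continuous_on[OF c(1)]])
    show "continuous_on U (\<lambda>z. (complex_of_real (fst z), complex_of_real (snd z)))"
      by (intro continuous_intros)
    show "(\<lambda>z. (complex_of_real (fst z), complex_of_real (snd z))) ` U \<subseteq> {x. norm x \<le> r0} \<times> {y. norm y \<le> r0}"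
      using UD \<delta> by fastforce
  qed
  then have Qm: "(\<lambda>z. indicator U z *\<^sub>R ?Q z) \<in> borel_measurable borel"
    using U(1) by (intro borel_measurable_continuous_on_indicator) auto
  have "(\<lambda>z. (indicator U z *\<^sub>R ?Q z) / ?P z) \<in> borel_measurable borel"
    using Qm by measurable
  moreover have "(\<lambda>z. (indicator U z *\<^sub>R ?Q z) / ?P z) = (\<lambda>z. indicator U z *\<^sub>R (?Q z / ?P z))"
    by (auto simp: fun_eq_iff scaleR_conv_of_real)
  ultimately have meas: "(\<lambda>z. indicator U z *\<^sub>R (?Q z / ?P z)) \<in> borel_measurable borel"
    by (simp only:)
  define F where "F z = indicator U z *\<^sub>R norm (?Q z / ?P z) powr p" for z
  have "F = (\<lambda>z. norm (indicator U z *\<^sub>R (?Q z / ?P z)) powr p)"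
    using p by (auto simp: F_def fun_eq_iff indicator_def)
  moreover have "(\<lambda>z. norm (indicator U z *\<^sub>R (?Q z / ?P z)) powr p) \<in> borel_measurable borel"
    using meas by measurable
  ultimately have Fm: "F \<in> borel_measurable borel" by (simp only:)
  \<comment> \<open>The cap at 1 makes \<eta> - 1 nonpositive, so the singular factors are at least
    1 and also absorb the constant bound on the tail.\<close>
  define \<eta> where "\<eta> = min 1 e1"
  define B where "B = 2 powr p * (1 / e1 + (E / k) powr p)"
  have B: "0 \<le> B" using e1(1) by (simp add: B_def)
  have "integrable lborel F"
  proof (rule integrable_of_singular_majorant[where g = "\<lambda>j. poly (q j)" and I = I and B = B and \<eta> = \<eta>, OF Fm])
    show "0 \<le> F z" for z by (simp add: F_def)
    show "poly (q j) \<in> borel_measurable borel" for j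
      by (intro borel_measurable_continuous_onI continuous_intros)
    show "\<bar>x\<bar> \<le> 1 \<and> (\<forall>j\<in>I. \<bar>y + poly (q j) x\<bar> \<le> 1)" if "F (x, y) \<noteq> 0" for x y
    proof -
      have "(x, y) \<in> U" using that by (auto simp: F_def indicator_def split: if_splits)
      then show ?thesis using UD by blast
    qed
    show "F (x, y) \<le> B * \<bar>x\<bar> powr (\<eta> - 1) * (\<Sum>j\<in>I. \<bar>y + poly (q j) x\<bar> powr (\<eta> - 1))"
      if x: "x \<noteq> 0" and t: "\<forall>j\<in>I. y + poly (q j) x \<noteq> 0" and x1: "\<bar>x\<bar> \<le> 1" and t1: "\<forall>j\<in>I. \<bar>y + poly (q j) x\<bar> \<le> 1" for x y
    proof (cases "(x, y) \<in> U")
      case False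
      then show ?thesis using B by (simp add: F_def sum_nonneg)
    next
      case True
      note xy = UD[OF True]
      obtain j where j: "j \<in> I" "\<forall>i\<in>I. norm (factor L q j (x, y)) \<le> norm (factor L q i (x, y))"
        using ex_min_if_finite[of "(\<lambda>i. norm (factor L q i (x, y))) ` I"] I by (force simp: not_less)
      let ?D = "\<Prod>i\<in>I. norm (factor L q i (x, y))"
      let ?t = "\<bar>y + poly (q j) x\<bar>"
      have kD: "k * max \<bar>x\<bar> \<bar>y\<bar> ^ K \<le> ?D" using k(2)[OF x1 t1] .
      have m: "0 < max \<bar>x\<bar> \<bar>y\<bar> ^ K" using x by (intro zero_less_power) (auto simp: less_max_iff_disj)
      have D: "0 < ?D" using kD mult_pos_pos[OF k(1) m] by linarith
      have "norm (?Q (x, y) - ev ?T (complex_of_real x) (complex_of_real y)) \<le> E * max \<bar>x\<bar> \<bar>y\<bar> ^ K"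
        using E(2)[of "complex_of_real x" "complex_of_real y"] xy \<delta> by simp
      also have "\<dots> = E / k * (k * max \<bar>x\<bar> \<bar>y\<bar> ^ K)" using k(1) by simp
      also have "\<dots> \<le> E / k * ?D" using kD E(1) k(1) by (intro mult_left_mono) auto
      finally have "norm (?Q (x, y)) \<le> norm (ev ?T (complex_of_real x) (complex_of_real y)) + E / k * ?D"
        using norm_triangle_sub[of "?Q (x, y)" "ev ?T (complex_of_real x) (complex_of_real y)"] by linarith
      then have "norm (?Q (x, y) / ?P (x, y)) \<le> ?R x y + E / k"
        using D by (simp add: norm_divide prod_norm[symmetric] divide_le_eq distrib_right)
      then have "F (x, y) \<le> (?R x y + E / k) powr p"
        using True p by (simp add: F_def powr_mono2)
      also have "\<dots> \<le> 2 powr p * (?R x y powr p + (E / k) powr p)"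
        using D E(1) k(1) p by (intro powr_add_le) auto
      also have "\<dots> \<le> 2 powr p * ((1 / e1 + (E / k) powr p) * (\<bar>x\<bar> powr (\<eta> - 1) * ?t powr (\<eta> - 1)))"
      proof (intro mult_left_mono)
        have t0: "0 < ?t" "?t \<le> 1" using t t1 j by auto
        have x0: "0 < \<bar>x\<bar>" using x by simp
        have "?R x y powr p \<le> 1 / e1 * \<bar>x\<bar> powr (e1 - 1) * ?t powr (e1 - 1)"
          using xy \<delta> t0 x0 j by (intro e1(2)) auto
        also have "\<dots> \<le> 1 / e1 * \<bar>x\<bar> powr (\<eta> - 1) * ?t powr (\<eta> - 1)"
          using e1(1) x0 x1 t0 by (intro mult_mono powr_mono') (auto simp: \<eta>_def)
        finally have 1: "?R x y powr p \<le> 1 / e1 * (\<bar>x\<bar> powr (\<eta> - 1) * ?t powr (\<eta> - 1))" by simp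
        have "1 * 1 \<le> \<bar>x\<bar> powr (\<eta> - 1) * ?t powr (\<eta> - 1)"
        proof (rule mult_mono)
          have ge1: "1 \<le> u powr (\<eta> - 1)" if "0 < u" "u \<le> 1" for u :: real
            using powr_mono'[of "\<eta> - 1" 0 u] that by (simp add: \<eta>_def)
          show "1 \<le> \<bar>x\<bar> powr (\<eta> - 1)" "1 \<le> ?t powr (\<eta> - 1)"
            using ge1 x0 x1 t0 by auto
        qed auto
        then have "(E / k) powr p * 1 \<le> (E / k) powr p * (\<bar>x\<bar> powr (\<eta> - 1) * ?t powr (\<eta> - 1))"
          by (intro mult_left_mono) auto
        with 1 show "?R x y powr p + (E / k) powr p \<le> (1 / e1 + (E / k) powr p) * (\<bar>x\<bar> powr (\<eta> - 1) * ?t powr (\<eta> - 1))"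
          by (simp add: distrib_right)
      qed simp
      also have "\<dots> = B * \<bar>x\<bar> powr (\<eta> - 1) * ?t powr (\<eta> - 1)" by (simp add: B_def)
      \<comment> \<open>The minimal j depends on the point; the sum over all j dominates without
        partitioning the plane.\<close>
      also have "\<dots> \<le> B * \<bar>x\<bar> powr (\<eta> - 1) * (\<Sum>j\<in>I. \<bar>y + poly (q j) x\<bar> powr (\<eta> - 1))"
        using B I(1) j(1) by (intro mult_left_mono member_le_sum) auto
      finally show ?thesis .
    qed
  qed (use I B e1(1) in \<open>auto simp: \<eta>_def\<close>)
  then have "set_integrable lborel U (\<lambda>z. norm (?Q z / ?P z) powr p)"
    by (simp add: set_integrable_def F_def[abs_def])
  then show ?thesis
    unfolding Lp_loc_def using U meas by (intro exI[of _ U]) simp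
qed

text \<open>N - \<nu> is an integer, so it is below (2 L_j + 1) / p exactly when it is below the
  ceiling. This is where the ceiling and the summand 1 of the criterion come from.\<close>

lemma weight_pos_iff:
  assumes "T \<noteq> 0" "1 \<le> p"
  shows "0 < weight T L q I p j (2 * L j) \<longleftrightarrow>
    (\<forall>(a, b)\<in>supp T (cpoly (q j)).
       (\<Sum>i\<in>I. int (Oij L q i j)) - \<lceil>real (2 * L j + 1) / p\<rceil> + 1 \<le> int (a + 2 * L j * b))"
    (is "_ \<longleftrightarrow> (\<forall>(a, b)\<in>_. ?m \<le> _)")
proof -
  let ?\<nu> = "nu T (cpoly (q j)) (2 * L j)"
  define N where "N = (\<Sum>i\<in>I. Oij L q i j)"
  have N: "(\<Sum>i\<in>I. min (2 * L j) (Oij L q i j)) = N"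
  proof -
    have "Oij L q i j \<le> 2 * L j" for i
      using le_Oij_iff[of "Oij L q i j" L q i j] by simp
    then show ?thesis by (simp add: N_def min_absorb2)
  qed
  have "0 < weight T L q I p j (2 * L j) \<longleftrightarrow> real N - real ?\<nu> < real (2 * L j + 1) / p"
    unfolding weight_def N using assms(2) by (subst pos_less_divide_eq) (auto simp: algebra_simps)
  also have "\<dots> \<longleftrightarrow> int N - int ?\<nu> < \<lceil>real (2 * L j + 1) / p\<rceil>"
    by (simp add: less_ceiling_iff)
  also have "\<dots> \<longleftrightarrow> ?m \<le> int ?\<nu>" by (auto simp: N_def)
  also have "\<dots> \<longleftrightarrow> (\<forall>(a, b)\<in>supp T (cpoly (q j)). ?m \<le> int (a + 2 * L j * b))"
  proof
    assume m: "?m \<le> int ?\<nu>"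
    have "?m \<le> int (a + 2 * L j * b)" if "(a, b) \<in> supp T (cpoly (q j))" for a b
      using nu_le[OF that, of "2 * L j"] m by linarith
    then show "\<forall>(a, b)\<in>supp T (cpoly (q j)). ?m \<le> int (a + 2 * L j * b)" by blast
  next
    assume H: "\<forall>(a, b)\<in>supp T (cpoly (q j)). ?m \<le> int (a + 2 * L j * b)"
    obtain b where "coeff (lform T (cpoly (q j)) (2 * L j)) b \<noteq> 0"
      using lform_nonzero[OF assms(1)] by (metis leading_coeff_0_iff)
    from coeff_lform_supp[OF this] obtain a where
      ab: "(a, b) \<in> supp T (cpoly (q j))" "a + 2 * L j * b = ?\<nu>" by blast
    have "?m \<le> int (a + 2 * L j * b)" using H ab(1) by blast
    then show "?m \<le> int ?\<nu>" by (simp only: ab(2))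
  qed
  finally show ?thesis .
qed

theorem theorem1p4:
  fixes M :: nat and L :: "nat \<Rightarrow> nat" and q :: "nat \<Rightarrow> real poly"
    and p :: real and c :: "nat \<Rightarrow> nat \<Rightarrow> complex"
  assumes "M \<ge> 1"
    and "\<forall>j\<in>{1..M}. L j \<ge> 1"
    and "\<forall>j\<in>{1..M}. degree (q j) < 2 * L j"
    and "\<forall>j\<in>{1..M}. poly (q j) 0 = 0"
    and "1 \<le> p"
    and "conv_ps c"
  shows "Lp_loc p (\<lambda>z. ps_eval c (complex_of_real (fst z), complex_of_real (snd z)) /
            (\<Prod>j\<in>{1..M}. complex_of_real (snd z) + complex_of_real (poly (q j) (fst z))
                             + \<i> * complex_of_real (fst z) ^ (2 * L j)))
     \<longleftrightarrow> (\<forall>j\<in>{1..M}. enat_ge_int (Oval (2 * L j) (map_poly complex_of_real (q j)) c)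
            ((\<Sum>i\<in>{1..M}. int (Oij L q i j)) - \<lceil>real (2 * L j + 1) / p\<rceil> + 1))"
proof -
  define I where "I = {1..M}"
  \<comment> \<open>One K meets two needs: it bounds every sum of the \<open>Oij\<close>, so the
    truncation decides the order conditions, and it is the exponent in the lower bound for
    |P|.\<close>
  define K where "K = (\<Sum>i\<in>I. 2 * L i)"
  define T where "T = trunc c K"
  have I: "finite I" "I \<noteq> {}" using assms(1) by (auto simp: I_def)
  obtain r0 where c: "0 < r0" "ps_summable c r0" using assms(6) by (auto simp: conv_ps_def ps_summable_def)
  let ?m = "\<lambda>j. (\<Sum>i\<in>I. int (Oij L q i j)) - \<lceil>real (2 * L j + 1) / p\<rceil> + 1"
  let ?leaf = "\<lambda>j. \<forall>(a, b)\<in>supp T (cpoly (q j)). ?m j \<le> int (a + 2 * L j * b)"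
  have NK: "(\<Sum>i\<in>I. Oij L q i j) \<le> K" for j
    unfolding K_def using le_Oij_iff[THEN iffD1, OF order_refl] by (intro sum_mono) blast
  have Oval: "enat_ge_int (Oval (2 * L j) (cpoly (q j)) c) (?m j) \<longleftrightarrow> ?leaf j" if j: "j \<in> I" for j
    unfolding T_def
  proof (rule Oval_ge_iff[OF assms(6)])
    show "poly (cpoly (q j)) 0 = 0" using poly_cpoly[of "q j" 0] assms(4) j by (simp add: I_def)
    show "1 \<le> 2 * L j" using assms(2) j by (force simp: I_def)
    \<comment> \<open>The ceiling is at least 1, so the threshold is at most the sum of the
      \<open>Oij\<close> and hence at most K.\<close>
    have "0 < real (2 * L j + 1) / p" using assms(5) by simp
    then have "1 \<le> \<lceil>real (2 * L j + 1) / p\<rceil>" by linarith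
    moreover have "(\<Sum>i\<in>I. int (Oij L q i j)) \<le> int K" using NK[of j] by (simp flip: of_nat_sum)
    ultimately show "?m j \<le> int K" by linarith
  qed
  have "Lp_loc p (\<lambda>z. ps_eval c (complex_of_real (fst z), complex_of_real (snd z)) / (\<Prod>i\<in>I. factor L q i z))
     \<longleftrightarrow> (\<forall>j\<in>I. ?leaf j)"
  proof
    assume Lp: "Lp_loc p (\<lambda>z. ps_eval c (complex_of_real (fst z), complex_of_real (snd z)) / (\<Prod>i\<in>I. factor L q i z))"
    show "\<forall>j\<in>I. ?leaf j"
    proof
      fix j assume j: "j \<in> I"
      show "?leaf j"
      \<comment> \<open>For T = 0 the support is empty and the condition vacuous, while the weight
        would rest on an unspecified \<open>nu\<close>.\<close>
      proof (cases "T = 0")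
        case True
        then show ?thesis by (simp add: supp_def blow_def)
      next
        case False
        have "0 < weight T L q I p j (2 * L j)"
          using Lp_loc_imp_weight_pos[OF I(1) j _ _ assms(5) c(2,1) NK _ Lp] False assms(2,4) j
          by (simp add: T_def I_def)
        then show ?thesis using weight_pos_iff[OF False assms(5)] by blast
      qed
    qed
  next
    assume leaf: "\<forall>j\<in>I. ?leaf j"
    show "Lp_loc p (\<lambda>z. ps_eval c (complex_of_real (fst z), complex_of_real (snd z)) / (\<Prod>i\<in>I. factor L q i z))"
    proof (rule weight_pos_imp_Lp_loc[OF I _ _ assms(5) c(2,1) K_def])
      fix j n assume j: "j \<in> I" "n \<le> 2 * L j" and T: "trunc c K \<noteq> 0"
      show "0 < weight (trunc c K) L q I p j n"
      proof (rule weight_pos[OF T I(1) assms(5)])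
        fix i assume "i \<in> I"
        then show "0 < weight (trunc c K) L q I p i (2 * L i)"
          using weight_pos_iff[OF T assms(5)] leaf unfolding T_def by blast
      qed (use j in auto)
    qed (use assms(2,4) in \<open>auto simp: I_def\<close>)
  qed
  then show ?thesis using Oval by (simp add: factor_def I_def)
qed

end
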